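(* Let $M\ge 1$ be an integer and let $\nu_1,\ldots,\nu_M\ge 0$ be fixed integers (with $\nu_0=0$). Let $K_n(x,y)$ be the correlation kernel of the squared singular values of the product of $M$ complex Ginibre matrices given by the double contour integral in the context. Set $$x_*=\frac{(M+1)^{M+1}}{M^M},\qquad c_2=\frac{(M+1)^{M+\frac23}}{2^{\frac13}M^{M-1}}.$$ Then $$\lim_{n\to\infty}\frac{e^{-2^{-\frac13}(M+1)^{\frac23}\xi n^{\frac13}}}{e^{-2^{-\frac13}(M+1)^{\frac23}\eta n^{\frac13}}}\,n^{M-\frac23}\,c_2\,K_n\left(n^M\left(x_*+\frac{c_2\xi}{n^{\frac23}}\right),\,n^M\left(x_*+\frac{c_2\eta}{n^{\frac23}}\right)\right)=K_{\mathrm{Ai}}(\xi,\eta)$$ uniformly for $\xi$ and $\eta$ in any compact subset of $\mathbb{R}$, where $K_{\mathrm{Ai}}$ is the Airy kernel.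
   Context: Setting: $X_1,\ldots,X_M$ are independent complex random matrices, $X_j$ of size $N_j\times N_{j-1}$ with i.i.d. standard complex Gaussian entries (complex Ginibre matrices), where $N_0=n=\min\{N_0,\ldots,N_M\}$ and $\nu_j=N_j-N_0$ for $j=0,\ldots,M$ (so $\nu_0=0$, $\nu_j\ge0$). The squared singular values of $Y_M=X_M\cdots X_1$ form a determinantal point process on $(0,\infty)$ with correlation kernel, for $x,y>0$, $$K_n(x,y)=\frac{1}{(2\pi i)^2}\int_{-1/2-i\infty}^{-1/2+i\infty}ds\oint_{\Sigma}dt\,\prod_{j=0}^M\frac{\Gamma(s+\nu_j+1)}{\Gamma(t+\nu_j+1)}\,\frac{\Gamma(t-n+1)}{\Gamma(s-n+1)}\,\frac{x^t y^{-s-1}}{s-t},$$ where $\Sigma$ is a closed contour going around $0,1,\ldots,n-1$ once in the positive direction with $\operatorname{Re}t>-1/2$ for $t\in\Sigma$. This formula is taken as the definition of $K_n$. The Airy kernel is $K_{\mathrm{Ai}}(x,y)=\frac{\mathrm{Ai}(x)\mathrm{Ai}'(y)-\mathrm{Ai}'(x)\mathrm{Ai}(y)}{x-y}$, extended continuously to $x=y$, where $\mathrm{Ai}$ is the Airy function. For $\xi,\eta$ in a fixed compact set the arguments of $K_n$ are positive for all large $n$. *)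

theory Defs
  imports "HOL-Complex_Analysis.Complex_Analysis"
begin

definition vertical_line_integral :: "real \<Rightarrow> (complex \<Rightarrow> complex) \<Rightarrow> complex" where
  "vertical_line_integral c f = \<i> * (LINT u|lborel. f (Complex c u))"

text \<open>Going around each of the points \<open>0, \<dots>, n - 1\<close> once in the positive direction is
  rendered by winding number one. The conditions exclude all poles of the kernel integrand
  from the path, so that the junk value of \<^term>\<open>Gamma :: complex \<Rightarrow> complex\<close> at its
  poles is never used.\<close>

definition kernel_contour :: "nat \<Rightarrow> (real \<Rightarrow> complex) \<Rightarrow> bool" where
  "kernel_contour n \<gamma> \<longleftrightarrow>
     valid_path \<gamma> \<and> pathfinish \<gamma> = pathstart \<gamma> \<and>
     (\<forall>t\<in>path_image \<gamma>. Re t > -1/2) \<and>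
     (\<forall>k<n. of_nat k \<notin> path_image \<gamma> \<and> winding_number \<gamma> (of_nat k) = 1)"

definition kernel_integrand ::
    "nat \<Rightarrow> (nat \<Rightarrow> nat) \<Rightarrow> nat \<Rightarrow> real \<Rightarrow> real \<Rightarrow> complex \<Rightarrow> complex \<Rightarrow> complex" where
  "kernel_integrand M \<nu> n x y s t =
     (\<Prod>j=0..M. Gamma (s + of_nat (\<nu> j) + 1) / Gamma (t + of_nat (\<nu> j) + 1)) *
     (Gamma (t - of_nat n + 1) / Gamma (s - of_nat n + 1)) *
     (of_real x powr t * of_real y powr (- s - 1) / (s - t))"

text \<open>By Cauchy's theorem the value does not depend on the choice of a path \<open>\<gamma>\<close> satisfying
  \<^term>\<open>kernel_contour n \<gamma>\<close>; the kernel is nevertheless kept as a function of the path.\<close>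

definition product_kernel ::
    "nat \<Rightarrow> (nat \<Rightarrow> nat) \<Rightarrow> nat \<Rightarrow> (real \<Rightarrow> complex) \<Rightarrow> real \<Rightarrow> real \<Rightarrow> complex" where
  "product_kernel M \<nu> n \<gamma> x y =
     1 / (2 * of_real pi * \<i>)\<^sup>2 *
     vertical_line_integral (-1/2)
       (\<lambda>s. contour_integral \<gamma> (\<lambda>t. kernel_integrand M \<nu> n x y s t))"

lemma kernel_contour_circlepath:
  assumes "n \<ge> 1"
  shows "kernel_contour n (circlepath (of_real ((real n - 1) / 2)) (real n / 2 - 1 / 4))"
proof -
  let ?z = "complex_of_real ((real n - 1) / 2)" and ?r = "real n / 2 - 1 / 4"
  have r: "?r > 0" using assms by (simp add: field_simps)
  have inside: "cmod (of_nat k - ?z) < ?r" if "k < n" for k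
  proof -
    have "cmod (of_nat k - ?z) = \<bar>real k - (real n - 1) / 2\<bar>"
      by (metis norm_of_real of_real_diff of_real_of_nat_eq)
    moreover have "real k \<le> real n - 1" using that by linarith
    ultimately show ?thesis by (auto simp: abs_if field_simps)
  qed
  have "Re t > -1/2" if "t \<in> path_image (circlepath ?z ?r)" for t
  proof -
    have "cmod (?z - t) = ?r" using that r by (auto simp: path_image_circlepath dist_norm)
    then have "Re ?z - Re t \<le> ?r" by (metis complex_Re_le_cmod minus_complex.sel(1))
    then show ?thesis by (simp add: field_simps)
  qed
  moreover have "of_nat k \<notin> path_image (circlepath ?z ?r)" if "k < n" for k
    using inside[OF that] r by (auto simp: path_image_circlepath dist_norm norm_minus_commute)
  ultimately show ?thesis
    unfolding kernel_contour_def using inside by (auto intro!: winding_number_circlepath)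
qed

definition ray_integral :: "real \<Rightarrow> (complex \<Rightarrow> complex) \<Rightarrow> complex" where
  "ray_integral \<theta> f = (LINT r:{0..}|lborel. cis \<theta> * f (of_real r * cis \<theta>))"

text \<open>The standard contour integral
  $\frac{1}{2\pi i}\int_{\infty e^{-\pi i/3}}^{\infty e^{\pi i/3}} e^{t^3/3 - zt}\,dt$,
  with the path chosen as the incoming ray at angle \<open>- pi / 3\<close> to the origin followed by the
  outgoing ray at angle \<open>pi / 3\<close>.\<close>

definition Airy_Ai :: "complex \<Rightarrow> complex" where
  "Airy_Ai z =
     1 / (2 * of_real pi * \<i>) *
     (ray_integral (pi / 3) (\<lambda>t. exp (t ^ 3 / 3 - z * t)) -
      ray_integral (- pi / 3) (\<lambda>t. exp (t ^ 3 / 3 - z * t)))"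

definition Airy_quotient :: "real \<Rightarrow> real \<Rightarrow> complex" where
  "Airy_quotient x y =
     (Airy_Ai (of_real x) * deriv Airy_Ai (of_real y) -
      deriv Airy_Ai (of_real x) * Airy_Ai (of_real y)) / of_real (x - y)"

definition Airy_kernel :: "real \<Rightarrow> real \<Rightarrow> complex" where
  "Airy_kernel x y =
     (if x \<noteq> y then Airy_quotient x y
      else Lim (at (x, x) within {(u, v). u \<noteq> v}) (\<lambda>(u, v). Airy_quotient u v))"

definition x_star :: "nat \<Rightarrow> real" where
  "x_star M = (real M + 1) ^ (M + 1) / real M ^ M"

definition c2 :: "nat \<Rightarrow> real" where
  "c2 M = (real M + 1) powr (real M + 2/3) / (2 powr (1/3) * real M ^ (M - 1))"

end

theory Submission
  imports Defs "HOL-Probability.Sinc_Integral" "HOL-Real_Asymp.Real_Asymp"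
begin

text \<open>
Write log F for the logarithm of prod_j Gamma(s + nu_j + 1) / Gamma(s - n + 1).  Its derivative is
(M + 1) log s - log (s - n) + O(1/n), so with s = n w the phase log F(s) - s log(n^M x_*) is n g(w) + O(1)
up to a constant that cancels in F(s) / F(t), and the derivative of g has a double zero at w0 = (M + 1) / M; no Stirling
formula is needed.  The s-line is moved to the right of the t-contour: the poles in between are cancelled
by the zeros of F at 0, ..., n - 1.  It then runs vertically at distance of order n^(2/3) from n w0, while
the t-contour is a pentagon with a corner at n w0 and sides leaving at angles +-3 pi / 4.  On the scale
n^(2/3) both integrands converge with exponential domination to exp(sigma^3/3 - eta sigma) and
exp(-tau^3/3 + xi tau).  The limiting double integral of these over sigma - tau equals the Airy kernel by
an integration by parts with d/dsigma + d/dtau.  Convergence is proved along arbitrary sequences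
n_k -> infinity, (xi_k, eta_k) -> (xi, eta), which gives continuity of the limit and uniformity on compacts.
\<close>

section \<open>Estimates for the Gamma and digamma functions\<close>

text \<open>Three obstacles shape the estimates. On the vertical line through the double critical
  point the cubic term of the phase is purely imaginary and gives no decay; displacing the line by
  one Airy unit turns it into a Gaussian and also keeps the real part of \<open>s - t\<close> at
  least one unit. Next, the logarithmic approximation of F is only available away from the part of
  the real axis that carries its zeros and poles. The left side of the pentagon crosses the real
  axis at -1/2, so there F is merely compared with its value at a corner, through the monotonicity
  of the modulus of Gamma in the imaginary direction. Third, descent has to hold along whole
  contours and for every M, not only near the critical point. The dimensions of the pentagon make
  this explicit: a side leaving w0 = 1 + e, with e = 1 / M, at angle 3 pi / 4 meets real part 1 at
  height e, and at that height all points with real part between -1 and 1 satisfy |w| \<le> w0 and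
  |w - 1| \<ge> e, where w0 itself gives equality in both.\<close>

text \<open>In Euler's limit formula the numerator has a modulus depending on the real part only,
  while every factor of the \<open>pochhammer\<close> denominator grows in modulus with the
  imaginary part. The inequality passes to the limit.\<close>

lemma norm_Gamma_antimono_Im:
  assumes "a > 0" "\<bar>v\<bar> \<le> \<bar>V\<bar>"
  shows "norm (Gamma (Complex a V)) \<le> norm (Gamma (Complex a v))"
proof (rule LIMSEQ_le)
  show "(\<lambda>n. norm (Gamma_series (Complex a V) n)) \<longlonglongrightarrow> norm (Gamma (Complex a V))"
    by (intro tendsto_intros)
  show "(\<lambda>n. norm (Gamma_series (Complex a v) n)) \<longlonglongrightarrow> norm (Gamma (Complex a v))"
    by (intro tendsto_intros)
  have *: "norm (pochhammer (Complex a v) n) \<le> norm (pochhammer (Complex a V) n)"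
    "norm (pochhammer (Complex a v) n) > 0" for n
  proof -
    have "norm (Complex a v + of_nat k) \<le> norm (Complex a V + of_nat k)" for k
      using assms by (auto simp: cmod_def intro: abs_le_square_iff[THEN iffD1])
    then show "norm (pochhammer (Complex a v) n) \<le> norm (pochhammer (Complex a V) n)"
      unfolding pochhammer_prod prod_norm [symmetric] by (intro prod_mono) auto
    have "Complex a v + of_nat k \<noteq> 0" for k
      using assms(1) by (auto simp: complex_eq_iff)
    then show "norm (pochhammer (Complex a v) n) > 0"
      unfolding pochhammer_prod prod_norm [symmetric] by (intro prod_pos) auto
  qed
  have "norm (Gamma_series (Complex a V) n) \<le> norm (Gamma_series (Complex a v) n)" for n
    using *[of "n+1"] by (auto simp: Gamma_series_def norm_mult norm_divide
      intro!: divide_left_mono mult_pos_pos simp del: pochhammer_Suc)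
  then show "\<exists>N. \<forall>n\<ge>N. norm (Gamma_series (Complex a V) n) \<le> norm (Gamma_series (Complex a v) n)"
    by blast
qed

lemma norm_Gamma_le_Gamma_Re:
  assumes "Re z > 0"
  shows "norm (Gamma z) \<le> Gamma (Re z)"
proof -
  have "norm (Gamma (Complex (Re z) (Im z))) \<le> norm (Gamma (Complex (Re z) 0))"
    using assms by (intro norm_Gamma_antimono_Im) auto
  also have "Complex (Re z) 0 = of_real (Re z)" by (simp add: complex_eq_iff)
  finally show ?thesis
    using assms by (simp add: Gamma_complex_of_real)
qed

text \<open>The functional equation moves \<open>z\<close> to the right by \<open>N\<close>, and
  each of the \<open>N\<close> factors divided out is at least the imaginary part. This yields decay
  of every polynomial order, which is all that moving the s-line requires.\<close>

lemma norm_Gamma_le_powr_Im: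
  assumes "Re z > 0" "Im z \<noteq> 0"
  shows "norm (Gamma z) \<le> Gamma (Re z + real N) / \<bar>Im z\<bar> ^ N"
proof -
  have z: "z \<notin> \<int>\<^sub>\<le>\<^sub>0" using assms by (auto elim!: nonpos_Ints_cases)
  have "\<bar>Im z\<bar> \<le> norm (z + of_nat k)" for k
    using abs_Im_le_cmod[of "z + of_nat k"] by simp
  then have *: "\<bar>Im z\<bar> ^ N \<le> norm (pochhammer z N)"
    unfolding pochhammer_prod prod_norm [symmetric]
    using prod_mono[of "{0..<N}" "\<lambda>_. \<bar>Im z\<bar>" "\<lambda>k. norm (z + of_nat k)"] by simp
  have "Gamma z \<noteq> 0" using z by (simp add: Gamma_eq_zero_iff)
  then have "norm (pochhammer z N) * norm (Gamma z) = norm (Gamma (z + of_nat N))"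
    using pochhammer_Gamma[OF z, of N] by (simp add: norm_divide)
  also have "\<dots> \<le> Gamma (Re z + real N)"
    using norm_Gamma_le_Gamma_Re[of "z + of_nat N"] assms by simp
  finally have "norm (pochhammer z N) * norm (Gamma z) \<le> Gamma (Re z + real N)" .
  moreover have "\<bar>Im z\<bar> ^ N * norm (Gamma z) \<le> norm (pochhammer z N) * norm (Gamma z)"
    using * by (intro mult_right_mono) auto
  ultimately show ?thesis using assms by (simp add: field_simps)
qed

section \<open>The digamma function against the logarithm\<close>

lemma sum_inverse_square_le:
  fixes r :: real
  assumes "r \<ge> 1"
  shows "(\<Sum>k<m. 1 / (r + real k)\<^sup>2) \<le> 2 / r"
proof -
  have *: "1 / (y + 1)\<^sup>2 \<le> 1 / y - 1 / (y + 1)" if "y > 0" for y :: real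
  proof -
    have "1 / y - 1 / (y + 1) = 1 / (y * (y + 1))"
      using that by (simp add: field_simps)
    also have "\<dots> \<ge> 1 / (y + 1)\<^sup>2"
      using that by (intro divide_left_mono) (auto simp: power2_eq_square)
    finally show ?thesis .
  qed
  \<comment> \<open>The subtracted term is what remains of the telescoping sum and makes the
    induction close; the first summand accounts for the second \<open>1 / r\<close>.\<close>
  have le: "(\<Sum>k<Suc m. 1 / (r + real k)\<^sup>2) \<le> 2 / r - 1 / (r + real m)" for m
  proof (induction m)
    case 0
    have "1 / r\<^sup>2 \<le> 1 / r" using assms by (intro divide_left_mono) (auto simp: power2_eq_square)
    then show ?case by simp
  next
    case (Suc m)
    then show ?case using *[of "r + real m"] assms by (simp add: add_ac)
  qed
  show ?thesis
  proof (cases m)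
    case (Suc m')
    have "1 / (r + real m') \<ge> 0" using assms by simp
    then show ?thesis using le[of m'] unfolding Suc by linarith
  qed (use assms in simp)
qed

text \<open>The hypothesis is a sector condition: it says that \<open>z\<close> keeps away from the negative real axis.\<close>

lemma norm_Digamma_minus_Ln_le:
  fixes z :: complex
  assumes d: "\<delta> > 0" and zd: "\<And>x. x \<ge> 0 \<Longrightarrow> \<delta> * (norm z + x) \<le> norm (z + of_real x)"
    and z1: "norm z \<ge> 1" "\<delta> * norm z \<ge> 2" and zn: "z \<notin> \<real>\<^sub>\<le>\<^sub>0"
  shows "norm (Digamma z - Ln z) \<le> (4 / \<delta>\<^sup>2) / norm z"
proof -
  let ?D = "\<lambda>m. of_real (ln (real m)) - (\<Sum>n<m. inverse (z + of_nat n))"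
  have zk: "z + of_nat k \<notin> \<real>\<^sub>\<le>\<^sub>0" for k
    using zn by (auto simp: complex_nonpos_Reals_iff)
  then have zk0: "z + of_nat k \<noteq> 0" for k
    by (metis nonpos_Reals_zero_I)
  have step: "Ln (z + of_nat (Suc k)) - Ln (z + of_nat k) = Ln (1 + inverse (z + of_nat k))" for k
  proof -
    have e: "1 + inverse (z + of_nat k) = (z + of_nat (Suc k)) / (z + of_nat k)"
      using zk0[of k] by (simp add: field_simps)
    \<comment> \<open>Both points lie on the same side of the real axis or on its positive half, so
      their arguments differ by less than pi and the difference of the principal logarithms is again
      a principal logarithm.\<close>
    have a: "\<bar>Im (Ln (z + of_nat (Suc k))) - Im (Ln (z + of_nat k))\<bar> < pi"
    proof (cases "Im z" "0::real" rule: linorder_cases)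
      case less
      have "Im (Ln (z + of_nat j)) < 0 \<and> -pi < Im (Ln (z + of_nat j))" for j
        using less zk0[of j] Im_Ln_pos_le[of "z + of_nat j"] mpi_less_Im_Ln[of "z + of_nat j"]
          Im_Ln_le_pi[of "z + of_nat j"] by (auto simp: not_le)
      from this[of k] this[of "Suc k"] show ?thesis by linarith
    next
      case equal
      then have "Re z > 0" using zn by (auto simp: complex_nonpos_Reals_iff)
      then have "Im (Ln (z + of_nat j)) = 0" for j
        using equal zk0[of j] by (simp add: Im_Ln_eq_0)
      from this[of k] this[of "Suc k"] show ?thesis by (simp del: of_nat_Suc)
    next
      case greater
      have "0 < Im (Ln (z + of_nat j)) \<and> Im (Ln (z + of_nat j)) < pi" for j
        using greater zk0[of j] Im_Ln_pos_lt[of "z + of_nat j"] by auto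
      from this[of k] this[of "Suc k"] show ?thesis by linarith
    qed
    have "Ln ((z + of_nat (Suc k)) / (z + of_nat k)) = Ln (z + of_nat (Suc k)) - Ln (z + of_nat k)"
      by (rule Ln_unique) (use a zk0[of k] zk0[of "Suc k"] in \<open>auto simp: exp_diff simp del: of_nat_Suc\<close>)
    then show ?thesis by (simp add: e)
  qed
  have sum: "Ln (z + of_nat m) - Ln z = (\<Sum>k<m. Ln (1 + inverse (z + of_nat k)))" for m
    using sum_lessThan_telescope[of "\<lambda>k. Ln (z + of_nat k)" m] by (simp add: step del: of_nat_Suc)
  \<comment> \<open>The limit formula for \<open>Digamma\<close> subtracts the sum from
    \<open>ln m\<close>, whereas the telescoped sum ends in \<open>Ln (z + m)\<close>; the two agree
    in the limit.\<close>
  have lim0: "(\<lambda>m. Ln (z + of_nat m) - of_real (ln (real m))) \<longlonglongrightarrow> 0"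
  proof (rule Lim_transform_eventually)
    have "(\<lambda>m. z / of_nat m) \<longlonglongrightarrow> 0" by (rule lim_const_over_n)
    then have "(\<lambda>m. Ln (1 + z / of_nat m)) \<longlonglongrightarrow> Ln (1 + 0)"
      by (intro tendsto_intros) auto
    then show "(\<lambda>m. Ln (1 + z / of_nat m)) \<longlonglongrightarrow> 0" by simp
    show "\<forall>\<^sub>F m in sequentially. Ln (1 + z / of_nat m) = Ln (z + of_nat m) - of_real (ln (real m))"
      using eventually_gt_at_top[of 0]
    proof eventually_elim
      case (elim m)
      have "1 + z / of_nat m = of_real (1 / real m) * (z + of_nat m)"
        using elim by (simp add: field_simps)
      then have "Ln (1 + z / of_nat m) = of_real (ln (1 / real m)) + Ln (z + of_nat m)"
        using elim zk0[of m] Ln_times_of_real[of "1 / real m" "z + of_nat m"] Ln_of_real[of "1 / real m"]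
        by (simp only:) simp
      then show ?case using elim by (simp add: ln_div)
    qed
  qed
  have "(\<lambda>m. ?D m + (Ln (z + of_nat m) - of_real (ln (real m))) - Ln z) \<longlonglongrightarrow> Digamma z + 0 - Ln z"
    using zn by (intro tendsto_intros lim0 Digamma_LIMSEQ) auto
  then have lim: "(\<lambda>m. \<Sum>k<m. Ln (1 + inverse (z + of_nat k)) - inverse (z + of_nat k)) \<longlonglongrightarrow> Digamma z - Ln z"
    using sum by (simp add: sum_subtractf algebra_simps)
  have "norm (\<Sum>k<m. Ln (1 + inverse (z + of_nat k)) - inverse (z + of_nat k)) \<le> (4 / \<delta>\<^sup>2) / norm z" for m
  proof -
    \<comment> \<open>The linear terms have cancelled, so each summand is quadratic in
      \<open>inverse (z + k)\<close>. The assumption \<open>\<delta> * norm z \<ge> 2\<close> keeps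
      this inverse at most 1/2.\<close>
    have term_le: "norm (Ln (1 + inverse (z + of_nat k)) - inverse (z + of_nat k)) \<le> (2 / \<delta>\<^sup>2) * (1 / (norm z + real k)\<^sup>2)" for k
    proof -
      let ?u = "inverse (z + of_nat k)"
      have n: "\<delta> * (norm z + real k) \<le> norm (z + of_nat k)"
        using zd[of "real k"] by simp
      moreover have "\<delta> * norm z \<le> \<delta> * (norm z + real k)"
        using d by (simp add: algebra_simps)
      ultimately have "norm (z + of_nat k) \<ge> 2" using z1 by linarith
      then have u2: "norm ?u \<le> 1/2" by (simp add: norm_inverse inverse_le_1_iff le_imp_inverse_le[of 2, simplified])
      have pos: "\<delta> * (norm z + real k) > 0" using d z1 by (intro mult_pos_pos) auto
      have le: "norm ?u \<le> 1 / (\<delta> * (norm z + real k))"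
        unfolding norm_inverse using le_imp_inverse_le[OF n pos] by (simp add: inverse_eq_divide)
      have "norm (Ln (1 + ?u) - ?u) \<le> norm ?u ^ 2 / (1 - norm ?u)"
        using u2 by (intro Ln_approx_linear) auto
      also have "\<dots> \<le> norm ?u ^ 2 / (1/2)"
        using u2 by (intro divide_left_mono) auto
      also have "\<dots> \<le> (1 / (\<delta> * (norm z + real k)))\<^sup>2 / (1/2)"
        by (intro divide_right_mono power_mono) (use le in auto)
      finally show ?thesis
        using d by (simp add: power_mult_distrib power_divide)
    qed
    have "norm (\<Sum>k<m. Ln (1 + inverse (z + of_nat k)) - inverse (z + of_nat k)) \<le> (\<Sum>k<m. (2 / \<delta>\<^sup>2) * (1 / (norm z + real k)\<^sup>2))"
      by (rule order_trans[OF norm_sum sum_mono]) (rule term_le)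
    also have "\<dots> = (2 / \<delta>\<^sup>2) * (\<Sum>k<m. 1 / (norm z + real k)\<^sup>2)"
      by (simp add: sum_distrib_left)
    also have "\<dots> \<le> (2 / \<delta>\<^sup>2) * (2 / norm z)"
      using z1 by (intro mult_left_mono sum_inverse_square_le) auto
    finally show ?thesis by simp
  qed
  then show ?thesis
    by (intro LIMSEQ_le_const2[OF tendsto_norm[OF lim]]) auto
qed

section \<open>Line and ray integrals\<close>

text \<open>This is the majorant for the scaled integrals, on the line as well as on the
  rays.\<close>

lemma integrable_exp_minus_abs: "integrable lborel (\<lambda>v::real. exp (- \<bar>v\<bar>))"
proof -
  have 1: "set_integrable lborel {0<..} (\<lambda>x::real. exp (- x))"
    using has_bochner_integral_I0i_power_exp_m[of 0]
    by (simp add: set_integrable_def indicator_def mult.commute integrable.intros)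
  then have 2: "integrable lborel (\<lambda>x::real. indicator {0<..} (0 + (-1) * x) *\<^sub>R exp (- (0 + (-1) * x)))"
    unfolding set_integrable_def
    by (subst lborel_integrable_real_affine_iff[of "-1" "\<lambda>x. indicator {0<..} x *\<^sub>R exp (- x)" 0]) auto
  have "integrable lborel (\<lambda>x::real. indicator {0<..} x *\<^sub>R exp (- x) + indicator {0<..} (0 + (-1) * x) *\<^sub>R exp (- (0 + (-1) * x)))"
    using 1 2 unfolding set_integrable_def by (rule Bochner_Integration.integrable_add)
  then show ?thesis
  proof (rule integrable_cong_AE_imp)
    have "AE x in lborel. (x::real) \<noteq> 0" by (rule AE_lborel_singleton)
    then show "AE x::real in lborel. indicator {0<..} x *\<^sub>R exp (- x) + indicator {0<..} (0 + (-1) * x) *\<^sub>R exp (- (0 + (-1) * x)) = exp (- \<bar>x\<bar>)"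
      by eventually_elim (auto simp: indicator_def)
  qed simp
qed

text \<open>Completing the square with two extra units of slope gives \<open>exp (- 2 * r)\<close>.
  One unit absorbs the power, since \<open>r ^ k \<le> fact k * exp r\<close>; the other is kept as
  decay.\<close>

lemma exp_gauss_le:
  fixes c A r :: real
  assumes "c > 0" "r \<ge> 0"
  shows "r ^ k * exp (A * r - c * r\<^sup>2) \<le> fact k * exp ((A + 2)\<^sup>2 / (4 * c)) * exp (- r)"
proof -
  have "r ^ k / fact k \<le> exp r"
  proof -
    have "(\<Sum>n\<in>{k}. r ^ n /\<^sub>R fact n) \<le> (\<Sum>n. r ^ n /\<^sub>R fact n)"
      using assms by (intro sum_le_suminf summable_exp_generic) auto
    then have "r ^ k /\<^sub>R fact k \<le> exp r" by (simp add: exp_def)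
    then show ?thesis by (simp add: field_simps)
  qed
  then have "r ^ k \<le> fact k * exp r" by (simp add: field_simps)
  moreover have "A * r - c * r\<^sup>2 \<le> (A + 2)\<^sup>2 / (4 * c) - 2 * r"
  proof -
    have "(A + 2)\<^sup>2 / (4 * c) - 2 * r - (A * r - c * r\<^sup>2) = (2 * c * r - (A + 2))\<^sup>2 / (4 * c)"
      using assms by (simp add: field_simps power2_eq_square)
    also have "\<dots> \<ge> 0" using assms by simp
    finally show ?thesis by simp
  qed
  ultimately have "r ^ k * exp (A * r - c * r\<^sup>2) \<le> (fact k * exp r) * exp ((A + 2)\<^sup>2 / (4 * c) - 2 * r)"
    using assms by (intro mult_mono) auto
  also have "\<dots> = fact k * exp ((A + 2)\<^sup>2 / (4 * c)) * exp (- r)"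
    by (simp add: exp_diff exp_minus field_simps flip: exp_add)
  finally show ?thesis .
qed

lemma integrable_lborel_exp_bound:
  fixes f :: "real \<Rightarrow> complex"
  assumes "f \<in> borel_measurable borel" "\<And>v. norm (f v) \<le> C * exp (- \<bar>v\<bar>)"
  shows "integrable lborel f"
proof (rule Bochner_Integration.integrable_bound)
  show "integrable lborel (\<lambda>v. C * exp (- \<bar>v\<bar>))"
    using integrable_exp_minus_abs by simp
  show "AE v in lborel. norm (f v) \<le> norm (C * exp (- \<bar>v\<bar>))"
    using assms(2) by (auto intro!: AE_I2 order_trans[OF assms(2) abs_ge_self])
qed (use assms in simp)

lemma set_integrable_Ici_exp_bound:
  fixes f :: "real \<Rightarrow> complex"
  assumes "continuous_on {0..} f" "\<And>v. v \<ge> 0 \<Longrightarrow> norm (f v) \<le> C * exp (- v)"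
  shows "set_integrable lborel {0..} f"
  unfolding set_integrable_def
proof (rule integrable_lborel_exp_bound[where C = "C"])
  show "(\<lambda>x. indicat_real {0..} x *\<^sub>R f x) \<in> borel_measurable borel"
    using assms(1) by (rule borel_measurable_continuous_on_indicator[rotated]) auto
  have "0 \<le> C" using order_trans[OF norm_ge_zero assms(2)[of 0]] by simp
  then show "norm (indicat_real {0..} v *\<^sub>R f v) \<le> C * exp (- \<bar>v\<bar>)" for v
    using assms(2)[of v] by (auto simp: indicator_def)
qed

section \<open>Improper integrals through primitives\<close>

text \<open>Expresses an improper integral by boundary values of a primitive. A change of contour
  then only requires comparing values of one primitive at distant points; the ray version below
  serves the same purpose.\<close>

lemma vertical_line_integral_tendsto:
  assumes P: "\<And>z. Re z = c \<Longrightarrow> (P has_field_derivative f z) (at z)"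
    and f: "continuous_on {z. Re z = c} f" "integrable lborel (\<lambda>v. f (Complex c v))"
  shows "((\<lambda>V. P (Complex c V) - P (Complex c (- V))) \<longlongrightarrow> vertical_line_integral c f) at_top"
proof -
  have cmplx: "Complex c v = of_real c + \<i> * of_real v" for v by (simp add: complex_eq_iff)
  have cont: "continuous_on A (\<lambda>v. f (Complex c v))" for A
    by (rule continuous_on_compose2[OF f(1)]) (auto simp: cmplx intro!: continuous_intros)
  have deriv: "((\<lambda>v. P (Complex c v)) has_vector_derivative \<i> * f (Complex c v)) (at v within A)" for v A
  proof -
    have "((\<lambda>v. Complex c v) has_vector_derivative \<i>) (at v within A)"
      unfolding cmplx by (auto intro!: derivative_eq_intros)
    from field_vector_diff_chain_within[OF this, of P "f (Complex c v)"] show ?thesis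
      using P[of "Complex c v"] by (simp add: o_def has_field_derivative_at_within)
  qed
  have eq: "P (Complex c V) - P (Complex c (- V)) = \<i> * (LINT v|lborel. indicator {-V..V} v *\<^sub>R f (Complex c v))"
    if "V \<ge> 0" for V
  proof -
    have "(LINT v|lborel. indicator {-V..V} v *\<^sub>R (\<i> * f (Complex c v))) = P (Complex c V) - P (Complex c (- V))"
      using that by (intro integral_FTC_Icc deriv continuous_intros cont) auto
    then show ?thesis
      by (simp add: mult.commute flip: integral_mult_right_zero mult_scaleR_right)
  qed
  have "((\<lambda>V. LINT v|lborel. indicator {-V..V} v *\<^sub>R f (Complex c v)) \<longlongrightarrow> (LINT v|lborel. f (Complex c v))) at_top"
  proof (rule integral_dominated_convergence_at_top)
    show "integrable lborel (\<lambda>v. norm (f (Complex c v)))" using f(2) by (rule integrable_norm)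
    show "AE v in lborel. ((\<lambda>V. indicator {-V..V} v *\<^sub>R f (Complex c v)) \<longlongrightarrow> f (Complex c v)) at_top"
    proof (rule AE_I2)
      fix v :: real
      have "\<forall>\<^sub>F V in at_top. indicator {-V..V} v *\<^sub>R f (Complex c v) = f (Complex c v)"
        using eventually_ge_at_top[of "\<bar>v\<bar>"] by eventually_elim (auto simp: indicator_def)
      then show "((\<lambda>V. indicator {-V..V} v *\<^sub>R f (Complex c v)) \<longlongrightarrow> f (Complex c v)) at_top"
        by (rule tendsto_eventually)
    qed
    show "\<forall>\<^sub>F i in at_top. AE x in lborel. norm (indicat_real {- i..i} x *\<^sub>R f (Complex c x)) \<le> norm (f (Complex c x))"
      by (intro always_eventually allI AE_I2) (auto simp: indicator_def)
  qed (use f(2) in auto)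
  then have "((\<lambda>V. \<i> * (LINT v|lborel. indicator {-V..V} v *\<^sub>R f (Complex c v))) \<longlongrightarrow> vertical_line_integral c f) at_top"
    unfolding vertical_line_integral_def by (intro tendsto_intros)
  moreover have "\<forall>\<^sub>F V in at_top. \<i> * (LINT v|lborel. indicator {-V..V} v *\<^sub>R f (Complex c v)) = P (Complex c V) - P (Complex c (- V))"
    using eventually_ge_at_top[of 0] by eventually_elim (simp add: eq)
  ultimately show ?thesis by (rule Lim_transform_eventually)
qed

lemma ray_integral_tendsto:
  assumes P: "\<And>r. r \<ge> 0 \<Longrightarrow> (P has_field_derivative f (of_real r * cis \<theta>)) (at (of_real r * cis \<theta>))"
    and f: "continuous_on {0..} (\<lambda>r. f (of_real r * cis \<theta>))"
    and int: "set_integrable lborel {0..} (\<lambda>r. f (of_real r * cis \<theta>))"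
  shows "((\<lambda>R. P (of_real R * cis \<theta>)) \<longlongrightarrow> P 0 + ray_integral \<theta> f) at_top"
proof -
  have deriv: "((\<lambda>r. P (of_real r * cis \<theta>)) has_vector_derivative cis \<theta> * f (of_real r * cis \<theta>)) (at r within A)"
    if "r \<ge> 0" for r A
  proof -
    have "((\<lambda>r. of_real r * cis \<theta>) has_vector_derivative cis \<theta>) (at r within A)"
      by (auto intro!: derivative_eq_intros)
    from field_vector_diff_chain_within[OF this, of P "f (of_real r * cis \<theta>)"] show ?thesis
      using P[OF that] by (simp add: o_def has_field_derivative_at_within)
  qed
  have "((\<lambda>R. LINT r:{0..R}|lborel. cis \<theta> * f (of_real r * cis \<theta>)) \<longlongrightarrow> ray_integral \<theta> f) at_top"
    unfolding ray_integral_def using int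
    by (intro tendsto_set_lebesgue_integral_at_top set_integrable_mult_right) auto
  then have "((\<lambda>R. P 0 + (LINT r:{0..R}|lborel. cis \<theta> * f (of_real r * cis \<theta>))) \<longlongrightarrow> P 0 + ray_integral \<theta> f) at_top"
    by (intro tendsto_intros)
  moreover have "\<forall>\<^sub>F R in at_top. P 0 + (LINT r:{0..R}|lborel. cis \<theta> * f (of_real r * cis \<theta>)) = P (of_real R * cis \<theta>)"
    using eventually_ge_at_top[of 0]
  proof eventually_elim
    case (elim R)
    have "(LINT r:{0..R}|lborel. cis \<theta> * f (of_real r * cis \<theta>)) = P (of_real R * cis \<theta>) - P (of_real 0 * cis \<theta>)"
      unfolding set_lebesgue_integral_def
      using elim by (intro integral_FTC_Icc deriv continuous_intros continuous_on_subset[OF f]) auto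
    then show ?case by simp
  qed
  ultimately show ?thesis by (rule Lim_transform_eventually)
qed

section \<open>The Airy function and the Airy kernel\<close>

abbreviation airy_exp :: "complex \<Rightarrow> complex \<Rightarrow> complex" where
  "airy_exp z w \<equiv> exp (w ^ 3 / 3 - z * w)"

lemma cos_triple_le: "\<theta> = pi/3 \<or> \<theta> = pi/4 \<or> \<theta> = - (pi/3) \<or> \<theta> = - (pi/4) \<Longrightarrow> cos (3 * \<theta>) \<le> - 1 / 2"
proof -
  have "cos (3 * (pi / 4)) = - cos (pi / 4)"
    using cos_add[of "pi/2" "pi/4"] cos_45 sin_45 by (simp add: algebra_simps)
  moreover have "sqrt 2 \<ge> 1" by simp
  ultimately have "cos (3 * (pi / 4)) \<le> - 1 / 2" by (simp add: cos_45)
  moreover have "cos (3 * (pi / 3)) \<le> - 1 / 2" by simp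
  moreover have "cos (3 * - \<phi>) = cos (3 * \<phi>)" for \<phi> :: real by simp
  ultimately show "\<theta> = pi/3 \<or> \<theta> = pi/4 \<or> \<theta> = - (pi/3) \<or> \<theta> = - (pi/4) \<Longrightarrow> cos (3 * \<theta>) \<le> - 1 / 2"
    by metis
qed

text \<open>The angles \<open>pi/3\<close> come from the definition of \<open>Airy_Ai\<close>; the
  angles \<open>pi/4\<close> are the reflections of the directions 3 pi / 4 in which the t-contour
  leaves the critical point. In all four directions the cubic term has negative real part.\<close>

definition airy_angle :: "real \<Rightarrow> bool" where
  "airy_angle \<theta> \<longleftrightarrow> \<theta> = pi/3 \<or> \<theta> = pi/4 \<or> \<theta> = - (pi/3) \<or> \<theta> = - (pi/4)"

lemma airy_angle_cos: "airy_angle \<theta> \<Longrightarrow> cos (3 * \<theta>) \<le> - 1 / 2" "airy_angle \<theta> \<Longrightarrow> cos \<theta> \<ge> 0"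
proof -
  show "airy_angle \<theta> \<Longrightarrow> cos (3 * \<theta>) \<le> - 1 / 2"
    unfolding airy_angle_def by (rule cos_triple_le)
  have "cos (pi / 3) \<ge> 0" "cos (pi / 4) \<ge> 0"
    by (simp_all add: cos_60 cos_45)
  then show "airy_angle \<theta> \<Longrightarrow> cos \<theta> \<ge> 0"
    unfolding airy_angle_def by (metis cos_minus)
qed

text \<open>The cubic decay is deliberately weakened to a quadratic one by
  \<open>r ^ 3 \<ge> r\<^sup>2 - 1\<close>, so that the Gaussian bound applies. The constant 1/6 is
  the bound 1/2 on \<open>- cos (3 * \<theta>)\<close> divided by 3.\<close>

lemma norm_airy_exp_ray_le:
  assumes "airy_angle \<theta>" "r \<ge> 0"
  shows "norm (airy_exp z (of_real r * cis \<theta>))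
    \<le> exp (1 / 6) * exp (norm z * r - 1/6 * r\<^sup>2)"
proof -
  have "Re ((of_real r * cis \<theta>) ^ 3 / 3) = r ^ 3 * cos (3 * \<theta>) / 3"
    by (simp add: power_mult_distrib Complex.DeMoivre flip: of_real_power)
  also have "\<dots> \<le> r ^ 3 * (- 1 / 2) / 3"
    using airy_angle_cos[OF assms(1)] assms(2) by (intro divide_right_mono mult_left_mono) auto
  also have "r ^ 3 * (- 1 / 2) / 3 \<le> 1 / 6 - 1 / 6 * r\<^sup>2"
  proof -
    have "r ^ 3 - r\<^sup>2 + 1 \<ge> 0"
    proof (cases "r \<ge> 1")
      case True
      then have "r\<^sup>2 * 1 \<le> r\<^sup>2 * r" by (intro mult_left_mono) auto
      then show ?thesis by (simp add: power3_eq_cube power2_eq_square)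
    next
      case False
      then have "r\<^sup>2 \<le> 1" "r ^ 3 \<ge> 0" using assms by (auto simp: power_le_one)
      then show ?thesis by linarith
    qed
    then show ?thesis by simp
  qed
  finally have "Re ((of_real r * cis \<theta>) ^ 3 / 3) \<le> 1 / 6 - 1 / 6 * r\<^sup>2" .
  moreover have "- Re (z * (of_real r * cis \<theta>)) \<le> norm z * r"
    using abs_Re_le_cmod[of "z * (of_real r * cis \<theta>)"] assms by (simp add: norm_mult)
  ultimately show ?thesis
    by (simp flip: exp_add)
qed

lemma airy_ray_bound:
  assumes "airy_angle \<theta>" "\<And>r. r \<ge> 0 \<Longrightarrow> norm (h (of_real r * cis \<theta>)) \<le> A * r ^ k + B"
  obtains C where "\<And>r. r \<ge> 0 \<Longrightarrow> norm (airy_exp z (of_real r * cis \<theta>) * h (of_real r * cis \<theta>)) \<le> C * exp (- r)"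
proof -
  define K where "K = exp (1/6) * exp ((norm z + 2)\<^sup>2 / (4 * (1/6)))"
  have "norm (airy_exp z (of_real r * cis \<theta>) * h (of_real r * cis \<theta>))
      \<le> (\<bar>A\<bar> * (K * fact k) + \<bar>B\<bar> * K) * exp (- r)" if r: "r \<ge> 0" for r
  proof -
    have h: "norm (h (of_real r * cis \<theta>)) \<le> \<bar>A\<bar> * r ^ k + \<bar>B\<bar>"
      using assms(2)[OF r] mult_right_mono[OF abs_ge_self[of A], of "r^k"] abs_ge_self[of B] r by simp
    have "norm (airy_exp z (of_real r * cis \<theta>) * h (of_real r * cis \<theta>))
       \<le> (exp (1 / 6) * exp (norm z * r - 1/6 * r\<^sup>2)) * (\<bar>A\<bar> * r ^ k + \<bar>B\<bar>)"
      unfolding norm_mult using r by (intro mult_mono norm_airy_exp_ray_le assms h) auto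
    also have "\<dots> = exp (1/6) * (\<bar>A\<bar> * (r ^ k * exp (norm z * r - 1/6 * r\<^sup>2)) + \<bar>B\<bar> * (r ^ 0 * exp (norm z * r - 1/6 * r\<^sup>2)))"
      by (simp add: algebra_simps)
    also have "\<dots> \<le> exp (1/6) * (\<bar>A\<bar> * (fact k * exp ((norm z + 2)\<^sup>2 / (4 * (1/6))) * exp (- r)) + \<bar>B\<bar> * (fact 0 * exp ((norm z + 2)\<^sup>2 / (4 * (1/6))) * exp (- r)))"
      using r by (intro mult_left_mono add_mono exp_gauss_le) auto
    also have "\<dots> = (\<bar>A\<bar> * (K * fact k) + \<bar>B\<bar> * K) * exp (- r)"
      by (simp add: K_def algebra_simps)
    finally show ?thesis .
  qed
  then show ?thesis by (rule that)
qed

lemma airy_ray_integrable: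
  assumes "airy_angle \<theta>" "\<And>r. r \<ge> 0 \<Longrightarrow> norm (h (of_real r * cis \<theta>)) \<le> A * r ^ k + B"
    "continuous_on {0..} (\<lambda>r. h (of_real r * cis \<theta>))"
  shows "set_integrable lborel {0..} (\<lambda>r. airy_exp z (of_real r * cis \<theta>) * h (of_real r * cis \<theta>))"
proof -
  obtain C where "\<And>r. r \<ge> 0 \<Longrightarrow> norm (airy_exp z (of_real r * cis \<theta>) * h (of_real r * cis \<theta>)) \<le> C * exp (- r)"
    using airy_ray_bound[of \<theta> h A k B z] assms by blast
  then show ?thesis
    by (intro set_integrable_Ici_exp_bound continuous_intros assms) auto
qed

lemma norm_airy_exp_Complex:
  "norm (airy_exp z (Complex u V)) \<le> exp (u ^ 3 / 3 - u * V\<^sup>2 + norm z * (\<bar>u\<bar> + \<bar>V\<bar>))"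
proof -
  have "Re (Complex u V ^ 3) = u ^ 3 - 3 * u * V\<^sup>2"
    by (simp add: power3_eq_cube power2_eq_square algebra_simps)
  moreover have "- Re (z * Complex u V) \<le> norm z * (\<bar>u\<bar> + \<bar>V\<bar>)"
  proof -
    have "- Re (z * Complex u V) \<le> norm z * norm (Complex u V)"
      using abs_Re_le_cmod[of "z * Complex u V"] unfolding norm_mult by linarith
    also have "\<dots> \<le> norm z * (\<bar>u\<bar> + \<bar>V\<bar>)"
      using cmod_le[of "Complex u V"] by (intro mult_left_mono) auto
    finally show ?thesis .
  qed
  moreover have "Re (Complex u V ^ 3 / 3 - z * Complex u V) = Re (Complex u V ^ 3) / 3 - Re (z * Complex u V)"
    by simp
  ultimately show ?thesis unfolding norm_exp_eq_Re by (simp add: diff_divide_distrib)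
qed

lemma airy_line_bound:
  assumes "\<And>v. norm (h (Complex 1 v)) \<le> A * \<bar>v\<bar> ^ k + B"
  obtains C where "\<And>v. norm (airy_exp z (Complex 1 v) * h (Complex 1 v)) \<le> C * exp (- \<bar>v\<bar>)"
proof -
  define K where "K = exp (1/3 + norm z) * exp ((norm z + 2)\<^sup>2 / (4 * 1))"
  have "norm (airy_exp z (Complex 1 v) * h (Complex 1 v))
      \<le> (\<bar>A\<bar> * (K * fact k) + \<bar>B\<bar> * K) * exp (- \<bar>v\<bar>)" for v
  proof -
    have h: "norm (h (Complex 1 v)) \<le> \<bar>A\<bar> * \<bar>v\<bar> ^ k + \<bar>B\<bar>"
      using assms[of v] mult_right_mono[OF abs_ge_self[of A], of "\<bar>v\<bar>^k"] abs_ge_self[of B]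
      by simp
    have "norm (airy_exp z (Complex 1 v)) \<le> exp (1/3 + norm z) * exp (norm z * \<bar>v\<bar> - 1 * \<bar>v\<bar>\<^sup>2)"
      using norm_airy_exp_Complex[of 1 v z] by (simp add: algebra_simps flip: exp_add)
    then have "norm (airy_exp z (Complex 1 v) * h (Complex 1 v))
       \<le> (exp (1/3 + norm z) * exp (norm z * \<bar>v\<bar> - 1 * \<bar>v\<bar>\<^sup>2)) * (\<bar>A\<bar> * \<bar>v\<bar> ^ k + \<bar>B\<bar>)"
      unfolding norm_mult by (intro mult_mono h) auto
    also have "\<dots> = exp (1/3 + norm z) * (\<bar>A\<bar> * (\<bar>v\<bar> ^ k * exp (norm z * \<bar>v\<bar> - 1 * \<bar>v\<bar>\<^sup>2)) + \<bar>B\<bar> * (\<bar>v\<bar> ^ 0 * exp (norm z * \<bar>v\<bar> - 1 * \<bar>v\<bar>\<^sup>2)))"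
      by (simp add: algebra_simps)
    also have "\<dots> \<le> exp (1/3 + norm z) * (\<bar>A\<bar> * (fact k * exp ((norm z + 2)\<^sup>2 / (4 * 1)) * exp (- \<bar>v\<bar>)) + \<bar>B\<bar> * (fact 0 * exp ((norm z + 2)\<^sup>2 / (4 * 1)) * exp (- \<bar>v\<bar>)))"
      by (intro mult_left_mono add_mono exp_gauss_le) auto
    also have "\<dots> = (\<bar>A\<bar> * (K * fact k) + \<bar>B\<bar> * K) * exp (- \<bar>v\<bar>)"
      by (simp add: K_def algebra_simps)
    finally show ?thesis .
  qed
  then show ?thesis by (rule that)
qed

lemma continuous_on_Complex_line:
  "continuous_on {z. Re z = c} h \<Longrightarrow> continuous_on A (\<lambda>v. h (Complex c v))"
proof -
  have "continuous_on A (\<lambda>v. Complex c v)"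
    by (simp add: Complex_eq continuous_intros)
  then show "continuous_on {z. Re z = c} h \<Longrightarrow> continuous_on A (\<lambda>v. h (Complex c v))"
    by (rule continuous_on_compose2[of "{z. Re z = c}" h, rotated]) auto
qed

lemma airy_line_integrable:
  assumes "\<And>v. norm (h (Complex 1 v)) \<le> A * \<bar>v\<bar> ^ k + B" "continuous_on {z. Re z = 1} h"
  shows "integrable lborel (\<lambda>v. airy_exp z (Complex 1 v) * h (Complex 1 v))"
proof -
  obtain C where "\<And>v. norm (airy_exp z (Complex 1 v) * h (Complex 1 v)) \<le> C * exp (- \<bar>v\<bar>)"
    using airy_line_bound[of h A k B z] assms by blast
  moreover have "(\<lambda>v. airy_exp z (Complex 1 v) * h (Complex 1 v)) \<in> borel_measurable borel"
    by (intro borel_measurable_continuous_onI continuous_on_Complex_line continuous_intros assms)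
       (auto intro: continuous_intros)
  ultimately show ?thesis by (intro integrable_lborel_exp_bound)
qed

text \<open>The two rays of the Airy contour may be rotated and straightened: the primitive of the
  integrand changes by a vanishing amount along the horizontal chord from the ray to the line.\<close>

lemma airy_ray_eq_line:
  fixes z :: complex
  assumes "\<theta> = pi/3 \<or> \<theta> = pi/4" and h: "h holomorphic_on UNIV" and hb: "\<And>w. norm (h w) \<le> A * norm w ^ k + B"
  defines "f \<equiv> (\<lambda>\<sigma>. airy_exp z \<sigma> * h \<sigma>)"
  shows "ray_integral \<theta> f - ray_integral (- \<theta>) f = vertical_line_integral 1 f"
proof -
  have hol: "f holomorphic_on UNIV" unfolding f_def by (intro holomorphic_intros h) auto
  then have cont: "continuous_on S f" for S
    using holomorphic_on_imp_continuous_on continuous_on_subset by blast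
  have hcont: "continuous_on S h" for S
    using h holomorphic_on_imp_continuous_on continuous_on_subset by blast
  obtain P where P: "\<And>x. (P has_field_derivative f x) (at x)"
    using holomorphic_convex_primitive'[OF _ _ hol] by auto
  have ang: "airy_angle \<theta>" "airy_angle (- \<theta>)" using assms(1) by (auto simp: airy_angle_def)
  have hcis: "continuous_on S (\<lambda>r. h (of_real r * cis \<phi>))" for \<phi> S
    by (rule continuous_on_compose2[OF hcont[of UNIV]]) (auto intro!: continuous_intros)
  have ray: "((\<lambda>R. P (of_real R * cis \<phi>)) \<longlongrightarrow> P 0 + ray_integral \<phi> f) at_top" if "airy_angle \<phi>" for \<phi>
  proof (rule ray_integral_tendsto)
    show "continuous_on {0..} (\<lambda>r. f (of_real r * cis \<phi>))"
      unfolding f_def by (intro continuous_intros hcis) auto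
    show "set_integrable lborel {0..} (\<lambda>r. f (of_real r * cis \<phi>))"
      unfolding f_def
    proof (rule airy_ray_integrable[OF that _ hcis])
      show "norm (h (of_real r * cis \<phi>)) \<le> A * r ^ k + B" if "r \<ge> 0" for r
        using hb[of "of_real r * cis \<phi>"] that by (simp add: norm_mult)
    qed
  qed (use P in auto)
  have sc: "sin \<theta> > 0" "cos \<theta> > 0" "cos \<theta> \<le> sin \<theta>"
  proof -
    have "sin (pi/3) > 0 \<and> cos (pi/3) > 0 \<and> cos (pi/3) \<le> sin (pi/3)"
      "sin (pi/4) > 0 \<and> cos (pi/4) > 0 \<and> cos (pi/4) \<le> sin (pi/4)"
      by (simp_all add: cos_60 sin_60 cos_45 sin_45)
    then show "sin \<theta> > 0" "cos \<theta> > 0" "cos \<theta> \<le> sin \<theta>"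
      using assms(1) by metis+
  qed
  have line: "((\<lambda>V. P (Complex 1 V) - P (Complex 1 (- V))) \<longlongrightarrow> vertical_line_integral 1 f) at_top"
  proof (rule vertical_line_integral_tendsto)
    have "norm (h (Complex 1 v)) \<le> (\<bar>A\<bar> * 2 ^ k) * \<bar>v\<bar> ^ k + (\<bar>A\<bar> * 2 ^ k + \<bar>B\<bar>)" for v
    proof -
      have "norm (Complex 1 v) \<le> 2 * max 1 \<bar>v\<bar>" using cmod_le[of "Complex 1 v"] by (auto simp: max_def)
      then have "norm (Complex 1 v) ^ k \<le> (2 * max 1 \<bar>v\<bar>) ^ k" by (intro power_mono) auto
      also have "\<dots> \<le> 2 ^ k * \<bar>v\<bar> ^ k + 2 ^ k"
        by (auto simp: power_mult_distrib max_def)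
      finally have "\<bar>A\<bar> * norm (Complex 1 v) ^ k \<le> \<bar>A\<bar> * (2 ^ k * \<bar>v\<bar> ^ k + 2 ^ k)"
        by (intro mult_left_mono) auto
      moreover have "A * norm (Complex 1 v) ^ k \<le> \<bar>A\<bar> * norm (Complex 1 v) ^ k"
        by (intro mult_right_mono) auto
      ultimately show ?thesis
        using hb[of "Complex 1 v"] abs_ge_self[of B] by (simp add: algebra_simps)
    qed
    then show "integrable lborel (\<lambda>v. f (Complex 1 v))"
      unfolding f_def by (rule airy_line_integrable) (rule hcont)
  qed (use P cont in auto)
  have chord: "norm (P (Complex (V * (cos \<theta> / sin \<theta>)) W) - P (Complex 1 W)) \<le> (\<bar>A\<bar> * (2 * V) ^ k + \<bar>B\<bar>) * exp (norm z * (2 * V) - 2/3 * V\<^sup>2) * V"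
    if V: "V \<ge> sin \<theta> / cos \<theta>" and W: "\<bar>W\<bar> = V" for V W
  proof -
    \<comment> \<open>This is the abscissa at which the ray reaches height \<open>V\<close>. It is
      at least 1 by the lower bound on \<open>V\<close> and at most \<open>V\<close> because
      \<open>cos \<theta> \<le> sin \<theta>\<close>; for real parts in this range the cubic term is
      at most \<open>- 2/3 * V\<^sup>2\<close>.\<close>
    let ?q = "V * (cos \<theta> / sin \<theta>)"
    have "sin \<theta> / cos \<theta> \<ge> 1" using sc by simp
    then have V1: "V \<ge> 1" using V by linarith
    have q: "1 \<le> ?q" "?q \<le> V" using V V1 sc by (auto simp: field_simps)
    have seg: "z \<in> closed_segment (Complex 1 W) (Complex ?q W) \<Longrightarrow> Im z = W \<and> 1 \<le> Re z \<and> Re z \<le> V" for z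
      using closed_segment_same_Im[of "Complex 1 W" "Complex ?q W"] q
      by (auto simp: closed_segment_eq_real_ivl)
    have "norm (P (Complex ?q W) - P (Complex 1 W)) \<le> (\<bar>A\<bar> * (2 * V) ^ k + \<bar>B\<bar>) * exp (norm z * (2 * V) - 2/3 * V\<^sup>2) * norm (Complex ?q W - Complex 1 W)"
    proof (rule field_differentiable_bound)
      fix w assume "w \<in> closed_segment (Complex 1 W) (Complex ?q W)"
      then obtain u where w: "w = Complex u W" "1 \<le> u" "u \<le> V"
        using seg[of w] by (cases w) auto
      have nw: "norm w \<le> 2 * V" using cmod_le[of w] w W V1 by auto
      have "norm (h w) \<le> \<bar>A\<bar> * (2 * V) ^ k + \<bar>B\<bar>"
      proof -
        have "A * norm w ^ k \<le> \<bar>A\<bar> * (2 * V) ^ k"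
          using nw by (intro mult_mono power_mono) auto
        then show ?thesis using hb[of w] abs_ge_self[of B] by linarith
      qed
      moreover have "norm (airy_exp z w) \<le> exp (norm z * (2 * V) - 2/3 * V\<^sup>2)"
      proof -
        have "u\<^sup>2 \<le> V\<^sup>2" using w by (intro power_mono) auto
        then have "u\<^sup>2 / 3 - V\<^sup>2 \<le> V\<^sup>2 / 3 - V\<^sup>2" by linarith
        then have "u * (u\<^sup>2 / 3 - V\<^sup>2) \<le> u * (V\<^sup>2 / 3 - V\<^sup>2)" by (rule mult_left_mono) (use w in simp)
        also have "\<dots> \<le> 1 * (V\<^sup>2 / 3 - V\<^sup>2)" using mult_right_mono_neg[of 1 u "V\<^sup>2 / 3 - V\<^sup>2"] w by auto
        finally have 1: "u ^ 3 / 3 - u * V\<^sup>2 \<le> - 2/3 * V\<^sup>2"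
          by (simp add: power3_eq_cube power2_eq_square algebra_simps)
        have 2: "norm z * (\<bar>u\<bar> + \<bar>W\<bar>) \<le> norm z * (2 * V)"
          using w W by (intro mult_left_mono) auto
        have "W\<^sup>2 = V\<^sup>2" using W by (metis power2_abs)
        then show ?thesis
          using norm_airy_exp_Complex[of u W z] 1 2 unfolding w(1)
          by (auto elim!: order_trans)
      qed
      ultimately show "norm (f w) \<le> (\<bar>A\<bar> * (2 * V) ^ k + \<bar>B\<bar>) * exp (norm z * (2 * V) - 2/3 * V\<^sup>2)"
        unfolding f_def norm_mult by (subst mult.commute) (intro mult_mono, auto)
      show "(P has_field_derivative f w) (at w within closed_segment (Complex 1 W) (Complex ?q W))"
        using P by (rule has_field_derivative_at_within)
    qed auto
    also have "norm (Complex ?q W - Complex 1 W) \<le> V"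
      using q cmod_le[of "Complex ?q W - Complex 1 W"] by simp
    finally show ?thesis
      using V1 by (simp add: mult_left_mono)
  qed
  have lim0: "((\<lambda>V. (\<bar>A\<bar> * (2 * V) ^ k + \<bar>B\<bar>) * exp (norm z * (2 * V) - 2/3 * V\<^sup>2) * V) \<longlongrightarrow> 0) at_top"
  proof (rule Lim_null_comparison)
    define c where "c = (\<bar>A\<bar> * 2 ^ k * fact (Suc k) + \<bar>B\<bar>) * exp ((2 * norm z + 2)\<^sup>2 / (4 * (2/3)))"
    show "((\<lambda>V. c * exp (- V)) \<longlongrightarrow> 0) at_top"
      by (intro tendsto_mult_right_zero filterlim_compose[OF exp_at_bot] filterlim_uminus_at_bot_at_top)
    show "\<forall>\<^sub>F V in at_top. norm ((\<bar>A\<bar> * (2 * V) ^ k + \<bar>B\<bar>) * exp (norm z * (2 * V) - 2/3 * V\<^sup>2) * V) \<le> c * exp (- V)"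
      using eventually_ge_at_top[of 0]
    proof eventually_elim
      case (elim V)
      let ?g = "\<lambda>j. V ^ j * exp (2 * norm z * V - 2/3 * V\<^sup>2)"
      have "norm ((\<bar>A\<bar> * (2 * V) ^ k + \<bar>B\<bar>) * exp (norm z * (2 * V) - 2/3 * V\<^sup>2) * V) = (\<bar>A\<bar> * 2 ^ k) * ?g (Suc k) + \<bar>B\<bar> * ?g 1"
        using elim by (simp add: abs_mult power_mult_distrib algebra_simps abs_of_nonneg)
      also have "\<dots> \<le> (\<bar>A\<bar> * 2 ^ k) * (fact (Suc k) * exp ((2 * norm z + 2)\<^sup>2 / (4 * (2/3))) * exp (- V))
          + \<bar>B\<bar> * (fact 1 * exp ((2 * norm z + 2)\<^sup>2 / (4 * (2/3))) * exp (- V))"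
        using elim by (intro add_mono mult_left_mono exp_gauss_le) auto
      also have "\<dots> = c * exp (- V)" by (simp add: c_def algebra_simps)
      finally show ?case .
    qed
  qed
  have d: "((\<lambda>V. P (Complex (V * (cos \<theta> / sin \<theta>)) V) - P (Complex 1 V)) \<longlongrightarrow> 0) at_top"
     "((\<lambda>V. P (Complex (V * (cos \<theta> / sin \<theta>)) (-V)) - P (Complex 1 (-V))) \<longlongrightarrow> 0) at_top"
  proof -
    have q: "sin \<theta> / cos \<theta> \<ge> 0" using sc by simp
    have "\<forall>\<^sub>F V in at_top. V \<ge> sin \<theta> / cos \<theta>" by (rule eventually_ge_at_top)
    then have ev: "\<forall>\<^sub>F V in at_top. V \<ge> sin \<theta> / cos \<theta> \<and> \<bar>V\<bar> = V \<and> \<bar>-V\<bar> = V"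
      by (rule eventually_mono) (use q in linarith)
    show "((\<lambda>V. P (Complex (V * (cos \<theta> / sin \<theta>)) V) - P (Complex 1 V)) \<longlongrightarrow> 0) at_top"
      by (rule Lim_null_comparison[OF eventually_mono[OF ev] lim0]) (elim conjE, rule chord)
    show "((\<lambda>V. P (Complex (V * (cos \<theta> / sin \<theta>)) (-V)) - P (Complex 1 (-V))) \<longlongrightarrow> 0) at_top"
      by (rule Lim_null_comparison[OF eventually_mono[OF ev] lim0]) (elim conjE, rule chord)
  qed
  \<comment> \<open>The rays are reparametrised by height instead of length, so that ray and line
    are compared at equal imaginary part.\<close>
  have scale: "filterlim (\<lambda>V. V / sin \<theta>) at_top at_top"
    using filterlim_at_top_mult_tendsto_pos[OF tendsto_const[of "1 / sin \<theta>"] _ filterlim_ident] sc by simp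
  have e: "of_real (V / sin \<theta>) * cis \<theta> = Complex (V * (cos \<theta> / sin \<theta>)) V"
    "of_real (V / sin \<theta>) * cis (- \<theta>) = Complex (V * (cos \<theta> / sin \<theta>)) (- V)" for V
    using sc by (simp_all add: complex_eq_iff)
  have "((\<lambda>V. P (Complex (V * (cos \<theta> / sin \<theta>)) V)) \<longlongrightarrow> P 0 + ray_integral \<theta> f) at_top"
    using filterlim_compose[OF ray[OF ang(1)] scale] by (simp add: e del: of_real_divide)
  moreover have "((\<lambda>V. P (Complex (V * (cos \<theta> / sin \<theta>)) (-V))) \<longlongrightarrow> P 0 + ray_integral (-\<theta>) f) at_top"
    using filterlim_compose[OF ray[OF ang(2)] scale] by (simp add: e del: of_real_divide)
  ultimately have "((\<lambda>V. (P (Complex (V * (cos \<theta> / sin \<theta>)) V) - P (Complex (V * (cos \<theta> / sin \<theta>)) (-V)))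
     - (P (Complex (V * (cos \<theta> / sin \<theta>)) V) - P (Complex 1 V)) +
       (P (Complex (V * (cos \<theta> / sin \<theta>)) (-V)) - P (Complex 1 (-V)))) \<longlongrightarrow>
     ((P 0 + ray_integral \<theta> f) - (P 0 + ray_integral (-\<theta>) f)) - 0 + 0) at_top"
    by (intro tendsto_add tendsto_diff d)
  then have "((\<lambda>V. P (Complex 1 V) - P (Complex 1 (- V))) \<longlongrightarrow> ray_integral \<theta> f - ray_integral (-\<theta>) f) at_top"
    by simp
  with line show ?thesis
    using tendsto_unique trivial_limit_at_top_linorder by blast
qed

section \<open>The Airy function as line and ray integral\<close>

text \<open>For \<open>k = 0\<close> this is Ai, and for \<open>k = 1\<close> it is - Ai'. On the
  straight line the integrand is Gaussian, which makes it convenient for differentiation in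
  \<open>z\<close>.\<close>

definition airy_line :: "nat \<Rightarrow> complex \<Rightarrow> complex" where
  "airy_line k z = vertical_line_integral 1 (\<lambda>\<sigma>. airy_exp z \<sigma> * \<sigma> ^ k) / (2 * of_real pi * \<i>)"

definition airy_rays :: "(complex \<Rightarrow> complex) \<Rightarrow> complex" where
  "airy_rays h = (ray_integral (pi/4) h - ray_integral (- (pi/4)) h) / (2 * of_real pi * \<i>)"

definition ray_ok :: "(complex \<Rightarrow> complex) \<Rightarrow> bool" where
  "ray_ok h \<longleftrightarrow> (\<forall>\<theta>\<in>{pi/4, - (pi/4)}. set_integrable lborel {0..} (\<lambda>r. h (of_real r * cis \<theta>)))"

lemma Airy_Ai_eq_line: "Airy_Ai z = airy_line 0 z"
  using airy_ray_eq_line[of "pi/3" "\<lambda>\<sigma>. \<sigma> ^ 0" 1 0 0 z]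
  by (simp add: Airy_Ai_def airy_line_def)

lemma airy_rays_eq_line: "airy_rays (\<lambda>\<sigma>. airy_exp z \<sigma> * \<sigma> ^ k) = airy_line k z"
  using airy_ray_eq_line[of "pi/4" "\<lambda>\<sigma>. \<sigma> ^ k" 1 k 0 z]
  by (simp add: airy_rays_def airy_line_def holomorphic_intros norm_power)

lemma airy_rays_lin:
  assumes "ray_ok h1" "ray_ok h2"
  shows "ray_ok (\<lambda>w. a * h1 w + b * h2 w)"
    "airy_rays (\<lambda>w. a * h1 w + b * h2 w) = a * airy_rays h1 + b * airy_rays h2"
proof -
  show "ray_ok (\<lambda>w. a * h1 w + b * h2 w)"
    using assms unfolding ray_ok_def by (auto intro!: set_integral_add set_integrable_mult_right)
  have "ray_integral \<theta> (\<lambda>w. a * h1 w + b * h2 w) = a * ray_integral \<theta> h1 + b * ray_integral \<theta> h2"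
    if "\<theta> = pi/4 \<or> \<theta> = - (pi/4)" for \<theta>
  proof -
    have i: "set_integrable lborel {0..} (\<lambda>r. h1 (of_real r * cis \<theta>))" "set_integrable lborel {0..} (\<lambda>r. h2 (of_real r * cis \<theta>))"
      using assms that unfolding ray_ok_def by blast+
    have "ray_integral \<theta> (\<lambda>w. a * h1 w + b * h2 w) =
      (LINT r:{0..}|lborel. (a * cis \<theta>) * h1 (of_real r * cis \<theta>) + (b * cis \<theta>) * h2 (of_real r * cis \<theta>))"
      unfolding ray_integral_def by (simp add: algebra_simps)
    also have "\<dots> = a * ray_integral \<theta> h1 + b * ray_integral \<theta> h2"
      unfolding ray_integral_def using i
      by (subst set_integral_add(2)) (auto intro!: set_integrable_mult_right simp: mult.assoc)
    finally show ?thesis .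
  qed
  then show "airy_rays (\<lambda>w. a * h1 w + b * h2 w) = a * airy_rays h1 + b * airy_rays h2"
    by (simp add: airy_rays_def field_simps)
qed

lemma airy_ray_ok:
  assumes "\<And>w. Re w \<ge> 0 \<Longrightarrow> norm (h w) \<le> A * norm w ^ k + B" "continuous_on {w. Re w \<ge> 0} h"
  shows "ray_ok (\<lambda>w. airy_exp z w * h w)"
proof -
  have "set_integrable lborel {0..} (\<lambda>r. airy_exp z (of_real r * cis \<theta>) * h (of_real r * cis \<theta>))"
    if \<theta>: "airy_angle \<theta>" for \<theta>
  proof (rule airy_ray_integrable[OF \<theta>])
    show "norm (h (of_real r * cis \<theta>)) \<le> A * r ^ k + B" if "r \<ge> 0" for r
      using assms(1)[of "of_real r * cis \<theta>"] airy_angle_cos(2)[OF \<theta>] that by (simp add: norm_mult)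
    show "continuous_on {0..} (\<lambda>r. h (of_real r * cis \<theta>))"
      using airy_angle_cos(2)[OF \<theta>] by (intro continuous_on_compose2[OF assms(2)] continuous_intros) auto
  qed
  then show ?thesis by (auto simp: ray_ok_def airy_angle_def)
qed

text \<open>The constant depends on \<open>z\<close> alone. It therefore serves whole families of
  multipliers \<open>h\<close>, in particular the difference quotients of
  \<open>airy_cauchy\<close>.\<close>

lemma norm_airy_rays_le:
  obtains K where "K \<ge> 0" "\<And>h A. (\<And>w. Re w \<ge> 0 \<Longrightarrow> norm (h w) \<le> A) \<Longrightarrow> continuous_on {w. Re w \<ge> 0} h \<Longrightarrow>
      norm (airy_rays (\<lambda>w. airy_exp z w * h w)) \<le> A * K"
proof -
  let ?E = "\<lambda>\<theta> r. norm (airy_exp z (of_real r * cis \<theta>))"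
  define I where "I \<theta> = (LINT r:{0..}|lborel. ?E \<theta> r)" for \<theta>
  have I: "set_integrable lborel {0..} (?E \<theta>)" if "airy_angle \<theta>" for \<theta>
    using set_integrable_norm[OF airy_ray_integrable[OF that, of "\<lambda>_. 1" 0 0 1 z]] by simp
  have *: "norm (ray_integral \<theta> (\<lambda>w. airy_exp z w * h w)) \<le> A * I \<theta>"
    if h: "\<And>w. Re w \<ge> 0 \<Longrightarrow> norm (h w) \<le> A" "continuous_on {w. Re w \<ge> 0} h" and \<theta>: "\<theta> = pi/4 \<or> \<theta> = - (pi/4)" for h A \<theta>
  proof -
    have ang: "airy_angle \<theta>" using \<theta> by (auto simp: airy_angle_def)
    have "ray_ok (\<lambda>w. airy_exp z w * h w)"
      by (rule airy_ray_ok[of h 0 0 A]) (use h in auto)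
    then have int: "set_integrable lborel {0..} (\<lambda>r. airy_exp z (of_real r * cis \<theta>) * h (of_real r * cis \<theta>))"
      using \<theta> unfolding ray_ok_def by blast
    have "norm (LINT r:{0..}|lborel. cis \<theta> * (airy_exp z (of_real r * cis \<theta>) * h (of_real r * cis \<theta>))) \<le> (LINT r:{0..}|lborel. A * ?E \<theta> r)"
      unfolding set_lebesgue_integral_def
    proof (rule order_trans[OF integral_norm_bound integral_mono])
      have "integrable lborel (\<lambda>r. indicat_real {0..} r *\<^sub>R (cis \<theta> * (airy_exp z (of_real r * cis \<theta>) * h (of_real r * cis \<theta>))))"
        using int unfolding set_integrable_def[symmetric] by (intro set_integrable_mult_right)
      then show "integrable lborel (\<lambda>r. norm (indicat_real {0..} r *\<^sub>R (cis \<theta> * (airy_exp z (of_real r * cis \<theta>) * h (of_real r * cis \<theta>)))))"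
        by (rule integrable_norm)
      show "integrable lborel (\<lambda>r. indicat_real {0..} r *\<^sub>R (A * ?E \<theta> r))"
        using I[OF ang] unfolding set_integrable_def[symmetric] by (intro set_integrable_mult_right)
      fix r :: real
      have "r \<ge> 0 \<Longrightarrow> ?E \<theta> r * norm (h (of_real r * cis \<theta>)) \<le> ?E \<theta> r * A"
        using airy_angle_cos(2)[OF ang] by (intro mult_left_mono h) auto
      then show "norm (indicat_real {0..} r *\<^sub>R (cis \<theta> * (airy_exp z (of_real r * cis \<theta>) * h (of_real r * cis \<theta>)))) \<le> indicat_real {0..} r *\<^sub>R (A * ?E \<theta> r)"
        by (auto simp: indicator_def norm_mult mult.commute simp del: norm_exp_eq_Re)
    qed
    then show ?thesis by (simp add: ray_integral_def I_def)
  qed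
  have I0: "I \<theta> \<ge> 0" for \<theta>
    unfolding I_def set_lebesgue_integral_def by (intro integral_nonneg_AE) auto
  show ?thesis
  proof (rule that[of "(I (pi/4) + I (- (pi/4))) / (2 * pi)"])
    fix h :: "complex \<Rightarrow> complex" and A :: real
    assume h: "\<And>w. Re w \<ge> 0 \<Longrightarrow> norm (h w) \<le> A" "continuous_on {w. Re w \<ge> 0} h"
    show "norm (airy_rays (\<lambda>w. airy_exp z w * h w)) \<le> A * ((I (pi/4) + I (- (pi/4))) / (2 * pi))"
      using norm_triangle_ineq4[of "ray_integral (pi/4) (\<lambda>w. airy_exp z w * h w)" "ray_integral (-(pi/4)) (\<lambda>w. airy_exp z w * h w)"]
       *[OF h, of "pi/4"] *[OF h, of "-(pi/4)"]
      by (simp add: airy_rays_def norm_divide norm_mult divide_right_mono algebra_simps)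
  qed (use I0 in auto)
qed

section \<open>Differentiation under the integral sign\<close>

text \<open>Reduces differentiation under the integral sign to a second-order Taylor remainder of
  the integrand that is bounded uniformly in the integration variable.\<close>

lemma has_field_derivative_quadratic_bound:
  fixes f :: "complex \<Rightarrow> complex"
  assumes "\<delta> > 0" "\<And>h. norm h < \<delta> \<Longrightarrow> norm (f (z + h) - f z - h * D) \<le> C * norm h ^ 2"
  shows "(f has_field_derivative D) (at z)"
  unfolding DERIV_def
proof (rule Lim_transform_eventually)
  have "((\<lambda>h. (f (z + h) - f z) / h - D) \<longlongrightarrow> 0) (at 0)"
  proof (rule Lim_null_comparison)
    have "((\<lambda>h::complex. C * norm h) \<longlongrightarrow> C * norm (0::complex)) (at 0)"
      by (intro tendsto_intros)
    then show "((\<lambda>h::complex. C * norm h) \<longlongrightarrow> 0) (at 0)" by simp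
    show "\<forall>\<^sub>F h in at 0. norm ((f (z + h) - f z) / h - D) \<le> C * norm h"
      unfolding eventually_at using assms
    proof (intro exI[of _ \<delta>] conjI ballI impI)
      fix h :: complex assume h: "h \<noteq> 0 \<and> dist h 0 < \<delta>"
      then have "(f (z + h) - f z) / h - D = (f (z + h) - f z - h * D) / h" by (simp add: field_simps)
      moreover have "norm (f (z + h) - f z - h * D) \<le> C * norm h * norm h"
        using assms(2)[of h] h by (simp add: power2_eq_square mult.assoc)
      ultimately show "norm ((f (z + h) - f z) / h - D) \<le> C * norm h"
        using h by (simp add: norm_divide field_simps)
    qed auto
  qed
  then have "((\<lambda>h. ((f (z + h) - f z) / h - D) + D) \<longlongrightarrow> 0 + D) (at 0)"
    by (intro tendsto_intros)
  then show "((\<lambda>h. ((f (z + h) - f z) / h - D) + D) \<longlongrightarrow> D) (at 0)" by simp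
qed (auto intro!: always_eventually)

lemma has_field_derivative_Airy_Ai: "(Airy_Ai has_field_derivative - airy_line 1 z) (at z)"
proof -
  define E where "E = (\<lambda>z v. airy_exp z (Complex 1 v))"
  \<comment> \<open>The Taylor remainder contributes \<open>1 + \<bar>v\<bar>\<close> to the
    exponent and the squared modulus of the line point a further \<open>\<bar>v\<bar>\<close>, so
    \<open>exp_gauss_le\<close> is used with slope \<open>norm z + 2\<close>.\<close>
  define C where "C = exp (4/3 + norm z) * exp ((norm z + 4)\<^sup>2 / 4) * 4"
  have bound: "norm (E (z + h) v - E z v + h * (E z v * Complex 1 v)) \<le> (norm h)\<^sup>2 * (C * exp (- \<bar>v\<bar>))"
    if h: "norm h < 1" for h v
  proof -
    let ?s = "Complex 1 v"
    have ns: "norm ?s \<le> 1 + \<bar>v\<bar>" using cmod_le[of ?s] by simp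
    have s2: "(norm ?s)\<^sup>2 \<le> 4 * exp \<bar>v\<bar>"
    proof -
      have "(norm ?s)\<^sup>2 = 1 + \<bar>v\<bar>\<^sup>2" by (simp add: cmod_def)
      also have "\<dots> \<le> 4 * (1 + \<bar>v\<bar> + \<bar>v\<bar>\<^sup>2 / 2)" by simp
      also have "\<dots> \<le> 4 * exp \<bar>v\<bar>"
        using exp_lower_Taylor_quadratic[of "\<bar>v\<bar>"] by simp
      finally show ?thesis .
    qed
    have "norm (exp (- h * ?s) - (\<Sum>k\<le>1. (- h * ?s) ^ k / fact k)) \<le> exp \<bar>Re (- h * ?s)\<bar> * norm (- h * ?s) ^ Suc 1 / fact 1"
      by (rule Taylor_exp)
    also have "\<dots> = exp \<bar>Re (- h * ?s)\<bar> * ((norm h)\<^sup>2 * (norm ?s)\<^sup>2)"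
      by (simp add: norm_mult power_mult_distrib power2_eq_square)
    also have "\<dots> \<le> exp (1 + \<bar>v\<bar>) * ((norm h)\<^sup>2 * (4 * exp \<bar>v\<bar>))"
    proof (rule mult_mono)
      have "\<bar>Re (- h * ?s)\<bar> \<le> norm (- h * ?s)" by (rule abs_Re_le_cmod)
      also have "\<dots> \<le> 1 * (1 + \<bar>v\<bar>)" unfolding norm_mult using h ns by (intro mult_mono) auto
      finally show "exp \<bar>Re (- h * ?s)\<bar> \<le> exp (1 + \<bar>v\<bar>)" by simp
    qed (use s2 in \<open>auto intro!: mult_left_mono\<close>)
    finally have 1: "norm (exp (- h * ?s) - 1 + h * ?s) \<le> exp (1 + \<bar>v\<bar>) * ((norm h)\<^sup>2 * (4 * exp \<bar>v\<bar>))"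
      by (simp add: algebra_simps)
    have 2: "norm (E z v) \<le> exp (1/3 - v\<^sup>2 + norm z * (1 + \<bar>v\<bar>))"
      using norm_airy_exp_Complex[of 1 v z] by (simp add: E_def)
    have "E (z + h) v = E z v * exp (- h * ?s)"
      by (simp add: E_def algebra_simps flip: exp_add)
    then have "norm (E (z + h) v - E z v + h * (E z v * ?s)) = norm (E z v) * norm (exp (- h * ?s) - 1 + h * ?s)"
      by (simp add: algebra_simps flip: norm_mult)
    also have "\<dots> \<le> exp (1/3 - v\<^sup>2 + norm z * (1 + \<bar>v\<bar>)) * (exp (1 + \<bar>v\<bar>) * ((norm h)\<^sup>2 * (4 * exp \<bar>v\<bar>)))"
      using 1 2 by (intro mult_mono) auto
    also have "\<dots> = (norm h)\<^sup>2 * (4 * exp (4/3 + norm z) * (\<bar>v\<bar> ^ 0 * exp ((norm z + 2) * \<bar>v\<bar> - 1 * \<bar>v\<bar>\<^sup>2)))"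
      by (simp add: algebra_simps flip: exp_add)
    also have "\<dots> \<le> (norm h)\<^sup>2 * (4 * exp (4/3 + norm z) * (fact 0 * exp ((norm z + 2 + 2)\<^sup>2 / (4 * 1)) * exp (- \<bar>v\<bar>)))"
      by (intro mult_left_mono exp_gauss_le) auto
    also have "\<dots> = (norm h)\<^sup>2 * (C * exp (- \<bar>v\<bar>))"
      by (simp add: C_def)
    finally show ?thesis .
  qed
  have int0: "integrable lborel (E w)" for w
    using airy_line_integrable[of "\<lambda>_. 1" 0 0 1 w] by (simp add: E_def)
  have int1: "integrable lborel (\<lambda>v. E z v * Complex 1 v)"
  proof -
    have "norm (Complex 1 v) \<le> 1 * \<bar>v\<bar> ^ 1 + 1" for v using cmod_le[of "Complex 1 v"] by simp
    from airy_line_integrable[OF this, of z] show ?thesis by (simp add: E_def continuous_intros)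
  qed
  have line: "airy_line k w = (LINT v|lborel. E w v * Complex 1 v ^ k) / (2 * of_real pi)" for k w
    by (simp add: airy_line_def vertical_line_integral_def E_def)
  show ?thesis
  proof (rule has_field_derivative_quadratic_bound[where \<delta> = 1 and C = "(LINT v|lborel. C * exp (- \<bar>v\<bar>)) / (2 * pi)"])
    fix h :: complex assume h: "norm h < 1"
    have "Airy_Ai (z + h) - Airy_Ai z - h * - airy_line 1 z =
      (LINT v|lborel. E (z + h) v - E z v + h * (E z v * Complex 1 v)) / (2 * of_real pi)"
      unfolding Airy_Ai_eq_line line using int0[of "z+h"] int0[of z] int1
      by (simp add: Bochner_Integration.integral_add Bochner_Integration.integral_diff field_simps)
    also have "norm \<dots> = norm (LINT v|lborel. E (z + h) v - E z v + h * (E z v * Complex 1 v)) / (2 * pi)"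
      by (simp add: norm_divide norm_mult)
    also have "\<dots> \<le> (LINT v|lborel. (norm h)\<^sup>2 * (C * exp (- \<bar>v\<bar>))) / (2 * pi)"
    proof (intro divide_right_mono order_trans[OF integral_norm_bound integral_mono])
      show "integrable lborel (\<lambda>v. norm (E (z + h) v - E z v + h * (E z v * Complex 1 v)))"
        using int0[of "z+h"] int0[of z] int1 by (intro integrable_norm) auto
      show "integrable lborel (\<lambda>v. (norm h)\<^sup>2 * (C * exp (- \<bar>v\<bar>)))"
        using integrable_exp_minus_abs by simp
    qed (use bound[OF h] in auto)
    also have "\<dots> = (LINT v|lborel. C * exp (- \<bar>v\<bar>)) / (2 * pi) * (norm h)\<^sup>2"
      by simp
    finally show "norm (Airy_Ai (z + h) - Airy_Ai z - h * - airy_line 1 z) \<le> (LINT v|lborel. C * exp (- \<bar>v\<bar>)) / (2 * pi) * (norm h)\<^sup>2" .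
  qed simp
qed

section \<open>The Airy kernel as a double integral\<close>

text \<open>The inner integral is written in the variable \<open>w = - tau\<close>: the exponential
  of the t-integral then becomes another Airy integrand, and \<open>sigma - tau\<close> becomes
  \<open>\<sigma> + w\<close>, whose real part is at least that of \<open>\<sigma>\<close> on the
  rays.\<close>

definition airy_cauchy :: "complex \<Rightarrow> complex \<Rightarrow> complex" where
  "airy_cauchy \<xi> \<sigma> = airy_rays (\<lambda>w. airy_exp \<xi> w * (1 / (\<sigma> + w)))"

definition airy_double :: "complex \<Rightarrow> complex \<Rightarrow> complex" where
  "airy_double \<xi> \<eta> = vertical_line_integral 1 (\<lambda>\<sigma>. airy_exp \<eta> \<sigma> * airy_cauchy \<xi> \<sigma>) / (2 * of_real pi * \<i>)"

lemma norm_add_ge_Re: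
  fixes \<sigma> w :: complex
  assumes "Re \<sigma> \<ge> a" "Re w \<ge> 0"
  shows "norm (\<sigma> + w) \<ge> a"
  using assms complex_Re_le_cmod[of "\<sigma> + w"] by simp

lemma airy_cauchy_ok:
  assumes "Re \<sigma> \<ge> a" "a > 0"
  shows "ray_ok (\<lambda>w. airy_exp \<xi> w * (1 / (\<sigma> + w)))" (is ?A)
    "ray_ok (\<lambda>w. airy_exp \<xi> w * (1 / (\<sigma> + w)\<^sup>2))" (is ?B)
    "Re w \<ge> 0 \<Longrightarrow> norm (1 / (\<sigma> + w)) \<le> 1 / a"
    "Re w \<ge> 0 \<Longrightarrow> norm (1 / (\<sigma> + w)\<^sup>2) \<le> 1 / a\<^sup>2"
    "Re w \<ge> 0 \<Longrightarrow> \<sigma> + w \<noteq> 0"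
proof -
  have 1: "norm (1 / (\<sigma> + w)) \<le> 1 / a" if "Re w \<ge> 0" for w
    using norm_add_ge_Re[OF assms(1) that] assms(2) by (auto simp: norm_divide intro!: frac_le)
  then show "Re w \<ge> 0 \<Longrightarrow> norm (1 / (\<sigma> + w)) \<le> 1 / a" .
  have 2: "norm (1 / (\<sigma> + w)\<^sup>2) \<le> 1 / a\<^sup>2" if "Re w \<ge> 0" for w
    using norm_add_ge_Re[OF assms(1) that] assms(2) by (auto simp: norm_divide norm_power intro!: frac_le power_mono)
  then show "Re w \<ge> 0 \<Longrightarrow> norm (1 / (\<sigma> + w)\<^sup>2) \<le> 1 / a\<^sup>2" .
  have 3: "\<sigma> + w \<noteq> 0" if "Re w \<ge> 0" for w
    using norm_add_ge_Re[OF assms(1) that] assms(2) by auto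
  then show "Re w \<ge> 0 \<Longrightarrow> \<sigma> + w \<noteq> 0" .
  show ?A using 1 3 by (intro airy_ray_ok[where A = 0 and k = 0 and B = "1 / a"] continuous_intros) auto
  show ?B using 2 3 by (intro airy_ray_ok[where A = 0 and k = 0 and B = "1 / a\<^sup>2"] continuous_intros) auto
qed

lemma has_field_derivative_airy_cauchy:
  assumes "Re \<sigma> = 1"
  shows "(airy_cauchy \<xi> has_field_derivative - airy_rays (\<lambda>w. airy_exp \<xi> w * (1 / (\<sigma> + w)\<^sup>2))) (at \<sigma>)"
proof -
  obtain K where K: "K \<ge> 0" "\<And>h A. (\<And>w. Re w \<ge> 0 \<Longrightarrow> norm (h w) \<le> A) \<Longrightarrow> continuous_on {w. Re w \<ge> 0} h \<Longrightarrow>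
      norm (airy_rays (\<lambda>w. airy_exp \<xi> w * h w)) \<le> A * K"
    by (rule norm_airy_rays_le[of \<xi>]) blast
  show ?thesis
  proof (rule has_field_derivative_quadratic_bound[where \<delta> = "1/2" and C = "2 * K"])
    fix h :: complex assume h: "norm h < 1/2"
    let ?E = "\<lambda>w. airy_exp \<xi> w"
    have Re: "Re (\<sigma> + h) \<ge> 1/2" using assms h abs_Re_le_cmod[of h] by simp
    note ok = airy_cauchy_ok[OF Re] airy_cauchy_ok[of 1 \<sigma>]
    have "airy_cauchy \<xi> (\<sigma> + h) - airy_cauchy \<xi> \<sigma> - h * - airy_rays (\<lambda>w. ?E w * (1 / (\<sigma> + w)\<^sup>2)) =
      airy_rays (\<lambda>w. 1 * (1 * (?E w * (1 / (\<sigma> + h + w))) + (-1) * (?E w * (1 / (\<sigma> + w)))) + h * (?E w * (1 / (\<sigma> + w)\<^sup>2)))"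
      using ok assms by (simp only: airy_rays_lin airy_cauchy_def) simp
    also have "\<dots> = airy_rays (\<lambda>w. ?E w * (1 / (\<sigma> + h + w) - 1 / (\<sigma> + w) + h * (1 / (\<sigma> + w)\<^sup>2)))"
      by (simp add: algebra_simps)
    also have "norm \<dots> \<le> (2 * (norm h)\<^sup>2) * K"
    proof (rule K(2))
      fix w :: complex assume w: "0 \<le> Re w"
      have nz: "\<sigma> + h + w \<noteq> 0" "\<sigma> + w \<noteq> 0" using ok(5)[OF _ w] ok(10)[OF _ _ w] assms by auto
      have "(\<sigma> + w) * (\<sigma> + w)\<^sup>2 * (\<sigma> + h + w) \<noteq> 0" using nz by simp
      \<comment> \<open>The Taylor remainder of the Cauchy factor in closed form. The radius 1/2
        keeps the real part of \<open>\<sigma> + h\<close> at least 1/2, which produces the factor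
        2.\<close>
      have "1 / (\<sigma> + h + w) - 1 / (\<sigma> + w) + h * (1 / (\<sigma> + w)\<^sup>2) = h\<^sup>2 * ((1 / (\<sigma> + w)\<^sup>2) * (1 / (\<sigma> + h + w)))"
      proof -
        define p q where "p = \<sigma> + w" and "q = \<sigma> + h + w"
        have "p \<noteq> 0" "q \<noteq> 0" and h: "h = q - p" using nz by (auto simp: p_def q_def)
        then have "1 / q - 1 / p + h * (1 / p\<^sup>2) = h\<^sup>2 * ((1 / p\<^sup>2) * (1 / q))"
          unfolding h by (simp add: field_simps power2_eq_square)
        then show ?thesis by (simp add: p_def q_def)
      qed
      also have "norm \<dots> = (norm h)\<^sup>2 * (norm (1 / (\<sigma> + w)\<^sup>2) * norm (1 / (\<sigma> + h + w)))"
        by (simp only: norm_mult norm_power)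
      also have "\<dots> \<le> (norm h)\<^sup>2 * ((1 / 1\<^sup>2) * (1 / (1/2)))"
        by (intro mult_left_mono mult_mono ok(3) ok(9) w) (use assms in auto)
      finally show "norm (1 / (\<sigma> + h + w) - 1 / (\<sigma> + w) + h * (1 / (\<sigma> + w)\<^sup>2)) \<le> 2 * (norm h)\<^sup>2" by simp
    next
      show "continuous_on {w. 0 \<le> Re w} (\<lambda>w. 1 / (\<sigma> + h + w) - 1 / (\<sigma> + w) + h * (1 / (\<sigma> + w)\<^sup>2))"
        using ok(5) ok(10) assms by (intro continuous_intros) auto
    qed
    finally show "norm (airy_cauchy \<xi> (\<sigma> + h) - airy_cauchy \<xi> \<sigma> - h * - airy_rays (\<lambda>w. ?E w * (1 / (\<sigma> + w)\<^sup>2))) \<le> 2 * K * (norm h)\<^sup>2"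
      by (simp add: algebra_simps)
  qed simp
qed

text \<open>Integration by parts along the rays; the boundary terms at the origin cancel.\<close>

lemma airy_rays_by_parts:
  assumes \<sigma>: "Re \<sigma> = 1"
  shows "airy_rays (\<lambda>w. airy_exp \<xi> w * (1 / (\<sigma> + w)\<^sup>2)) =
    \<sigma>\<^sup>2 * airy_cauchy \<xi> \<sigma> - \<sigma> * airy_line 0 \<xi> + airy_line 1 \<xi> - \<xi> * airy_cauchy \<xi> \<sigma>"
proof -
  let ?E = "\<lambda>w. airy_exp \<xi> w"
  define P where "P = (\<lambda>w. ?E w * (1 / (\<sigma> + w)))"
  define f where "f = (\<lambda>w. ?E w * ((w\<^sup>2 - \<xi>) * (1 / (\<sigma> + w)) - 1 / (\<sigma> + w)\<^sup>2))"
  note ok = airy_cauchy_ok[of 1 \<sigma>, simplified \<sigma>, simplified]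
  have mono: "ray_ok (\<lambda>w. ?E w * w ^ k)" for k
    by (rule airy_ray_ok[where A = 1 and k = k and B = 0]) (auto simp: norm_power intro!: continuous_intros)
  \<comment> \<open>Dividing \<open>w\<^sup>2 - \<xi>\<close> by \<open>\<sigma> + w\<close> leaves
    the remainder \<open>\<sigma>\<^sup>2 - \<xi>\<close> and the quotient
    \<open>w - \<sigma>\<close>. Hence only Cauchy-type integrals and Airy integrals of order 0 and
    1 occur.\<close>
  have lin: "f w = 1 * (1 * ((\<sigma>\<^sup>2 - \<xi>) * P w + (-1) * (?E w * (1 / (\<sigma> + w)\<^sup>2))) + (- \<sigma>) * (?E w * w ^ 0)) + 1 * (?E w * w ^ 1)"
    if "Re w \<ge> 0" for w
  proof -
    define p where "p = \<sigma> + w"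
    have "p \<noteq> 0" using ok(5)[OF that] by (simp add: p_def)
    then have eq: "(w\<^sup>2 - \<xi>) * (1 / p) = (\<sigma>\<^sup>2 - \<xi>) * (1 / p) - \<sigma> + w"
      by (simp add: field_simps p_def power2_eq_square)
    then show ?thesis unfolding f_def P_def p_def[symmetric] eq
      by (simp add: algebra_simps diff_divide_distrib)
  qed
  have okP: "ray_ok P" and okD: "ray_ok (\<lambda>w. ?E w * (1 / (\<sigma> + w)\<^sup>2))"
    using ok(1,2) by (auto simp: P_def)
  have dP: "(P has_field_derivative f w) (at w)" if "\<sigma> + w \<noteq> 0" for w
  proof -
    have "(?E has_field_derivative ?E w * (w\<^sup>2 - \<xi>)) (at w)"
      by (auto intro!: derivative_eq_intros)
    moreover have "((\<lambda>w. 1 / (\<sigma> + w)) has_field_derivative - (1 / (\<sigma> + w)\<^sup>2)) (at w)"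
      using that by (auto intro!: derivative_eq_intros simp: power2_eq_square)
    ultimately have "(P has_field_derivative ?E w * (w\<^sup>2 - \<xi>) * (1 / (\<sigma> + w)) + - (1 / (\<sigma> + w)\<^sup>2) * ?E w) (at w)"
      unfolding P_def by (rule DERIV_mult)
    then show ?thesis by (simp add: f_def algebra_simps)
  qed
  have ray: "ray_integral \<theta> f = - P 0" if \<theta>: "\<theta> \<in> {pi/4, - (pi/4)}" for \<theta>
  proof -
    have ang: "airy_angle \<theta>" using \<theta> by (auto simp: airy_angle_def)
    have pos: "Re (of_real r * cis \<theta>) \<ge> 0" if "r \<ge> 0" for r
      using airy_angle_cos(2)[OF ang] that by simp
    have nz: "r \<ge> 0 \<Longrightarrow> \<sigma> + of_real r * cis \<theta> \<noteq> 0" for r using ok(5)[OF pos] .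
    have "((\<lambda>R. P (of_real R * cis \<theta>)) \<longlongrightarrow> P 0 + ray_integral \<theta> f) at_top"
    proof (rule ray_integral_tendsto)
      fix r :: real assume r: "r \<ge> 0"
      show "(P has_field_derivative f (of_real r * cis \<theta>)) (at (of_real r * cis \<theta>))"
        using dP nz[OF r] by blast
    next
      show "continuous_on {0..} (\<lambda>r. f (of_real r * cis \<theta>))"
        unfolding f_def using nz by (intro continuous_intros) auto
      have "ray_ok (\<lambda>w. 1 * (1 * ((\<sigma>\<^sup>2 - \<xi>) * P w + (-1) * (?E w * (1 / (\<sigma> + w)\<^sup>2))) + (- \<sigma>) * (?E w * w ^ 0)) + 1 * (?E w * w ^ 1))"
        by (intro airy_rays_lin(1) okP okD mono)
      then have "set_integrable lborel {0..} (\<lambda>r. (\<lambda>w. 1 * (1 * ((\<sigma>\<^sup>2 - \<xi>) * P w + (-1) * (?E w * (1 / (\<sigma> + w)\<^sup>2))) + (- \<sigma>) * (?E w * w ^ 0)) + 1 * (?E w * w ^ 1)) (of_real r * cis \<theta>))"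
        using \<theta> unfolding ray_ok_def by blast
      then show "set_integrable lborel {0..} (\<lambda>r. f (of_real r * cis \<theta>))"
        by (rule set_integrable_cong[THEN iffD1, OF refl refl, rotated]) (use lin pos in auto)
    qed
    moreover have "((\<lambda>R. P (of_real R * cis \<theta>)) \<longlongrightarrow> 0) at_top"
    proof -
      obtain C where C: "\<And>r. r \<ge> 0 \<Longrightarrow> norm (P (of_real r * cis \<theta>)) \<le> C * exp (- r)"
        using airy_ray_bound[OF ang, of "\<lambda>w. 1 / (\<sigma> + w)" 0 0 1 \<xi>] ok(3)[OF pos] unfolding P_def by auto
      have "((\<lambda>r. C * exp (- r)) \<longlongrightarrow> 0) at_top"
        by (intro tendsto_mult_right_zero filterlim_compose[OF exp_at_bot] filterlim_uminus_at_bot_at_top)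
      then show ?thesis
        by (rule Lim_null_comparison[rotated]) (rule eventually_mono[OF eventually_ge_at_top[of 0] C])
    qed
    ultimately have "P 0 + ray_integral \<theta> f = 0"
      using tendsto_unique trivial_limit_at_top_linorder by blast
    then show ?thesis by (simp add: eq_neg_iff_add_eq_0 add.commute)
  qed
  have "airy_rays f = airy_rays (\<lambda>w. 1 * (1 * ((\<sigma>\<^sup>2 - \<xi>) * P w + (-1) * (?E w * (1 / (\<sigma> + w)\<^sup>2))) + (- \<sigma>) * (?E w * w ^ 0)) + 1 * (?E w * w ^ 1))"
  proof -
    have "ray_integral \<theta> f = ray_integral \<theta> (\<lambda>w. 1 * (1 * ((\<sigma>\<^sup>2 - \<xi>) * P w + (-1) * (?E w * (1 / (\<sigma> + w)\<^sup>2))) + (- \<sigma>) * (?E w * w ^ 0)) + 1 * (?E w * w ^ 1))"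
      if ang: "airy_angle \<theta>" for \<theta>
      unfolding ray_integral_def
      by (rule set_lebesgue_integral_cong) (use lin[of "of_real _ * cis \<theta>"] airy_angle_cos(2)[OF ang] in auto)
    from this[of "pi/4"] this[of "-(pi/4)"] show ?thesis by (simp only: airy_rays_def airy_angle_def) simp
  qed
  also have "\<dots> = (\<sigma>\<^sup>2 - \<xi>) * airy_cauchy \<xi> \<sigma> - airy_rays (\<lambda>w. ?E w * (1 / (\<sigma> + w)\<^sup>2)) - \<sigma> * airy_line 0 \<xi> + airy_line 1 \<xi>"
    by (simp only: airy_rays_lin okP okD mono airy_rays_eq_line) (simp add: P_def airy_cauchy_def)
  finally have "airy_rays f = \<dots>" .
  moreover have "airy_rays f = 0" unfolding airy_rays_def using ray by simp
  ultimately show ?thesis by (simp add: algebra_simps)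
qed

lemma airy_cauchy_bound:
  obtains K where "K \<ge> 0" "\<And>\<sigma>. Re \<sigma> = 1 \<Longrightarrow> norm (airy_cauchy \<xi> \<sigma>) \<le> K"
proof -
  obtain K where K: "K \<ge> 0" "\<And>h A. (\<And>w. Re w \<ge> 0 \<Longrightarrow> norm (h w) \<le> A) \<Longrightarrow> continuous_on {w. Re w \<ge> 0} h \<Longrightarrow>
      norm (airy_rays (\<lambda>w. airy_exp \<xi> w * h w)) \<le> A * K"
    by (rule norm_airy_rays_le[of \<xi>]) blast
  have "norm (airy_cauchy \<xi> \<sigma>) \<le> 1 * K" if "Re \<sigma> = 1" for \<sigma>
    unfolding airy_cauchy_def using airy_cauchy_ok[of 1 \<sigma>] that
    by (intro K(2) continuous_intros) auto
  with K(1) show ?thesis using that[of K] by simp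
qed

text \<open>The function \<open>f\<close> is the derivative of \<open>Q\<close>, which decays along
  the line, so its integral is 0. In this derivative the two terms with
  \<open>\<sigma>\<^sup>2\<close>, one from each exponential, cancel; there remain
  \<open>\<xi> - \<eta>\<close> times the double integrand and products of single Airy
  integrals.\<close>

lemma airy_double_eq:
  "(\<xi> - \<eta>) * airy_double \<xi> \<eta> = Airy_Ai \<xi> * deriv Airy_Ai \<eta> - deriv Airy_Ai \<xi> * Airy_Ai \<eta>"
proof -
  let ?e = "\<lambda>\<sigma>. airy_exp \<eta> \<sigma>"
  define Q where "Q = (\<lambda>\<sigma>. ?e \<sigma> * airy_cauchy \<xi> \<sigma>)"
  define A0 A1 where "A0 = airy_line 0 \<xi>" and "A1 = airy_line 1 \<xi>"
  define f where "f = (\<lambda>\<sigma>. ?e \<sigma> * (\<sigma> * A0 - A1 + (\<xi> - \<eta>) * airy_cauchy \<xi> \<sigma>))"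
  obtain K where K: "K \<ge> 0" "\<And>\<sigma>. Re \<sigma> = 1 \<Longrightarrow> norm (airy_cauchy \<xi> \<sigma>) \<le> K"
    using airy_cauchy_bound[of \<xi>] by blast
  have Q: "(Q has_field_derivative f \<sigma>) (at \<sigma>)" if \<sigma>: "Re \<sigma> = 1" for \<sigma>
  proof -
    have "(Q has_field_derivative (\<sigma>\<^sup>2 - \<eta>) * ?e \<sigma> * airy_cauchy \<xi> \<sigma> - airy_rays (\<lambda>w. airy_exp \<xi> w * (1 / (\<sigma> + w)\<^sup>2)) * ?e \<sigma>) (at \<sigma>)"
      unfolding Q_def
      by (rule derivative_eq_intros has_field_derivative_airy_cauchy[OF \<sigma>] | simp)+
    then show ?thesis
      unfolding airy_rays_by_parts[OF \<sigma>] f_def A0_def A1_def by (simp add: algebra_simps)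
  qed
  have contC: "continuous_on {z. Re z = 1} (airy_cauchy \<xi>)"
    using has_field_derivative_airy_cauchy by (intro continuous_at_imp_continuous_on) (auto intro: DERIV_isCont)
  have intC: "integrable lborel (\<lambda>v. ?e (Complex 1 v) * airy_cauchy \<xi> (Complex 1 v))"
    using K(2) by (intro airy_line_integrable[where A = 0 and B = K and k = 0] contC) auto
  have intP: "integrable lborel (\<lambda>v. ?e (Complex 1 v) * Complex 1 v ^ k)" if "k \<le> 1" for k
  proof (rule airy_line_integrable[where A = 1 and B = 1 and k = k])
    show "norm (Complex 1 v ^ k) \<le> 1 * \<bar>v\<bar> ^ k + 1" for v
      using that cmod_le[of "Complex 1 v"] by (cases k) auto
  qed (intro continuous_intros)
  have fsplit: "f \<sigma> = A0 * (?e \<sigma> * \<sigma> ^ 1) - A1 * (?e \<sigma> * \<sigma> ^ 0) + (\<xi> - \<eta>) * (?e \<sigma> * airy_cauchy \<xi> \<sigma>)" for \<sigma>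
    by (simp add: f_def algebra_simps)
  have "((\<lambda>V. Q (Complex 1 V) - Q (Complex 1 (- V))) \<longlongrightarrow> vertical_line_integral 1 f) at_top"
  proof (rule vertical_line_integral_tendsto)
    show "continuous_on {z. Re z = 1} f"
      unfolding f_def by (intro continuous_intros contC) auto
    show "integrable lborel (\<lambda>v. f (Complex 1 v))"
      unfolding fsplit using intP[of 0] intP[of 1] intC by auto
  qed (use Q in auto)
  moreover have "((\<lambda>V. Q (Complex 1 V) - Q (Complex 1 (- V))) \<longlongrightarrow> 0) at_top"
  proof -
    obtain C where C: "\<And>v. norm (Q (Complex 1 v)) \<le> C * exp (- \<bar>v\<bar>)"
      using airy_line_bound[of "airy_cauchy \<xi>" 0 0 K \<eta>] K(2) unfolding Q_def by auto
    have lim: "((\<lambda>r. C * exp (- \<bar>r\<bar>)) \<longlongrightarrow> 0) at_top"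
      by (intro tendsto_mult_right_zero filterlim_compose[OF exp_at_bot] filterlim_compose[OF filterlim_uminus_at_bot_at_top] filterlim_abs_real)
    have "((\<lambda>V. Q (Complex 1 V)) \<longlongrightarrow> 0) at_top" "((\<lambda>V. Q (Complex 1 (- V))) \<longlongrightarrow> 0) at_top"
      using C[of "- _"] by (auto intro!: Lim_null_comparison[OF _ lim] always_eventually C)
    then show ?thesis using tendsto_diff by fastforce
  qed
  ultimately have "vertical_line_integral 1 f = 0"
    using tendsto_unique trivial_limit_at_top_linorder by blast
  then have zero: "(LINT v|lborel. f (Complex 1 v)) = 0"
    by (simp add: vertical_line_integral_def)
  have split: "(LINT v|lborel. f (Complex 1 v)) = A0 * (LINT v|lborel. ?e (Complex 1 v) * Complex 1 v ^ 1) -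
      A1 * (LINT v|lborel. ?e (Complex 1 v) * Complex 1 v ^ 0) + (\<xi> - \<eta>) * (LINT v|lborel. ?e (Complex 1 v) * airy_cauchy \<xi> (Complex 1 v))"
    unfolding fsplit using intP[of 0] intP[of 1] intC
    by (subst Bochner_Integration.integral_add, simp, simp, subst Bochner_Integration.integral_diff) auto
  have lines: "(LINT v|lborel. ?e (Complex 1 v) * Complex 1 v ^ k) = 2 * of_real pi * airy_line k \<eta>" for k
    by (simp add: airy_line_def vertical_line_integral_def)
  have dbl: "(LINT v|lborel. ?e (Complex 1 v) * airy_cauchy \<xi> (Complex 1 v)) = 2 * of_real pi * airy_double \<xi> \<eta>"
    by (simp add: airy_double_def vertical_line_integral_def)
  have "2 * of_real pi * (A0 * airy_line 1 \<eta> - A1 * airy_line 0 \<eta> + (\<xi> - \<eta>) * airy_double \<xi> \<eta>) = 0"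
    using split[unfolded zero lines dbl] by (simp add: algebra_simps)
  then have "A0 * airy_line 1 \<eta> - A1 * airy_line 0 \<eta> + (\<xi> - \<eta>) * airy_double \<xi> \<eta> = 0"
    by simp
  moreover have "deriv Airy_Ai w = - airy_line 1 w" for w
    using has_field_derivative_Airy_Ai by (rule DERIV_imp_deriv)
  ultimately show ?thesis
    by (simp add: A0_def A1_def Airy_Ai_eq_line algebra_simps add_eq_0_iff2)
qed

section \<open>The phase function\<close>

text \<open>The condition is homogeneous, so it passes from \<open>w\<close> to \<open>n * w\<close>
  with the same constant.\<close>

definition in_sector :: "real \<Rightarrow> complex \<Rightarrow> bool" where
  "in_sector \<delta> z \<longleftrightarrow> (\<forall>x\<ge>0. \<delta> * (norm z + x) \<le> norm (z + of_real x))"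

lemma in_sectorD: "in_sector \<delta> z \<Longrightarrow> x \<ge> 0 \<Longrightarrow> \<delta> * (norm z + x) \<le> norm (z + of_real x)"
  by (simp add: in_sector_def)

lemma in_sector_Re:
  assumes "Re z \<ge> 0"
  shows "in_sector (1/2) z"
  unfolding in_sector_def
proof (intro allI impI)
  fix x :: real assume x: "x \<ge> 0"
  have "norm z \<le> norm (z + of_real x)"
  proof -
    have "(Re z)\<^sup>2 \<le> (Re z + x)\<^sup>2" using assms x by (intro power_mono) auto
    then show ?thesis by (simp add: cmod_def)
  qed
  moreover have "x \<le> norm (z + of_real x)"
    using complex_Re_le_cmod[of "z + of_real x"] assms x by simp
  ultimately show "1/2 * (norm z + x) \<le> norm (z + of_real x)" by simp
qed

text \<open>For \<open>x\<close> beyond \<open>2 * norm z\<close> the translation dominates and the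
  triangle inequality suffices; for smaller \<open>x\<close> the imaginary part, which translation
  leaves unchanged, gives the bound.\<close>

lemma in_sector_Im:
  assumes "\<bar>Im z\<bar> \<ge> \<kappa> * norm z" "0 < \<kappa>" "\<kappa> \<le> 1"
  shows "in_sector (\<kappa> / 3) z"
  unfolding in_sector_def
proof (intro allI impI)
  fix x :: real assume x: "x \<ge> 0"
  have 1: "\<kappa> * norm z \<le> norm (z + of_real x)"
    using abs_Im_le_cmod[of "z + of_real x"] assms by simp
  show "\<kappa> / 3 * (norm z + x) \<le> norm (z + of_real x)"
  proof (cases "x \<ge> 2 * norm z")
    case True
    have "x - norm z \<le> norm (z + of_real x)"
      using norm_triangle_ineq2[of "of_real x" "- z"] x by (simp add: add.commute)
    moreover have "\<kappa> / 3 * (norm z + x) \<le> 1 / 3 * (norm z + x)"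
      using assms x by (intro mult_right_mono) auto
    ultimately show ?thesis using True by simp
  next
    case False
    then have "\<kappa> / 3 * (norm z + x) \<le> \<kappa> / 3 * (3 * norm z)"
      using assms by (intro mult_left_mono) auto
    with 1 show ?thesis by simp
  qed
qed

lemma in_sector_mono: "in_sector \<delta> z \<Longrightarrow> \<delta>' \<le> \<delta> \<Longrightarrow> in_sector \<delta>' z"
  unfolding in_sector_def
  by (meson add_nonneg_nonneg mult_right_mono norm_ge_zero order_trans)

lemma in_sector_scale:
  assumes "r > 0" "in_sector \<delta> z"
  shows "in_sector \<delta> (of_real r * z)"
  unfolding in_sector_def
proof (intro allI impI)
  fix x :: real assume "x \<ge> 0"
  then have "\<delta> * (norm z + x / r) \<le> norm (z + of_real (x / r))"
    using assms by (intro in_sectorD) auto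
  then have "r * (\<delta> * (norm z + x / r)) \<le> r * norm (z + of_real (x / r))"
    using assms by (intro mult_left_mono) auto
  also have "r * norm (z + of_real (x / r)) = norm (of_real r * (z + of_real (x / r)))"
    using assms by (simp add: norm_mult)
  also have "of_real r * (z + of_real (x / r)) = of_real r * z + of_real x"
    using assms by (simp add: algebra_simps)
  finally show "\<delta> * (norm (of_real r * z) + x) \<le> norm (of_real r * z + of_real x)"
    using assms by (simp add: norm_mult algebra_simps)
qed

lemma in_sector_not_nonpos_Reals:
  assumes "in_sector \<delta> z" "\<delta> > 0" "z \<noteq> 0" "x \<ge> 0"
  shows "z + of_real x \<notin> \<real>\<^sub>\<le>\<^sub>0"
proof
  assume "z + of_real x \<in> \<real>\<^sub>\<le>\<^sub>0"
  then obtain y where y: "z + of_real x = of_real y" "y \<le> 0" by (auto elim!: nonpos_Reals_cases)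
  have "\<delta> * (norm z + (x - y)) \<le> norm (z + of_real (x - y))"
    using assms y by (intro in_sectorD) auto
  moreover have "z + of_real (x - y) = 0" using y by (simp add: add_diff_eq)
  moreover have "\<delta> * (norm z + (x - y)) > 0" using assms y by (intro mult_pos_pos add_pos_nonneg) auto
  ultimately show False by simp
qed

text \<open>Each unit shift changes \<open>Digamma\<close> by a reciprocal, which the sector
  condition bounds by \<open>1 / (\<delta> * norm z)\<close>. The fixed parameters
  \<open>\<nu> j\<close> thus only affect the constant of the error term.\<close>

lemma norm_Digamma_shift_minus_Ln_le:
  assumes "in_sector \<delta> z" "\<delta> > 0" "norm z \<ge> 1" "\<delta> * norm z \<ge> 2"
  shows "norm (Digamma (z + of_nat m) - Ln z) \<le> (4 / \<delta>\<^sup>2 + real m / \<delta>) / norm z"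
proof -
  have z: "z \<noteq> 0" using assms by auto
  have nn: "z + of_nat k \<notin> \<real>\<^sub>\<le>\<^sub>0" for k
    using in_sector_not_nonpos_Reals[OF assms(1,2) z, of "real k"] by simp
  have "norm (Digamma z - Ln z) \<le> (4 / \<delta>\<^sup>2) / norm z"
    using assms nn[of 0] in_sectorD[OF assms(1)] by (intro norm_Digamma_minus_Ln_le) auto
  moreover have "norm (Digamma (z + of_nat m) - Digamma z) \<le> real m / \<delta> / norm z"
  proof (induction m)
    case (Suc m)
    have "\<delta> * norm z \<le> \<delta> * (norm z + real m)" using assms by simp
    also have "\<dots> \<le> norm (z + of_nat m)" using in_sectorD[OF assms(1), of "real m"] by simp
    finally have "1 / norm (z + of_nat m) \<le> 1 / (\<delta> * norm z)"
      using assms by (intro divide_left_mono mult_pos_pos) auto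
    moreover have eq: "Digamma (z + of_nat (Suc m)) - Digamma z = (Digamma (z + of_nat m) - Digamma z) + 1 / (z + of_nat m)"
      using Digamma_plus1[of "z + of_nat m"] nn[of m] nonpos_Reals_zero_I by (fastforce simp: algebra_simps)
    ultimately have "norm (Digamma (z + of_nat (Suc m)) - Digamma z) \<le> real m / \<delta> / norm z + 1 / (\<delta> * norm z)"
      using Suc norm_triangle_ineq[of "Digamma (z + of_nat m) - Digamma z" "1 / (z + of_nat m)"]
      unfolding eq by (simp add: norm_divide)
    also have "\<dots> = real (Suc m) / \<delta> / norm z" using assms z by (simp add: field_simps)
    finally show ?case .
  qed simp
  ultimately show ?thesis
    using norm_triangle_ineq[of "Digamma z - Ln z" "Digamma (z + of_nat m) - Digamma z"]
    by (simp add: algebra_simps add_divide_distrib)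
qed

lemma diff_le_of_deriv_le:
  fixes f h :: "real \<Rightarrow> real"
  assumes "a \<le> b" "\<And>x. a \<le> x \<Longrightarrow> x \<le> b \<Longrightarrow> (f has_real_derivative f' x) (at x)"
    "\<And>x. a \<le> x \<Longrightarrow> x \<le> b \<Longrightarrow> (h has_real_derivative h' x) (at x)"
    "\<And>x. a \<le> x \<Longrightarrow> x \<le> b \<Longrightarrow> f' x \<le> h' x"
  shows "f b - f a \<le> h b - h a"
proof -
  have "h a - f a \<le> h b - f b"
  proof (rule DERIV_nonneg_imp_nondecreasing[of a b "\<lambda>x. h x - f x"])
    fix x assume "a \<le> x" "x \<le> b"
    then show "\<exists>y. ((\<lambda>x. h x - f x) has_real_derivative y) (at x) \<and> 0 \<le> y"
      using assms by (intro exI[of _ "h' x - f' x"]) (auto intro!: derivative_intros)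
  qed fact
  then show ?thesis by simp
qed

section \<open>The phase and its double critical point\<close>

locale ginibre_product =
  fixes M :: nat and \<nu> :: "nat \<Rightarrow> nat"
  assumes M1: "M \<ge> 1"
begin

text \<open>This is the distance from the branch point 1 to the critical point, and hence also the
  height at which the side leaving at angle 3 pi / 4 reaches real part 1.\<close>

definition e :: real where "e = 1 / real M"
definition w0 :: real where "w0 = 1 + e"

text \<open>\<open>n * g (t / n)\<close> is the leading part of \<open>log (F n t) - t * log (n ^ M * x_star M)\<close>, and \<open>w0\<close> is a
  double zero of \<open>g1\<close>, the derivative of \<open>g\<close>.\<close>

definition g :: "complex \<Rightarrow> complex" where
  "g w = (of_nat M + 1) * (w * Ln w - w) - ((w - 1) * Ln (w - 1) - (w - 1)) - w * of_real (ln (x_star M))"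
definition g1 :: "complex \<Rightarrow> complex" where
  "g1 w = (of_nat M + 1) * Ln w - Ln (w - 1) - of_real (ln (x_star M))"
definition g2 :: "complex \<Rightarrow> complex" where
  "g2 w = (of_nat M + 1) / w - 1 / (w - 1)"

lemma e_bounds: "e > 0" "e \<le> 1" "real M * e = 1" "w0 > 1" "w0 \<le> 2"
  using M1 by (auto simp: e_def w0_def)

lemma x_star_eq: "x_star M = real M * (1 + e) ^ (M + 1)" "x_star M > 0"
proof -
  have "real M + 1 = real M * (1 + e)" using e_bounds by (simp add: algebra_simps)
  then show 1: "x_star M = real M * (1 + e) ^ (M + 1)"
    using M1 by (simp add: x_star_def power_mult_distrib)
  show "x_star M > 0" unfolding 1 using M1 e_bounds by simp
qed

text \<open>Since \<open>w0 - 1 = e\<close>, this is the equation \<open>g1 w0 = 0\<close> in real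
  form.\<close>

lemma ln_x_star: "ln (x_star M) = (real M + 1) * ln w0 - ln e"
proof -
  have "ln (x_star M) = ln (real M) + (real M + 1) * ln (1 + e)"
    using M1 e_bounds unfolding x_star_eq(1)
    by (subst ln_mult) (auto simp: ln_realpow algebra_simps simp del: power_Suc)
  moreover have "ln (real M) = - ln e" using M1 by (simp add: e_def ln_div)
  ultimately show ?thesis by (simp add: w0_def)
qed

lemma minus1_nonpos: "w - 1 \<notin> \<real>\<^sub>\<le>\<^sub>0 \<Longrightarrow> w \<notin> \<real>\<^sub>\<le>\<^sub>0" for w :: complex
  by (auto simp: complex_nonpos_Reals_iff)

lemma has_field_derivative_g:
  assumes "w - 1 \<notin> \<real>\<^sub>\<le>\<^sub>0"
  shows "(g has_field_derivative g1 w) (at w within A)"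
proof -
  have "w \<noteq> 0" "w - 1 \<noteq> 0" using assms minus1_nonpos[OF assms] by auto
  then show ?thesis
    unfolding g_def g1_def using assms minus1_nonpos[OF assms]
    by (auto intro!: derivative_eq_intros)
qed

lemma has_field_derivative_g1:
  assumes "w - 1 \<notin> \<real>\<^sub>\<le>\<^sub>0"
  shows "(g1 has_field_derivative g2 w) (at w within A)"
proof -
  have "w \<noteq> 0" "w - 1 \<noteq> 0" using assms minus1_nonpos[OF assms] by auto
  then show ?thesis
    unfolding g1_def g2_def using assms minus1_nonpos[OF assms]
    by (auto intro!: derivative_eq_intros simp: field_simps)
qed

lemma g1_w0: "g1 (of_real w0) = 0"
proof -
  have "Ln (of_real w0) = of_real (ln w0)" "Ln (of_real w0 - 1) = of_real (ln e)"
    using e_bounds Ln_of_real[of w0] Ln_of_real[of e] by (simp_all add: w0_def)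
  then show ?thesis by (simp add: g1_def ln_x_star)
qed

lemma g2_eq:
  assumes "w \<noteq> 0" "w \<noteq> 1"
  shows "g2 w = of_nat M * (w - of_real w0) / (w * (w - 1))"
proof -
  have "of_nat M * of_real e = (1::complex)" using e_bounds(3) by (metis of_real_mult of_real_1 of_real_of_nat_eq)
  then show ?thesis using assms by (simp add: g2_def w0_def field_simps)
qed

text \<open>The disc of radius \<open>e / 2\<close> around \<open>w0\<close> stays at distance
  \<open>e / 2\<close> to the right of the branch point 1, which bounds the fourth derivative. The
  first two derivatives vanish at \<open>w0\<close>, and the third equals M^3 / (M + 1)
  there.\<close>

lemma g_taylor:
  assumes "norm (w - of_real w0) \<le> e / 2"
  shows "norm (g w - g (of_real w0) - of_real (real M ^ 3 / (6 * (real M + 1))) * (w - of_real w0) ^ 3)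
    \<le> ((2 * (real M + 1) + 2) / (e / 2) ^ 3) * norm (w - of_real w0) ^ 4"
proof -
  define S where "S = cball (of_real w0 :: complex) (e / 2)"
  define f :: "nat \<Rightarrow> complex \<Rightarrow> complex" where "f i = (if i = 0 then g else if i = 1 then g1 else if i = 2 then g2
    else if i = 3 then (\<lambda>w. - (of_nat M + 1) / w ^ 2 + 1 / (w - 1) ^ 2)
    else (\<lambda>w. 2 * (of_nat M + 1) / w ^ 3 - 2 / (w - 1) ^ 3))" for i
  have S: "Re w - 1 \<ge> e / 2" "norm w \<ge> e / 2" "norm (w - 1) \<ge> e / 2" "w - 1 \<notin> \<real>\<^sub>\<le>\<^sub>0" "w \<noteq> 0" "w \<noteq> 1" if "w \<in> S" for w
  proof -
    have "\<bar>Re w - w0\<bar> \<le> e / 2"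
      using that abs_Re_le_cmod[of "of_real w0 - w"] by (auto simp: S_def dist_norm abs_minus_commute)
    then show *: "Re w - 1 \<ge> e / 2" unfolding w0_def by linarith
    show "norm w \<ge> e / 2" using * complex_Re_le_cmod[of w] e_bounds by linarith
    show "norm (w - 1) \<ge> e / 2" using * complex_Re_le_cmod[of "w - 1"] by simp
    show "w - 1 \<notin> \<real>\<^sub>\<le>\<^sub>0" "w \<noteq> 0" "w \<noteq> 1" using * e_bounds by (auto simp: complex_nonpos_Reals_iff)
  qed
  have "norm (f 0 w - (\<Sum>i\<le>3. f i (of_real w0) * (w - of_real w0) ^ i / fact i))
     \<le> ((2 * (real M + 1) + 2) / (e / 2) ^ 3) * norm (w - of_real w0) ^ Suc 3 / fact 3"
  proof (rule complex_Taylor[where S = S])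
    show "convex S" by (simp add: S_def)
    show "w \<in> S" "of_real w0 \<in> S" using assms e_bounds by (auto simp: S_def dist_norm norm_minus_commute)
  next
    fix i x assume "x \<in> S" "i \<le> (3::nat)"
    then consider "i = 0" | "i = 1" | "i = 2" | "i = 3" by linarith
    then show "(f i has_field_derivative f (Suc i) x) (at x within S)"
    proof cases
      case 3
      then show ?thesis
        unfolding f_def g2_def using S[OF \<open>x \<in> S\<close>]
        by (auto intro!: derivative_eq_intros simp: power2_eq_square)
    next
      case 4
      have "((\<lambda>w. - (of_nat M + 1) / w ^ 2 + 1 / (w - 1) ^ 2) has_field_derivative
         (2 * (of_nat M + 1) / x ^ 3 - 2 / (x - 1) ^ 3)) (at x within S)"
        using S[OF \<open>x \<in> S\<close>]
        apply (auto intro!: derivative_eq_intros)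
        apply (simp add: divide_simps)
        apply (simp add: algebra_simps eval_nat_numeral)
        done
      then show ?thesis using 4 by (simp add: f_def)
    qed (use S[OF \<open>x \<in> S\<close>] has_field_derivative_g has_field_derivative_g1 in \<open>auto simp: f_def\<close>)
  next
    fix x assume x: "x \<in> S"
    have "norm (f (Suc 3) x) \<le> norm (2 * (of_nat M + 1) / x ^ 3) + norm (2 / (x - 1) ^ 3)"
      unfolding f_def by (simp add: norm_triangle_ineq4)
    also have "\<dots> = 2 * (real M + 1) / norm x ^ 3 + 2 / norm (x - 1) ^ 3"
    proof -
      have "norm (2 * (of_nat M + 1) :: complex) = norm (of_nat (2 * (M + 1)) :: complex)" by (simp add: algebra_simps)
      also have "\<dots> = 2 * (real M + 1)" by (subst norm_of_nat) simp
      finally show ?thesis by (simp only: norm_divide norm_power) simp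
    qed
    also have "\<dots> \<le> 2 * (real M + 1) / (e / 2) ^ 3 + 2 / (e / 2) ^ 3"
      using S[OF x] e_bounds by (intro add_mono divide_left_mono power_mono mult_pos_pos zero_less_power) auto
    finally show "norm (f (Suc 3) x) \<le> (2 * (real M + 1) + 2) / (e / 2) ^ 3"
      by (simp add: add_divide_distrib)
  qed
  also have "\<dots> \<le> ((2 * (real M + 1) + 2) / (e / 2) ^ 3) * norm (w - of_real w0) ^ 4"
    using e_bounds by (simp add: eval_nat_numeral fact_numeral field_simps)
  also have "(\<Sum>i\<le>3. f i (of_real w0) * (w - of_real w0) ^ i / fact i) =
     g (of_real w0) + of_real (real M ^ 3 / (6 * (real M + 1))) * (w - of_real w0) ^ 3"
  proof -
    have "g2 (of_real w0) = 0" using e_bounds g2_eq[of "of_real w0"]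
      by (metis cancel_comm_monoid_add_class.diff_cancel div_0 less_irrefl less_trans mult_zero_right of_real_eq_0_iff of_real_eq_1_iff zero_less_one)
    moreover have "f 3 (of_real w0) = of_real (real M ^ 3 / (real M + 1))"
    proof -
      have M0: "real M > 0" using M1 by simp
      have "f 3 (of_real w0) = of_real (- (real M + 1) / w0 ^ 2 + 1 / (w0 - 1) ^ 2)"
        by (simp add: f_def)
      also have "- (real M + 1) / w0 ^ 2 + 1 / (w0 - 1) ^ 2 = real M ^ 3 / (real M + 1)"
      proof -
        have "w0 = (real M + 1) / real M" using M0 by (simp add: w0_def e_def field_simps)
        then show ?thesis using M0
          by (simp add: w0_def e_def divide_simps) (simp add: algebra_simps eval_nat_numeral)
      qed
      finally show ?thesis .
    qed
    ultimately show ?thesis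
      using g1_w0 by (simp add: eval_nat_numeral f_def[of 0] f_def[of 1] f_def[of 2] f_def[of "Suc 0"] f_def[of "Suc (Suc 0)"] fact_numeral)
  qed
  finally show ?thesis by (simp add: f_def algebra_simps)
qed

section \<open>The phase along the contours\<close>

text \<open>Along the line the derivative of \<open>Re g\<close> is \<open>- Im g1\<close>, and that
  of \<open>Im g1\<close> is \<open>Re g2\<close>. The latter is nonnegative, and at least
  \<open>d / 50\<close> up to height 1; two integrations give the quadratic bound, and above height
  1 the slope already gained is kept. The bound is proportional to the displacement
  \<open>d\<close>, which is why the line must not pass through \<open>w0\<close> itself.\<close>

lemma Re_g_vertical:
  assumes d: "0 \<le> d" "d \<le> 1" and y: "y \<ge> 0"
  shows "Re (g (Complex (w0 + d) y)) - Re (g (of_real (w0 + d))) \<le> - (d / 100) * (if y \<le> 1 then y\<^sup>2 else y)"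
proof -
  define q where "q = w0 + d"
  have q: "q > 1" "q \<le> 3" using d e_bounds by (auto simp: q_def)
  have nn: "Complex q y - 1 \<notin> \<real>\<^sub>\<le>\<^sub>0" for y
    using q by (auto simp: complex_nonpos_Reals_iff)
  have cd: "((\<lambda>y. Complex q y) has_vector_derivative \<i>) (at y)" for y
    unfolding Complex_eq by (auto intro!: derivative_eq_intros)
  have dg: "((\<lambda>y. Re (g (Complex q y))) has_real_derivative - Im (g1 (Complex q y))) (at y)" for y
  proof -
    have "((g \<circ> (\<lambda>y. Complex q y)) has_vector_derivative \<i> * g1 (Complex q y)) (at y)"
      by (intro field_vector_diff_chain_at cd has_field_derivative_g nn)
    from has_field_derivative_Re[OF this] show ?thesis by (simp add: o_def)
  qed
  have dg1: "((\<lambda>y. Im (g1 (Complex q y))) has_real_derivative Re (g2 (Complex q y))) (at y)" for y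
  proof -
    have "((g1 \<circ> (\<lambda>y. Complex q y)) has_vector_derivative \<i> * g2 (Complex q y)) (at y)"
      by (intro field_vector_diff_chain_at cd has_field_derivative_g1 nn)
    from has_field_derivative_Im[OF this] show ?thesis by (simp add: o_def)
  qed
  have Re_g2: "Re (g2 (Complex q y)) = (q * (q - 1) * (real M * d) + y\<^sup>2 * (real M * q + 1)) / ((q\<^sup>2 + y\<^sup>2) * ((q - 1)\<^sup>2 + y\<^sup>2))" for y
  proof -
    have pos: "q\<^sup>2 + y\<^sup>2 > 0" "(q - 1)\<^sup>2 + y\<^sup>2 > 0" using q by (auto intro: add_pos_nonneg)
    have re: "Re (1 / Complex a y) = a / (a\<^sup>2 + y\<^sup>2)" for a by (simp add: Re_divide)
    have g2q: "g2 (Complex q y) = of_real (real M + 1) * (1 / Complex q y) - 1 / Complex (q - 1) y"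
    proof -
      have "Complex q y - 1 = Complex (q - 1) y" by (simp add: complex_eq_iff)
      then show ?thesis by (simp add: g2_def)
    qed
    have "Re (g2 (Complex q y)) = (real M + 1) * (q / (q\<^sup>2 + y\<^sup>2)) - (q - 1) / ((q - 1)\<^sup>2 + y\<^sup>2)"
    proof -
      have "Re (of_real r * A - B) = r * Re A - Re B" for r A B by simp
      then show ?thesis
        unfolding g2q by (simp only: re)
    qed
    also have "\<dots> = ((real M + 1) * q * ((q - 1)\<^sup>2 + y\<^sup>2) - (q - 1) * (q\<^sup>2 + y\<^sup>2)) / ((q\<^sup>2 + y\<^sup>2) * ((q - 1)\<^sup>2 + y\<^sup>2))"
      using pos[THEN less_imp_neq] by (simp add: diff_frac_eq mult_ac)
    also have "(real M + 1) * q * ((q - 1)\<^sup>2 + y\<^sup>2) - (q - 1) * (q\<^sup>2 + y\<^sup>2) = q * (q - 1) * (real M * d) + y\<^sup>2 * (real M * q + 1)"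
    proof -
      have Md: "real M * d = real M * q - (real M + 1)"
        using e_bounds(3) by (simp add: q_def w0_def algebra_simps)
      show ?thesis unfolding Md by (simp add: power2_eq_square algebra_simps)
    qed
    finally show ?thesis .
  qed
  have g2_nonneg: "Re (g2 (Complex q y)) \<ge> 0" for y
    unfolding Re_g2 using q d by (intro divide_nonneg_nonneg add_nonneg_nonneg mult_nonneg_nonneg) auto
  \<comment> \<open>Because \<open>q \<le> 3\<close> and \<open>y \<le> 1\<close> the denominator is
    at most 10 * 5, and \<open>(q - 1) * M \<ge> e * M = 1\<close> bounds the numerator below by
    \<open>d\<close>.\<close>
  have g2_ge: "Re (g2 (Complex q y)) \<ge> d / 50" if y: "0 \<le> y" "y \<le> 1" for y
  proof -
    have y2: "y\<^sup>2 \<le> 1" using y by (simp add: power_le_one)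
    have q2: "q\<^sup>2 \<le> 9" "(q - 1)\<^sup>2 \<le> 4"
      using power_mono[of q 3 2] power_mono[of "q - 1" 2 2] q by auto
    have den: "(q\<^sup>2 + y\<^sup>2) * ((q - 1)\<^sup>2 + y\<^sup>2) \<le> 10 * 5"
      using y2 q2 by (intro mult_mono) auto
    have "1 * (e * real M) \<le> q * ((q - 1) * real M)"
      using q d e_bounds by (intro mult_mono) (auto simp: q_def w0_def)
    then have "1 \<le> q * (q - 1) * real M" using e_bounds(3) by (simp add: mult_ac)
    then have "1 * d \<le> q * (q - 1) * real M * d" by (intro mult_right_mono) (use d in auto)
    then have num: "d \<le> q * (q - 1) * (real M * d) + y\<^sup>2 * (real M * q + 1)"
      using q by (simp add: mult.assoc add_increasing2)
    have "d / 50 \<le> (q * (q - 1) * (real M * d) + y\<^sup>2 * (real M * q + 1)) / 50"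
      using num by simp
    also have "\<dots> \<le> Re (g2 (Complex q y))"
      unfolding Re_g2 using den q d num by (intro divide_left_mono) (auto intro!: mult_pos_pos add_pos_nonneg)
    finally show ?thesis .
  qed
  have g1_0: "Im (g1 (Complex q 0)) = 0"
  proof -
    have "Complex q 0 = of_real q" "Complex q 0 - 1 = of_real (q - 1)" by (simp_all add: complex_eq_iff)
    then show ?thesis using q Ln_of_real[of q] Ln_of_real[of "q - 1"] by (simp add: g1_def)
  qed
  have g1_small: "d / 50 * y \<le> Im (g1 (Complex q y))" if "0 \<le> y" "y \<le> 1" for y
  proof -
    have "d / 50 * y - d / 50 * 0 \<le> Im (g1 (Complex q y)) - Im (g1 (Complex q 0))"
      by (rule diff_le_of_deriv_le[OF _ _ dg1]) (use that g2_ge in \<open>auto intro!: derivative_eq_intros\<close>)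
    then show ?thesis using g1_0 by simp
  qed
  have g1_large: "d / 50 \<le> Im (g1 (Complex q y))" if "1 \<le> y" for y
  proof -
    have "0 - 0 \<le> Im (g1 (Complex q y)) - Im (g1 (Complex q 1))"
      by (rule diff_le_of_deriv_le[where f = "\<lambda>_. 0" and f' = "\<lambda>_. 0", OF _ _ dg1]) (use that g2_nonneg in auto)
    then show ?thesis using g1_small[of 1] by simp
  qed
  have small: "Re (g (Complex q y)) - Re (g (Complex q 0)) \<le> - (d / 100) * y\<^sup>2" if "0 \<le> y" "y \<le> 1" for y
  proof -
    have "Re (g (Complex q y)) - Re (g (Complex q 0)) \<le> - (d / 100) * y\<^sup>2 - - (d / 100) * 0\<^sup>2"
      by (rule diff_le_of_deriv_le[OF _ dg, where h' = "\<lambda>y. - (d / 50) * y"]) (use that g1_small in \<open>auto intro!: derivative_eq_intros\<close>)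
    then show ?thesis by simp
  qed
  have large: "Re (g (Complex q y)) - Re (g (Complex q 1)) \<le> - (d / 50) * (y - 1)" if "1 \<le> y" for y
  proof -
    have "Re (g (Complex q y)) - Re (g (Complex q 1)) \<le> - (d / 50) * (y - 1) - - (d / 50) * (1 - 1)"
      by (rule diff_le_of_deriv_le[OF _ dg, where h' = "\<lambda>y. - (d / 50)"]) (use that g1_large in \<open>auto intro!: derivative_eq_intros\<close>)
    then show ?thesis by simp
  qed
  have c0: "complex_of_real q = Complex q 0" by (simp add: complex_eq_iff)
  show ?thesis
  proof (cases "y \<le> 1")
    case True
    then show ?thesis using small[OF y True] unfolding q_def[symmetric] c0 by simp
  next
    case False
    then have "d * 1 \<le> d * y" using d by (intro mult_left_mono) auto
    then show ?thesis using small[of 1] large[of y] False unfolding q_def[symmetric] c0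
      by (simp add: right_diff_distrib diff_divide_distrib)
  qed
qed

text \<open>Descent for the \<open>t\<close>-integral is possible at angles between \<open>pi / 2\<close> and \<open>5 * pi / 6\<close> only;
  at \<open>3 * pi / 4\<close> the second derivative of the phase is explicitly nonnegative up to height \<open>e\<close>.\<close>

lemma Re_g_ray:
  assumes a: "0 \<le> a" "a \<le> e"
  shows "Re (g (Complex (w0 - a) a)) - Re (g (of_real w0)) \<ge> a ^ 3 / 3456"
proof -
  define W where "W a = Complex (w0 - a) a" for a
  define \<phi> where "\<phi> a = Re (g (W a))" for a
  define \<phi>1 where "\<phi>1 a = Re (Complex (-1) 1 * g1 (W a))" for a
  define \<phi>2 where "\<phi>2 a = Re (Complex (-1) 1 * (Complex (-1) 1 * g2 (W a)))" for a
  have nn: "W a - 1 \<notin> \<real>\<^sub>\<le>\<^sub>0" if "0 \<le> a" "a \<le> e" for a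
    using that e_bounds by (auto simp: complex_nonpos_Reals_iff W_def w0_def)
  have cd: "(W has_vector_derivative Complex (-1) 1) (at a)" for a
  proof -
    have "W = (\<lambda>a. of_real w0 + of_real a * Complex (-1) 1)" by (auto simp: W_def complex_eq_iff)
    then show ?thesis by (auto intro!: derivative_eq_intros)
  qed
  have d\<phi>: "(\<phi> has_real_derivative \<phi>1 a) (at a)" if "0 \<le> a" "a \<le> e" for a
  proof -
    have "((g \<circ> W) has_vector_derivative Complex (-1) 1 * g1 (W a)) (at a)"
      by (intro field_vector_diff_chain_at cd has_field_derivative_g nn that)
    from has_field_derivative_Re[OF this] show ?thesis by (simp add: o_def \<phi>_def[abs_def] \<phi>1_def)
  qed
  have d\<phi>1: "(\<phi>1 has_real_derivative \<phi>2 a) (at a)" if "0 \<le> a" "a \<le> e" for a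
  proof -
    have "((g1 \<circ> W) has_vector_derivative Complex (-1) 1 * g2 (W a)) (at a)"
      by (intro field_vector_diff_chain_at cd has_field_derivative_g1 nn that)
    then have "((\<lambda>a. Complex (-1) 1 * g1 (W a)) has_vector_derivative Complex (-1) 1 * (Complex (-1) 1 * g2 (W a))) (at a)"
      by (simp add: o_def has_vector_derivative_mult_right)
    from has_field_derivative_Re[OF this] show ?thesis by (simp add: \<phi>1_def[abs_def] \<phi>2_def)
  qed
  \<comment> \<open>The cube of the direction -1 + i is 2 + 2 i, so the sign of
    \<open>\<phi>2 a\<close> is that of the sum of the real and imaginary parts of
    \<open>W a * (W a - 1)\<close>, which is \<open>e + e\<^sup>2 - 2 * a\<^sup>2\<close>.\<close>
  have \<phi>2: "\<phi>2 a = 2 * real M * a * (e + e\<^sup>2 - 2 * a\<^sup>2) / (norm (W a * (W a - 1)))\<^sup>2" if "0 \<le> a" "a \<le> e" for a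
  proof -
    let ?X = "W a * (W a - 1)"
    have nz: "W a \<noteq> 0" "W a \<noteq> 1" using nn[OF that] minus1_nonpos[OF nn[OF that]] by auto
    have "W a - of_real w0 = of_real a * Complex (-1) 1" by (simp add: W_def complex_eq_iff)
    then have "Complex (-1) 1 * (Complex (-1) 1 * g2 (W a)) = of_real (real M * a) * (Complex (-1) 1 * Complex (-1) 1 * Complex (-1) 1) / ?X"
      using g2_eq[OF nz] by simp
    also have "Complex (-1) 1 * Complex (-1) 1 * Complex (-1) 1 = Complex 2 2" by (simp add: complex_eq_iff)
    finally have "\<phi>2 a = Re (of_real (real M * a) * Complex 2 2 / ?X)" by (simp add: \<phi>2_def)
    also have "\<dots> = real M * a * (2 * Re ?X + 2 * Im ?X) / (norm ?X)\<^sup>2"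
      by (simp add: Re_divide cmod_power2 algebra_simps)
    also have "2 * Re ?X + 2 * Im ?X = 2 * (e + e\<^sup>2 - 2 * a\<^sup>2)"
      by (simp add: W_def w0_def algebra_simps power2_eq_square)
    finally show ?thesis by simp
  qed
  have \<phi>2_nonneg: "\<phi>2 a \<ge> 0" if "0 \<le> a" "a \<le> e" for a
  proof -
    have "a\<^sup>2 \<le> e\<^sup>2" "e\<^sup>2 \<le> e" using that e_bounds power_mono[of a e 2] by (auto simp: power2_eq_square mult_left_le)
    then have "0 \<le> e + e\<^sup>2 - 2 * a\<^sup>2" by linarith
    then show ?thesis unfolding \<phi>2[OF that] using that by (intro divide_nonneg_nonneg mult_nonneg_nonneg) auto
  qed
  have \<phi>2_ge: "\<phi>2 a \<ge> a / 72" if "0 \<le> a" "a \<le> e / 2" for a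
  proof -
    have a': "0 \<le> a" "a \<le> e" using that e_bounds by auto
    have "norm (W a) \<le> 4" "norm (W a - 1) \<le> 3"
      using cmod_le[of "W a"] cmod_le[of "W a - 1"] that e_bounds by (auto simp: W_def w0_def)
    then have "norm (W a * (W a - 1)) \<le> 12" unfolding norm_mult using mult_mono[of "norm (W a)" 4 "norm (W a - 1)" 3] by simp
    then have X: "(norm (W a * (W a - 1)))\<^sup>2 \<le> 144" using power_mono[of "norm (W a * (W a - 1))" 12 2] by simp
    have X0: "(norm (W a * (W a - 1)))\<^sup>2 > 0"
      using nn[OF a'] minus1_nonpos[OF nn[OF a']] by auto
    have "a\<^sup>2 \<le> (e / 2)\<^sup>2" using that by (intro power_mono) auto
    then have "4 * a\<^sup>2 \<le> e\<^sup>2" by (simp add: power_divide)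
    then have "e \<le> e + e\<^sup>2 - 2 * a\<^sup>2" using zero_le_power2[of a] by linarith
    then have "2 * real M * a * e \<le> 2 * real M * a * (e + e\<^sup>2 - 2 * a\<^sup>2)"
      using that by (intro mult_left_mono) auto
    moreover have "2 * real M * a * e = 2 * a" using e_bounds(3) by (simp add: mult_ac)
    ultimately have num: "2 * a \<le> 2 * real M * a * (e + e\<^sup>2 - 2 * a\<^sup>2)" by simp
    have "a / 72 \<le> 2 * real M * a * (e + e\<^sup>2 - 2 * a\<^sup>2) / 144" using num by linarith
    also have "\<dots> \<le> \<phi>2 a"
      unfolding \<phi>2[OF a'] using X X0 order_trans[OF _ num, of 0] that by (intro divide_left_mono) auto
    finally show ?thesis .
  qed
  have W0: "W 0 = of_real w0" by (simp add: W_def complex_eq_iff)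
  have \<phi>1_0: "\<phi>1 0 = 0" by (simp add: \<phi>1_def W0 g1_w0)
  have \<phi>1_nonneg: "\<phi>1 a \<ge> 0" if "0 \<le> a" "a \<le> e" for a
    using diff_le_of_deriv_le[of 0 a "\<lambda>_. 0" "\<lambda>_. 0" \<phi>1 \<phi>2] d\<phi>1 \<phi>2_nonneg that \<phi>1_0 by auto
  have \<phi>1_ge: "\<phi>1 a \<ge> a\<^sup>2 / 144" if "0 \<le> a" "a \<le> e / 2" for a
  proof -
    have "a\<^sup>2 / 144 - 0\<^sup>2 / 144 \<le> \<phi>1 a - \<phi>1 0"
      by (rule diff_le_of_deriv_le[where f' = "\<lambda>a. a / 72" and h' = \<phi>2])
         (use that \<phi>2_ge d\<phi>1 e_bounds in \<open>auto intro!: derivative_eq_intros\<close>)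
    then show ?thesis using \<phi>1_0 by simp
  qed
  have \<phi>_small: "\<phi> a - \<phi> 0 \<ge> a ^ 3 / 432" if "0 \<le> a" "a \<le> e / 2" for a
  proof -
    have "a ^ 3 / 432 - 0 ^ 3 / 432 \<le> \<phi> a - \<phi> 0"
      by (rule diff_le_of_deriv_le[where f' = "\<lambda>a. a\<^sup>2 / 144" and h' = \<phi>1])
         (use that \<phi>1_ge d\<phi> e_bounds in \<open>auto intro!: derivative_eq_intros\<close>)
    then show ?thesis by simp
  qed
  have \<phi>_large: "\<phi> a \<ge> \<phi> (e / 2)" if "e / 2 \<le> a" "a \<le> e" for a
    using diff_le_of_deriv_le[of "e / 2" a "\<lambda>_. 0" "\<lambda>_. 0" \<phi> \<phi>1] d\<phi> \<phi>1_nonneg that e_bounds by auto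
  \<comment> \<open>Up to \<open>e / 2\<close> the bound \<open>a / 72\<close> has been integrated
    twice to \<open>a ^ 3 / 432\<close>. Beyond that only monotonicity is used, and
    \<open>a \<le> e\<close> costs the factor 8 in 3456 = 8 * 432.\<close>
  have "\<phi> a - \<phi> 0 \<ge> a ^ 3 / 3456"
  proof (cases "a \<le> e / 2")
    case True
    have "a ^ 3 / 3456 \<le> a ^ 3 / 432" using a by (intro divide_left_mono) auto
    then show ?thesis using \<phi>_small[OF a(1) True] by linarith
  next
    case False
    have "(a / 2) ^ 3 \<le> (e / 2) ^ 3" using a by (intro power_mono) auto
    then have "a ^ 3 / 3456 \<le> (e / 2) ^ 3 / 432" by (simp add: power_divide)
    then show ?thesis using \<phi>_small[of "e / 2"] \<phi>_large[of a] False a e_bounds by linarith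
  qed
  then show ?thesis by (simp add: \<phi>_def W0 W_def[of a])
qed

text \<open>On this segment |w| is at most \<open>w0\<close> and |w - 1| at least \<open>e\<close>.
  At \<open>w0\<close> both are equalities and \<open>g1\<close> vanishes, so the derivative
  \<open>Re g1\<close> is nonpositive along the segment.\<close>

lemma Re_g_horizontal:
  assumes u: "-1 \<le> u" "u \<le> 1"
  shows "Re (g (Complex u e)) \<ge> Re (g (Complex 1 e))"
proof -
  have nn: "Complex u e - 1 \<notin> \<real>\<^sub>\<le>\<^sub>0" for u
    using e_bounds by (auto simp: complex_nonpos_Reals_iff)
  have d: "((\<lambda>u. Re (g (Complex u e))) has_real_derivative Re (g1 (Complex u e))) (at u)" for u
  proof -
    have "((\<lambda>u. Complex u e) has_vector_derivative 1) (at u)"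
      unfolding Complex_eq by (auto intro!: derivative_eq_intros)
    then have "((g \<circ> (\<lambda>u. Complex u e)) has_vector_derivative 1 * g1 (Complex u e)) (at u)"
      by (intro field_vector_diff_chain_at has_field_derivative_g nn)
    from has_field_derivative_Re[OF this] show ?thesis by (simp add: o_def)
  qed
  have "Re (g1 (Complex u e)) \<le> 0" if u: "-1 \<le> u" "u \<le> 1" for u
  proof -
    have nz: "Complex u e \<noteq> 0" "Complex u e - 1 \<noteq> 0" using e_bounds by (auto simp: complex_eq_iff)
    have "norm (Complex u e) \<le> w0"
      using cmod_le[of "Complex u e"] u e_bounds by (simp add: w0_def)
    then have "ln (norm (Complex u e)) \<le> ln w0"
      using nz e_bounds by (subst ln_le_cancel_iff) auto
    then have 1: "(real M + 1) * ln (norm (Complex u e)) \<le> (real M + 1) * ln w0"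
      by (intro mult_left_mono) auto
    have "e \<le> norm (Complex u e - 1)" using abs_Im_le_cmod[of "Complex u e - 1"] by simp
    then have 2: "ln e \<le> ln (norm (Complex u e - 1))"
      using nz e_bounds by (subst ln_le_cancel_iff) auto
    have "Re (g1 (Complex u e)) = (real M + 1) * ln (norm (Complex u e)) - ln (norm (Complex u e - 1)) - ln (x_star M)"
      using nz by (simp add: g1_def)
    then show ?thesis using 1 2 unfolding ln_x_star by linarith
  qed
  then have "Re (g (Complex 1 e)) - Re (g (Complex u e)) \<le> 0 - 0"
    using u by (intro diff_le_of_deriv_le[of u 1 "\<lambda>u. Re (g (Complex u e))" "\<lambda>u. Re (g1 (Complex u e))" "\<lambda>_. 0" "\<lambda>_. 0"] d) auto
  then show ?thesis by simp
qed

section \<open>Comparison of log F with the phase\<close>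

definition logF :: "nat \<Rightarrow> complex \<Rightarrow> complex" where
  "logF n t = (\<Sum>j=0..M. ln_Gamma (t + of_nat (\<nu> j) + 1)) - ln_Gamma (t - of_nat n + 1)"

definition H :: "nat \<Rightarrow> complex \<Rightarrow> complex" where
  "H n t = logF n t - t * of_real (real M * ln (real n) + ln (x_star M))"

definition F :: "nat \<Rightarrow> complex \<Rightarrow> complex" where
  "F n t = (\<Prod>j=0..M. Gamma (t + of_nat (\<nu> j) + 1)) / Gamma (t - of_nat n + 1)"

text \<open>The conditions on \<open>w\<close> and on \<open>w - 1\<close> correspond to the two
  kinds of Gamma factors in \<open>F\<close>, whose arguments are near \<open>n * w\<close> and
  \<open>n * (w - 1)\<close>.\<close>

definition regular :: "real \<Rightarrow> real \<Rightarrow> complex set" where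
  "regular \<delta> c = {w. in_sector \<delta> w \<and> in_sector \<delta> (w - 1) \<and> c \<le> norm w \<and> c \<le> norm (w - 1)}"

lemma regular_not_nonpos_Reals:
  assumes "w \<in> regular \<delta> c" "\<delta> > 0" "c > 0" "n > 0"
  shows "of_nat n * w + of_nat k \<notin> \<real>\<^sub>\<le>\<^sub>0" "of_nat n * w - of_nat n + of_nat k \<notin> \<real>\<^sub>\<le>\<^sub>0" "w - 1 \<notin> \<real>\<^sub>\<le>\<^sub>0"
proof -
  have w: "in_sector \<delta> w" "in_sector \<delta> (w - 1)" "w \<noteq> 0" "w - 1 \<noteq> 0"
    using assms by (auto simp: regular_def)
  have "in_sector \<delta> (of_real (real n) * w)" "in_sector \<delta> (of_real (real n) * (w - 1))"
    by (intro in_sector_scale w; use assms in simp)+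
  from this[THEN in_sector_not_nonpos_Reals[OF _ assms(2), of _ "real k"]]
  show "of_nat n * w + of_nat k \<notin> \<real>\<^sub>\<le>\<^sub>0" "of_nat n * w - of_nat n + of_nat k \<notin> \<real>\<^sub>\<le>\<^sub>0"
    using w assms by (auto simp: right_diff_distrib)
  show "w - 1 \<notin> \<real>\<^sub>\<le>\<^sub>0"
    using in_sector_not_nonpos_Reals[OF w(2) assms(2) w(4), of 0] by simp
qed

lemma exp_logF:
  assumes "\<And>j. j \<le> M \<Longrightarrow> t + of_nat (\<nu> j) + 1 \<notin> \<real>\<^sub>\<le>\<^sub>0" "t - of_nat n + 1 \<notin> \<real>\<^sub>\<le>\<^sub>0"
  shows "exp (logF n t) = F n t"
proof -
  have *: "exp (ln_Gamma z) = Gamma z" if "z \<notin> \<real>\<^sub>\<le>\<^sub>0" for z :: complex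
    using that nonpos_Ints_subset_nonpos_Reals by (auto simp: Gamma_complex_altdef)
  show ?thesis
    using assms by (auto simp: logF_def F_def exp_diff exp_sum * intro!: prod.cong)
qed

lemma regular_exp_logF:
  assumes "w \<in> regular \<delta> c" "\<delta> > 0" "c > 0" "n > 0"
  shows "exp (logF n (of_nat n * w)) = F n (of_nat n * w)"
proof (rule exp_logF)
  show "of_nat n * w + of_nat (\<nu> j) + 1 \<notin> \<real>\<^sub>\<le>\<^sub>0" for j
    using regular_not_nonpos_Reals(1)[OF assms, of "Suc (\<nu> j)"] by (simp add: add_ac)
  show "of_nat n * w - of_nat n + 1 \<notin> \<real>\<^sub>\<le>\<^sub>0"
    using regular_not_nonpos_Reals(2)[OF assms, of 1] by simp
qed

text \<open>Only the logarithmic derivative of \<open>F\<close> is approximated; the constant of Stirling's formula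
  drops out of the quotient \<open>F n s / F n t\<close>.\<close>

lemma H_approx:
  assumes "\<delta> > 0" "c > 0"
  obtains C n0 where "C \<ge> 0" "n0 > 0" "\<And>n a b. n \<ge> n0 \<Longrightarrow> closed_segment a b \<subseteq> regular \<delta> c \<Longrightarrow>
    norm (H n (of_nat n * b) - H n (of_nat n * a) - of_nat n * (g b - g a)) \<le> C * norm (b - a)"
proof -
  define K where "K m = 4 / \<delta>\<^sup>2 + real m / \<delta>" for m
  have K0: "K m \<ge> 0" for m using assms by (simp add: K_def)
  define C where "C = (\<Sum>j=0..M. K (\<nu> j + 1)) / c + K 1 / c"
  \<comment> \<open>From this index on \<open>n * c \<ge> 1\<close> and
    \<open>\<delta> * (n * c) \<ge> 2\<close>, which are the size conditions of the digamma estimate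
    at points scaled by \<open>n\<close>.\<close>
  define n0 where "n0 = nat \<lceil>1 / c + 2 / (\<delta> * c)\<rceil>"
  have "1 / c + 2 / (\<delta> * c) > 0" using assms by (intro add_pos_pos) auto
  then have n0: "n0 > 0" by (simp add: n0_def)
  have main: "norm (H n (of_nat n * b) - H n (of_nat n * a) - of_nat n * (g b - g a)) \<le> C * norm (b - a)"
    if n: "n \<ge> n0" and seg: "closed_segment a b \<subseteq> regular \<delta> c" for n a b
  proof -
    define G where "G w = H n (of_nat n * w) - of_nat n * g w" for w
    define l where "l = real M * ln (real n) + ln (x_star M)"
    have npos: "n > 0" using n n0 by simp
    have nc: "real n \<ge> 1 / c + 2 / (\<delta> * c)" using n by (simp add: n0_def)
    have nc1: "real n * c \<ge> 1" "\<delta> * (real n * c) \<ge> 2"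
    proof -
      have p: "1 / c \<ge> 0" "2 / (\<delta> * c) \<ge> 0" using assms by auto
      have "1 / c \<le> real n" "2 / (\<delta> * c) \<le> real n" using nc p by linarith+
      then have "1 / c * c \<le> real n * c" using assms by (intro mult_right_mono) auto
      then show "real n * c \<ge> 1" using assms by simp
      have "2 / (\<delta> * c) * (\<delta> * c) \<le> real n * (\<delta> * c)" using \<open>2 / (\<delta> * c) \<le> real n\<close> assms by (intro mult_right_mono) auto
      then show "\<delta> * (real n * c) \<ge> 2" using assms by (simp add: mult_ac)
    qed
    define D where "D w = of_nat n * ((\<Sum>j=0..M. Digamma (of_nat n * w + of_nat (\<nu> j) + 1)) - Digamma (of_nat n * w - of_nat n + 1) - of_real l) - of_nat n * g1 w" for w
    have "norm (G b - G a) \<le> C * norm (b - a)"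
    proof (rule field_differentiable_bound[where S = "closed_segment a b" and f' = D])
      fix w assume "w \<in> closed_segment a b"
      then have w: "w \<in> regular \<delta> c" using seg by blast
      note nn = regular_not_nonpos_Reals[OF w assms npos]
      have nn1: "of_nat n * w + of_nat k + 1 \<notin> \<real>\<^sub>\<le>\<^sub>0" for k using nn(1)[of "Suc k"] by (simp add: add_ac)
      have nn2: "of_nat n * w - of_nat n + 1 \<notin> \<real>\<^sub>\<le>\<^sub>0" using nn(2)[of 1] by simp
      have d1: "((\<lambda>w. ln_Gamma (of_nat n * w + of_nat k + 1)) has_field_derivative of_nat n * Digamma (of_nat n * w + of_nat k + 1)) (at w within closed_segment a b)" for k
        using nn1[of k] by (auto intro!: derivative_eq_intros)
      have d2: "((\<lambda>w. ln_Gamma (of_nat n * w - of_nat n + 1)) has_field_derivative of_nat n * Digamma (of_nat n * w - of_nat n + 1)) (at w within closed_segment a b)"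
        using nn2 by (auto intro!: derivative_eq_intros)
      have "(G has_field_derivative ((\<Sum>j=0..M. of_nat n * Digamma (of_nat n * w + of_nat (\<nu> j) + 1)) - of_nat n * Digamma (of_nat n * w - of_nat n + 1) - of_nat n * of_real l) - of_nat n * g1 w) (at w within closed_segment a b)"
        unfolding G_def H_def logF_def l_def[symmetric]
        by (intro DERIV_diff DERIV_cmult has_field_derivative_g nn(3) DERIV_sum d1 d2) (auto intro!: derivative_eq_intros)
      then show "(G has_field_derivative D w) (at w within closed_segment a b)"
        by (simp add: D_def sum_distrib_left algebra_simps)
      have reg_angle: "in_sector \<delta> (of_nat n * w)" "in_sector \<delta> (of_nat n * (w - 1))"
        using in_sector_scale[of "real n" \<delta> w] in_sector_scale[of "real n" \<delta> "w - 1"] w npos by (auto simp: regular_def)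
      have nrm: "norm (of_nat n * w) \<ge> real n * c" "norm (of_nat n * (w - 1)) \<ge> real n * c"
        using w npos by (auto simp: regular_def norm_mult)
      have dig: "norm (Digamma (z + of_nat m) - Ln z) \<le> K m / (real n * c)"
        if z: "in_sector \<delta> z" "norm z \<ge> real n * c" for z m
      proof -
        have "\<delta> * (real n * c) \<le> \<delta> * norm z" using z assms by (intro mult_left_mono) auto
        then have "2 \<le> \<delta> * norm z" using nc1 by linarith
        then have "norm (Digamma (z + of_nat m) - Ln z) \<le> K m / norm z"
          unfolding K_def using z assms nc1 by (intro norm_Digamma_shift_minus_Ln_le) auto
        also have "\<dots> \<le> K m / (real n * c)"
          using z K0 nc1 assms npos by (intro divide_left_mono mult_pos_pos) auto
        finally show ?thesis .
      qed
      have wz: "w \<noteq> 0" "w - 1 \<noteq> 0" using w assms by (auto simp: regular_def)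
      have Ln1: "Ln (of_nat n * w) = of_real (ln (real n)) + Ln w" "Ln (of_nat n * (w - 1)) = of_real (ln (real n)) + Ln (w - 1)"
        using wz npos Ln_times_of_nat[of n w] Ln_times_of_nat[of n "w - 1"] by (simp_all add: Ln_of_nat)
      \<comment> \<open>The logarithms of \<open>n\<close> cancel: \<open>M + 1\<close> from the
        numerator, minus one from the denominator, minus the \<open>M\<close> contained in
        \<open>l\<close>. Only differences of digamma and logarithm remain, each of order
        1/n.\<close>
      have Deq: "D w = of_nat n * ((\<Sum>j=0..M. Digamma (of_nat n * w + of_nat (\<nu> j + 1)) - Ln (of_nat n * w)) - (Digamma (of_nat n * (w - 1) + of_nat 1) - Ln (of_nat n * (w - 1))))"
        unfolding D_def g1_def Ln1 l_def
        by (simp add: sum_subtractf algebra_simps)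
      have "norm (D w) \<le> real n * ((\<Sum>j=0..M. K (\<nu> j + 1) / (real n * c)) + K 1 / (real n * c))"
        unfolding Deq norm_mult norm_of_nat
        by (intro mult_left_mono order_trans[OF norm_triangle_ineq4] add_mono order_trans[OF norm_sum sum_mono] dig reg_angle nrm) auto
      also have "\<dots> = C"
        using npos by (simp add: C_def sum_divide_distrib[symmetric] field_simps)
      finally show "norm (D w) \<le> C" .
    qed auto
    then show ?thesis by (simp add: G_def algebra_simps)
  qed
  show ?thesis
    by (rule that[of C n0]) (use main n0 K0 assms in \<open>auto simp: C_def intro!: add_nonneg_nonneg divide_nonneg_pos sum_nonneg\<close>)
qed

end

section \<open>Contours for the kernel\<close>

text \<open>With simple fractions, Cauchy's integral formula can be applied pole by pole.\<close>

lemma partial_fractions_of_nat: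
  "\<exists>c. \<forall>t::complex. (\<forall>k<n. t \<noteq> of_nat k) \<longrightarrow> 1 / (\<Prod>k<n. t - of_nat k) = (\<Sum>k<n. c k / (t - of_nat k))"
  if "n > 0"
  using that
proof (induction n rule: nat_induct_non_zero)
  case 1
  show ?case by (intro exI[of _ "\<lambda>_. 1"]) simp
next
  case (Suc n)
  then obtain c where c: "\<And>t::complex. (\<forall>k<n. t \<noteq> of_nat k) \<Longrightarrow> 1 / (\<Prod>k<n. t - of_nat k) = (\<Sum>k<n. c k / (t - of_nat k))"
    by blast
  \<comment> \<open>Multiplying an old term by \<open>1 / (t - n)\<close> splits it into two simple
    fractions with opposite coefficients, and the new pole at \<open>n\<close> collects the second
    halves of all of them.\<close>
  define c' where "c' k = (if k < n then c k / (of_nat k - of_nat n) else - (\<Sum>k<n. c k / (of_nat k - of_nat n)))" for k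
  have "1 / (\<Prod>k<Suc n. t - of_nat k) = (\<Sum>k<Suc n. c' k / (t - of_nat k))" if t: "\<forall>k<Suc n. t \<noteq> of_nat k" for t :: complex
  proof -
    have tn: "t - of_nat n \<noteq> 0" using t by auto
    have "1 / (\<Prod>k<Suc n. t - of_nat k) = (1 / (\<Prod>k<n. t - of_nat k)) / (t - of_nat n)" by simp
    also have "1 / (\<Prod>k<n. t - of_nat k) = (\<Sum>k<n. c k / (t - of_nat k))"
      using t by (intro c) auto
    also have "\<dots> / (t - of_nat n) = (\<Sum>k<n. c k / (t - of_nat k) / (t - of_nat n))"
      by (rule sum_divide_distrib)
    also have "\<dots> = (\<Sum>k<n. c' k / (t - of_nat k) - c k / (of_nat k - of_nat n) / (t - of_nat n))"
    proof (rule sum.cong)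
      fix k assume "k \<in> {..<n}"
      then have "t - of_nat k \<noteq> 0" "of_nat k - of_nat n \<noteq> (0::complex)" "k < n" using t by auto
      then show "c k / (t - of_nat k) / (t - of_nat n) = c' k / (t - of_nat k) - c k / (of_nat k - of_nat n) / (t - of_nat n)"
        using tn unfolding c'_def by (simp add: divide_simps) (simp add: algebra_simps)
    qed simp
    also have "\<dots> = (\<Sum>k<n. c' k / (t - of_nat k)) + c' n / (t - of_nat n)"
      by (simp only: sum_subtractf sum_divide_distrib[symmetric]) (simp add: c'_def)
    finally show ?thesis by simp
  qed
  then show ?case by blast
qed

lemma integrable_lborel_inverse_square_bound:
  fixes f :: "real \<Rightarrow> complex"
  assumes cont: "continuous_on UNIV f" and bnd: "\<And>v. \<bar>v\<bar> \<ge> 1 \<Longrightarrow> norm (f v) \<le> C / v\<^sup>2"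
  shows "integrable lborel f"
proof -
  have "bounded (f ` {-1..1})"
    by (intro compact_imp_bounded compact_continuous_image continuous_on_subset[OF cont]) auto
  then obtain B where "\<forall>z\<in>f ` {-1..1}. norm z \<le> B" unfolding bounded_iff by blast
  then have B: "\<And>v. v \<in> {-1..1} \<Longrightarrow> norm (f v) \<le> B" by blast
  have 1: "integrable lborel (\<lambda>x::real. inverse (1 + x\<^sup>2))"
    using integrable_inverse_1_plus_square by (simp add: set_integrable_def einterval_eq_UNIV)
  show ?thesis
  proof (rule Bochner_Integration.integrable_bound)
    show "integrable lborel (\<lambda>x::real. (2 * \<bar>B\<bar> + 2 * \<bar>C\<bar>) * inverse (1 + x\<^sup>2))"
      using 1 by simp
    show "f \<in> borel_measurable lborel" using borel_measurable_continuous_onI[OF cont] by simp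
    have "norm (f v) \<le> (2 * \<bar>B\<bar> + 2 * \<bar>C\<bar>) * inverse (1 + v\<^sup>2)" for v
    proof (cases "\<bar>v\<bar> \<ge> 1")
      case True
      then have v: "v\<^sup>2 \<ge> 1" using power_mono[of 1 "\<bar>v\<bar>" 2] by simp
      have "norm (f v) \<le> C / v\<^sup>2" by (rule bnd[OF True])
      also have "\<dots> \<le> 2 * \<bar>C\<bar> / (1 + v\<^sup>2)"
      proof -
        have "C * (1 + v\<^sup>2) \<le> \<bar>C\<bar> * (2 * v\<^sup>2)" using v by (intro mult_mono) auto
        then show ?thesis using v by (simp add: divide_simps mult_ac)
      qed
      also have "\<dots> \<le> (2 * \<bar>B\<bar> + 2 * \<bar>C\<bar>) / (1 + v\<^sup>2)" by (intro divide_right_mono) auto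
      finally show ?thesis by (simp add: field_simps)
    next
      case False
      then have v: "v\<^sup>2 \<le> 1" using power_mono[of "\<bar>v\<bar>" 1 2] by simp
      have pos: "1 + v\<^sup>2 > 0" by (intro add_pos_nonneg) auto
      have "v \<in> {-1..1}" using False by auto
      from B[OF this] have "norm (f v) \<le> \<bar>B\<bar>" by linarith
      moreover have "\<bar>B\<bar> * (1 + v\<^sup>2) \<le> \<bar>B\<bar> * 2" using v by (intro mult_left_mono) auto
      moreover have "\<bar>B\<bar> \<le> (2 * \<bar>B\<bar> + 2 * \<bar>C\<bar>) / (1 + v\<^sup>2)" if "\<bar>B\<bar> * (1 + v\<^sup>2) \<le> \<bar>B\<bar> * 2"
        using that pos by (subst pos_le_divide_eq) auto
      ultimately show ?thesis by (simp add: divide_inverse)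
    qed
    then show "AE v in lborel. norm (f v) \<le> norm ((2 * \<bar>B\<bar> + 2 * \<bar>C\<bar>) * inverse (1 + v\<^sup>2))"
      unfolding real_norm_def by (intro AE_I2 order_trans[OF _ abs_ge_self])
  qed
qed

text \<open>A primitive on a convex neighbourhood of the strip takes the place of rectangular
  contours: the quadratic decay makes its increment across the strip vanish at large height.\<close>

lemma vertical_line_integral_shift:
  assumes "a < b" and hol: "f holomorphic_on S" "open S" "convex S"
    and S: "\<And>z. a \<le> Re z \<Longrightarrow> Re z \<le> b \<Longrightarrow> z \<in> S"
    and bnd: "\<And>z. a \<le> Re z \<Longrightarrow> Re z \<le> b \<Longrightarrow> \<bar>Im z\<bar> \<ge> 1 \<Longrightarrow> norm (f z) \<le> C / (Im z)\<^sup>2"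
  shows "vertical_line_integral a f = vertical_line_integral b f"
proof -
  obtain P where P: "\<And>z. z \<in> S \<Longrightarrow> (P has_field_derivative f z) (at z within S)"
    using holomorphic_convex_primitive'[OF hol(3,2,1)] by blast
  have P': "(P has_field_derivative f z) (at z)" if "z \<in> S" for z
    using P[OF that] at_within_open[OF that hol(2)] by simp
  have cont: "continuous_on S f" using hol(1) by (rule holomorphic_on_imp_continuous_on)
  have lim: "((\<lambda>V. P (Complex c V) - P (Complex c (- V))) \<longlongrightarrow> vertical_line_integral c f) at_top"
    if c: "a \<le> c" "c \<le> b" for c
  proof (rule vertical_line_integral_tendsto)
    show cl: "continuous_on {z. Re z = c} f"
      by (rule continuous_on_subset[OF cont]) (use S c in auto)
    show "integrable lborel (\<lambda>v. f (Complex c v))"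
      by (rule integrable_lborel_inverse_square_bound[where C = C])
         (use bnd[of "Complex c _"] c continuous_on_Complex_line[OF cl] in auto)
  qed (use P' S c in auto)
  have diff: "norm (P (Complex b V) - P (Complex a V)) \<le> C / V\<^sup>2 * (b - a)" if V: "\<bar>V\<bar> \<ge> 1" for V
  proof -
    have seg: "Im z = V \<and> a \<le> Re z \<and> Re z \<le> b" if "z \<in> closed_segment (Complex a V) (Complex b V)" for z
      using closed_segment_same_Im[of "Complex a V" "Complex b V"] that assms(1)
      by (auto simp: closed_segment_eq_real_ivl)
    have "norm (P (Complex b V) - P (Complex a V)) \<le> C / V\<^sup>2 * norm (Complex b V - Complex a V)"
    proof (rule field_differentiable_bound[where S = "closed_segment (Complex a V) (Complex b V)" and f' = f])
      fix z assume "z \<in> closed_segment (Complex a V) (Complex b V)"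
      note z = seg[OF this]
      show "(P has_field_derivative f z) (at z within closed_segment (Complex a V) (Complex b V))"
        using P'[OF S] z by (auto intro: has_field_derivative_at_within)
      show "norm (f z) \<le> C / V\<^sup>2" using bnd[of z] z V by auto
    qed auto
    also have "Complex b V - Complex a V = of_real (b - a)" by (simp add: complex_eq_iff)
    finally show ?thesis using assms(1) by (simp del: of_real_diff)
  qed
  have lim0: "((\<lambda>V::real. C / V\<^sup>2 * (b - a)) \<longlongrightarrow> 0) at_top"
    by (intro tendsto_mult_left_zero tendsto_divide_0[OF tendsto_const] filterlim_at_top_imp_at_infinity filterlim_pow_at_top filterlim_ident) auto
  have ev: "\<forall>\<^sub>F V in at_top. (1::real) \<le> V" by (rule eventually_ge_at_top)
  have d1: "((\<lambda>V. P (Complex b V) - P (Complex a V)) \<longlongrightarrow> 0) at_top"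
    by (rule Lim_null_comparison[OF eventually_mono[OF ev] lim0]) (use diff in auto)
  have d2: "((\<lambda>V. P (Complex b (-V)) - P (Complex a (-V))) \<longlongrightarrow> 0) at_top"
    by (rule Lim_null_comparison[OF eventually_mono[OF ev] lim0]) (use diff[of "- _"] in auto)
  have "((\<lambda>V. (P (Complex a V) - P (Complex a (- V))) + ((P (Complex b V) - P (Complex a V)) - (P (Complex b (-V)) - P (Complex a (-V))))) \<longlongrightarrow> vertical_line_integral a f + (0 - 0)) at_top"
    using assms(1) by (intro tendsto_add tendsto_diff lim d1 d2) auto
  then have "((\<lambda>V. P (Complex b V) - P (Complex b (- V))) \<longlongrightarrow> vertical_line_integral a f) at_top"
    by simp
  moreover have "((\<lambda>V. P (Complex b V) - P (Complex b (- V))) \<longlongrightarrow> vertical_line_integral b f) at_top"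
    using assms(1) by (intro lim) auto
  ultimately show ?thesis
    using tendsto_unique trivial_limit_at_top_linorder by blast
qed

lemma Gamma_strip_bound:
  assumes "0 < a" "a \<le> b"
  obtains C where "C \<ge> 0" "\<And>z. a \<le> Re z \<Longrightarrow> Re z \<le> b \<Longrightarrow> \<bar>Im z\<bar> \<ge> 1 \<Longrightarrow> norm (Gamma z) \<le> C / \<bar>Im z\<bar> ^ N"
proof -
  have "compact (Gamma ` {a + real N..b + real N})"
    using assms by (intro compact_continuous_image continuous_intros) (auto elim!: nonpos_Ints_cases)
  then have "bounded (Gamma ` {a + real N..b + real N})" by (rule compact_imp_bounded)
  then obtain C where "\<forall>z\<in>Gamma ` {a + real N..b + real N}. norm z \<le> C"
    unfolding bounded_iff by blast
  then have C: "\<And>u. a + real N \<le> u \<Longrightarrow> u \<le> b + real N \<Longrightarrow> norm (Gamma u) \<le> C" by auto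
  have "C \<ge> 0" using order_trans[OF norm_ge_zero C[of "a + real N"]] assms by simp
  moreover have "norm (Gamma z) \<le> C / \<bar>Im z\<bar> ^ N" if "a \<le> Re z" "Re z \<le> b" "\<bar>Im z\<bar> \<ge> 1" for z
  proof -
    have "norm (Gamma z) \<le> Gamma (Re z + real N) / \<bar>Im z\<bar> ^ N"
      using that assms by (intro norm_Gamma_le_powr_Im) auto
    also have "\<dots> \<le> C / \<bar>Im z\<bar> ^ N"
      using C[of "Re z + real N"] that by (intro divide_right_mono) auto
    finally show ?thesis .
  qed
  ultimately show ?thesis by (rule that)
qed

section \<open>The inner integral as a residue sum\<close>

context ginibre_product
begin

text \<open>The index starts at 1 because the factor for \<open>j = 0\<close>, divided by
  \<open>Gamma (s - n + 1)\<close>, is the polynomial with zeros 0, ..., n - 1.\<close>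

definition gamma_prod :: "complex \<Rightarrow> complex" where "gamma_prod s = (\<Prod>j=1..M. Gamma (s + of_nat (\<nu> j) + 1))"
definition rgamma_prod :: "complex \<Rightarrow> complex" where "rgamma_prod s = (\<Prod>j=1..M. rGamma (s + of_nat (\<nu> j) + 1))"

text \<open>Also valid at the poles, where \<open>Gamma\<close> takes the default value 0 and
  \<open>rGamma\<close> truly vanishes. As the left side is entire, holomorphy of the t-integrand
  away from the points 0, ..., n - 1 and \<open>s\<close> is immediate.\<close>

lemma rgamma_prod_eq: "rgamma_prod t = 1 / gamma_prod t"
  by (simp add: rgamma_prod_def gamma_prod_def rGamma_inverse_Gamma inverse_eq_divide prod_dividef)

lemma F_eq:
  assumes "\<nu> 0 = 0" "s - of_nat n + 1 \<notin> \<int>\<^sub>\<le>\<^sub>0"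
  shows "F n s = (\<Prod>k<n. s - of_nat k) * gamma_prod s"
proof -
  have "(\<Prod>j=0..M. Gamma (s + of_nat (\<nu> j) + 1)) = Gamma (s + 1) * gamma_prod s"
    unfolding gamma_prod_def by (subst prod.atLeast_Suc_atMost) (use assms in auto)
  moreover have "(\<Prod>k<n. s - of_nat k) = Gamma (s + 1) / Gamma (s - of_nat n + 1)"
  proof -
    have "(\<Prod>k<n. s - of_nat k) = (\<Prod>k<n. s - of_nat (n - Suc k))"
      by (rule prod.nat_diff_reindex[symmetric])
    also have "\<dots> = (\<Prod>k<n. s - of_nat n + 1 + of_nat k)"
      by (intro prod.cong) (auto simp: of_nat_diff algebra_simps)
    also have "\<dots> = pochhammer (s - of_nat n + 1) n"
      by (simp add: pochhammer_prod atLeast0LessThan)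
    also have "\<dots> = Gamma (s + 1) / Gamma (s - of_nat n + 1)"
      using pochhammer_Gamma[OF assms(2), of n] by (simp add: algebra_simps)
    finally show ?thesis .
  qed
  ultimately show ?thesis by (simp add: F_def)
qed

lemma not_pole:
  assumes "Re t > -1" "\<And>k. k < n \<Longrightarrow> t \<noteq> of_nat k"
  shows "t - of_nat n + 1 \<notin> \<int>\<^sub>\<le>\<^sub>0"
proof
  assume "t - of_nat n + 1 \<in> \<int>\<^sub>\<le>\<^sub>0"
  then obtain m where "t - of_nat n + 1 = - of_nat m" by (auto elim: nonpos_Ints_cases')
  then have t: "t = of_int (int n - 1 - int m)" by (simp add: algebra_simps)
  then have "real_of_int (int n - 1 - int m) > -1" using assms(1) by simp
  then have "int n - 1 - int m \<ge> 0" by linarith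
  then have "t = of_nat (n - 1 - m)" "n - 1 - m < n" using t by (auto simp: of_nat_diff)
  then show False using assms(2) by blast
qed

lemma kernel_integrand_eq:
  "kernel_integrand M \<nu> n x y s t = F n s * of_real y powr (- s - 1) * (of_real x powr t / F n t / (s - t))"
  by (simp add: kernel_integrand_def F_def prod_dividef mult_ac)

text \<open>For \<open>n = 0\<close> there are no such coefficients.\<close>

definition coef :: "nat \<Rightarrow> nat \<Rightarrow> complex" where
  "coef n = (SOME c. \<forall>t::complex. (\<forall>k<n. t \<noteq> of_nat k) \<longrightarrow> 1 / (\<Prod>k<n. t - of_nat k) = (\<Sum>k<n. c k / (t - of_nat k)))"

lemma coef: "n > 0 \<Longrightarrow> (\<And>k. k < n \<Longrightarrow> t \<noteq> of_nat k) \<Longrightarrow> 1 / (\<Prod>k<n. t - of_nat k) = (\<Sum>k<n. coef n k / (t - of_nat k))"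
  unfolding coef_def using someI_ex[OF partial_fractions_of_nat[of n]] by blast

definition residue_sum :: "nat \<Rightarrow> real \<Rightarrow> complex \<Rightarrow> complex" where
  "residue_sum n x s = (\<Sum>k<n. coef n k * (of_real x powr of_nat k * rgamma_prod (of_nat k)) / (s - of_nat k))"

lemma holomorphic_rgamma_prod: "rgamma_prod holomorphic_on A"
  unfolding rgamma_prod_def by (intro holomorphic_intros)

text \<open>After the partial fraction expansion every term is a function holomorphic on
  \<open>S\<close> divided by \<open>t - k\<close>, so \<open>\<gamma>\<close> enters only through
  its winding numbers. The same value is thus obtained for the contour of the kernel and for a
  rectangle.\<close>

lemma contour_integral_F:
  assumes nu0: "\<nu> 0 = 0" and n: "n > 0" and x: "x > 0"
    and S: "convex S" "open S" "\<And>t. t \<in> S \<Longrightarrow> Re t > -1" "s \<notin> S" "\<And>k. k < n \<Longrightarrow> of_nat k \<in> S"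
    and \<gamma>: "valid_path \<gamma>" "pathfinish \<gamma> = pathstart \<gamma>" "path_image \<gamma> \<subseteq> S"
      "\<And>k. k < n \<Longrightarrow> of_nat k \<notin> path_image \<gamma>" "\<And>k. k < n \<Longrightarrow> winding_number \<gamma> (of_nat k) = 1"
  shows "((\<lambda>t. of_real x powr t / F n t / (s - t)) has_contour_integral 2 * of_real pi * \<i> * residue_sum n x s) \<gamma>"
proof -
  define h where "h t = of_real x powr t * rgamma_prod t / (s - t)" for t
  have h: "h holomorphic_on S"
    unfolding h_def using S(4) x by (intro holomorphic_intros holomorphic_rgamma_prod) auto
  have "((\<lambda>t. \<Sum>k<n. coef n k * (h t / (t - of_nat k))) has_contour_integral
      (\<Sum>k<n. coef n k * (2 * of_real pi * \<i> * winding_number \<gamma> (of_nat k) * h (of_nat k)))) \<gamma>"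
  proof (intro has_contour_integral_sum has_contour_integral_lmul)
    fix k assume "k \<in> {..<n}"
    then have "of_nat k \<in> interior S" "path_image \<gamma> \<subseteq> S - {of_nat k}"
      using S \<gamma> by (auto simp: interior_open)
    from Cauchy_integral_formula_convex_simple[OF S(1) h this(1) \<gamma>(1) this(2) \<gamma>(2)]
    show "((\<lambda>t. h t / (t - of_nat k)) has_contour_integral 2 * of_real pi * \<i> * winding_number \<gamma> (of_nat k) * h (of_nat k)) \<gamma>"
      by simp
  qed simp
  then have "((\<lambda>t. of_real x powr t / F n t / (s - t)) has_contour_integral
      (\<Sum>k<n. coef n k * (2 * of_real pi * \<i> * winding_number \<gamma> (of_nat k) * h (of_nat k)))) \<gamma>"
  proof (rule has_contour_integral_eq)
    fix t assume t: "t \<in> path_image \<gamma>"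
    have tk: "t \<noteq> of_nat k" if "k < n" for k using t \<gamma>(4)[OF that] by auto
    have "t - of_nat n + 1 \<notin> \<int>\<^sub>\<le>\<^sub>0" by (rule not_pole) (use t \<gamma>(3) S(3) tk in auto)
    then have Ft: "F n t = (\<Prod>k<n. t - of_nat k) * gamma_prod t" by (rule F_eq[OF nu0])
    have "(\<Sum>k<n. coef n k * (h t / (t - of_nat k))) = (\<Sum>k<n. coef n k / (t - of_nat k)) * h t"
      by (simp add: sum_distrib_right)
    also have "(\<Sum>k<n. coef n k / (t - of_nat k)) = 1 / (\<Prod>k<n. t - of_nat k)"
      using coef[OF n tk] by simp
    finally show "(\<Sum>k<n. coef n k * (h t / (t - of_nat k))) = of_real x powr t / F n t / (s - t)"
      unfolding Ft h_def rgamma_prod_eq by simp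
  qed
  also have "(\<Sum>k<n. coef n k * (2 * of_real pi * \<i> * winding_number \<gamma> (of_nat k) * h (of_nat k))) = 2 * of_real pi * \<i> * residue_sum n x s"
    unfolding residue_sum_def h_def sum_distrib_left using \<gamma>(5) by (intro sum.cong) (auto simp: mult_ac)
  finally show ?thesis .
qed

text \<open>The zeros of \<open>F n\<close> cancel the poles of the residue sum, so that the \<open>s\<close>-line may be moved
  across the \<open>t\<close>-contour.\<close>

definition residue_poly :: "nat \<Rightarrow> real \<Rightarrow> complex \<Rightarrow> complex" where
  "residue_poly n x s = (\<Sum>k<n. coef n k * (of_real x powr of_nat k * rgamma_prod (of_nat k)) * (\<Prod>j\<in>{..<n}-{k}. s - of_nat j))"

lemma residue_poly_eq:
  assumes "\<And>k. k < n \<Longrightarrow> s \<noteq> of_nat k"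
  shows "residue_poly n x s = (\<Prod>k<n. s - of_nat k) * residue_sum n x s"
  unfolding residue_poly_def residue_sum_def sum_distrib_left
proof (rule sum.cong)
  fix k assume "k \<in> {..<n}"
  then have "(\<Prod>k<n. s - of_nat k) = (s - of_nat k) * (\<Prod>j\<in>{..<n}-{k}. s - of_nat j)"
    by (intro prod.remove) auto
  moreover have "s - of_nat k \<noteq> 0" using assms \<open>k \<in> {..<n}\<close> by auto
  ultimately show "coef n k * (of_real x powr of_nat k * rgamma_prod (of_nat k)) * (\<Prod>j\<in>{..<n}-{k}. s - of_nat j) =
     (\<Prod>k<n. s - of_nat k) * (coef n k * (of_real x powr of_nat k * rgamma_prod (of_nat k)) / (s - of_nat k))"
    by simp
qed simp

definition line_integrand :: "nat \<Rightarrow> real \<Rightarrow> real \<Rightarrow> complex \<Rightarrow> complex" where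
  "line_integrand n x y s = residue_poly n x s * gamma_prod s * of_real y powr (- s - 1)"

lemma holomorphic_line_integrand:
  assumes "y > 0"
  shows "line_integrand n x y holomorphic_on {s. Re s > -1}"
proof -
  have "s + of_nat m + 1 \<notin> \<int>\<^sub>\<le>\<^sub>0" if "Re s > -1" for s and m :: nat
  proof
    assume "s + of_nat m + 1 \<in> \<int>\<^sub>\<le>\<^sub>0"
    then obtain k where "s + of_nat m + 1 = - of_nat k" by (auto elim: nonpos_Ints_cases')
    then have "Re (s + of_nat m + 1) = Re (- of_nat k)" by simp
    then show False using that by simp
  qed
  then show ?thesis
    unfolding line_integrand_def residue_poly_def gamma_prod_def using assms by (intro holomorphic_intros) auto
qed

text \<open>The residue polynomial grows at most like the \<open>n\<close>-th power of the imaginary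
  part. The Gamma factor with index 1, present because \<open>M \<ge> 1\<close>, decays like any
  power; the exponent \<open>n + 2\<close> beats the polynomial and leaves an inverse
  square.\<close>

lemma line_integrand_bound:
  assumes y: "y > 0" and b: "b > -1/2"
  obtains C where "\<And>s. -1/2 \<le> Re s \<Longrightarrow> Re s \<le> b \<Longrightarrow> \<bar>Im s\<bar> \<ge> 1 \<Longrightarrow> norm (line_integrand n x y s) \<le> C / (Im s)\<^sup>2"
proof -
  define N where "N = n + 2"
  obtain C1 where C1: "C1 \<ge> 0" "\<And>s. 1/2 \<le> Re s \<Longrightarrow> Re s \<le> b + 1 + real (\<nu> 1) \<Longrightarrow> \<bar>Im s\<bar> \<ge> 1 \<Longrightarrow> norm (Gamma s) \<le> C1 / \<bar>Im s\<bar> ^ N"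
    using Gamma_strip_bound[of "1/2" "b + 1 + real (\<nu> 1)" N] b by auto
  have "\<exists>C. C \<ge> 0 \<and> (\<forall>s. 1/2 \<le> Re s \<longrightarrow> Re s \<le> b + 1 + real (\<nu> j) \<longrightarrow> \<bar>Im s\<bar> \<ge> 1 \<longrightarrow> norm (Gamma s) \<le> C)" for j
  proof -
    obtain C where "C \<ge> 0" "\<And>s. 1/2 \<le> Re s \<Longrightarrow> Re s \<le> b + 1 + real (\<nu> j) \<Longrightarrow> \<bar>Im s\<bar> \<ge> 1 \<Longrightarrow> norm (Gamma s) \<le> C / \<bar>Im s\<bar> ^ 0"
      using Gamma_strip_bound[of "1/2" "b + 1 + real (\<nu> j)" 0] b by auto
    then show ?thesis by (intro exI[of _ C]) auto
  qed
  then obtain D where D: "\<And>j. D j \<ge> 0" "\<And>j s. 1/2 \<le> Re s \<Longrightarrow> Re s \<le> b + 1 + real (\<nu> j) \<Longrightarrow> \<bar>Im s\<bar> \<ge> 1 \<Longrightarrow> norm (Gamma s) \<le> D j"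
    by metis
  define B where "B = \<bar>b\<bar> + real n + 2"
  define K where "K = (\<Sum>k<n. norm (coef n k * (of_real x powr of_nat k * rgamma_prod (of_nat k))) * B ^ n)"
  define Y where "Y = exp ((\<bar>b\<bar> + 2) * \<bar>ln y\<bar>)"
  have "norm (line_integrand n x y s) \<le> (K * C1 * (\<Prod>j=2..M. D j) * Y) / (Im s)\<^sup>2"
    if s: "-1/2 \<le> Re s" "Re s \<le> b" "\<bar>Im s\<bar> \<ge> 1" for s
  proof -
    have B1: "B * \<bar>Im s\<bar> \<ge> 1" using s mult_mono[of 1 B 1 "\<bar>Im s\<bar>"] by (simp add: B_def)
    have fac: "norm (s - of_nat j) \<le> B * \<bar>Im s\<bar>" if "j < n" for j
    proof -
      have "norm (s - of_nat j) \<le> \<bar>Re (s - of_nat j)\<bar> + \<bar>Im (s - of_nat j)\<bar>" by (rule cmod_le)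
      also have "\<dots> \<le> (\<bar>b\<bar> + real n + 1) * 1 + \<bar>Im s\<bar>" using s that by auto
      also have "\<dots> \<le> (\<bar>b\<bar> + real n + 1) * \<bar>Im s\<bar> + \<bar>Im s\<bar>" using s by (intro add_mono mult_left_mono) auto
      finally show ?thesis by (simp add: B_def algebra_simps)
    qed
    have T: "norm (residue_poly n x s) \<le> K * \<bar>Im s\<bar> ^ n"
    proof -
      have "norm (\<Prod>j\<in>{..<n}-{k}. s - of_nat j) \<le> (B * \<bar>Im s\<bar>) ^ n" if "k < n" for k
      proof -
        have "norm (\<Prod>j\<in>{..<n}-{k}. s - of_nat j) \<le> (\<Prod>j\<in>{..<n}-{k}. B * \<bar>Im s\<bar>)"
          unfolding prod_norm[symmetric] by (intro prod_mono) (use fac in auto)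
        also have "\<dots> = (B * \<bar>Im s\<bar>) ^ card ({..<n}-{k})" by simp
        also have "\<dots> \<le> (B * \<bar>Im s\<bar>) ^ n"
          using B1 card_mono[of "{..<n}" "{..<n}-{k}"] by (intro power_increasing) auto
        finally show ?thesis .
      qed
      then have "norm (residue_poly n x s) \<le> (\<Sum>k<n. norm (coef n k * (of_real x powr of_nat k * rgamma_prod (of_nat k))) * (B * \<bar>Im s\<bar>) ^ n)"
        unfolding residue_poly_def
        by (intro order_trans[OF norm_sum sum_mono]) (auto simp: norm_mult intro!: mult_left_mono)
      then show ?thesis by (simp add: K_def sum_distrib_right sum_distrib_left power_mult_distrib mult_ac)
    qed
    have W: "norm (gamma_prod s) \<le> C1 / \<bar>Im s\<bar> ^ N * (\<Prod>j=2..M. D j)"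
    proof -
      have "gamma_prod s = Gamma (s + of_nat (\<nu> 1) + 1) * (\<Prod>j=2..M. Gamma (s + of_nat (\<nu> j) + 1))"
        unfolding gamma_prod_def using M1 by (subst prod.atLeast_Suc_atMost) (auto simp: numeral_2_eq_2)
      moreover have p: "norm (\<Prod>j=2..M. Gamma (s + of_nat (\<nu> j) + 1)) \<le> (\<Prod>j=2..M. D j)"
        unfolding prod_norm[symmetric] using s by (intro prod_mono) (auto intro!: D)
      have "norm (Gamma (s + of_nat (\<nu> 1) + 1)) \<le> C1 / \<bar>Im s\<bar> ^ N"
        using C1(2)[of "s + of_nat (\<nu> 1) + 1"] s by simp
      from mult_mono[OF this p] have "norm (Gamma (s + of_nat (\<nu> 1) + 1)) * norm (\<Prod>j=2..M. Gamma (s + of_nat (\<nu> j) + 1)) \<le> C1 / \<bar>Im s\<bar> ^ N * (\<Prod>j=2..M. D j)"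
        using C1(1) by auto
      ultimately show ?thesis by (simp only: norm_mult)
    qed
    have Yb: "norm (of_real y powr (- s - 1)) \<le> Y"
    proof -
      have "norm (of_real y powr (- s - 1)) = y powr (- Re s - 1)"
        using y by (simp add: norm_powr_real_powr)
      also have "\<dots> = exp ((- Re s - 1) * ln y)" using y by (simp add: powr_def)
      also have "(- Re s - 1) * ln y \<le> \<bar>- Re s - 1\<bar> * \<bar>ln y\<bar>" by (simp flip: abs_mult)
      also have "\<dots> \<le> (\<bar>b\<bar> + 2) * \<bar>ln y\<bar>" using s by (intro mult_right_mono) auto
      finally show ?thesis by (simp add: Y_def)
    qed
    have K0: "K \<ge> 0" unfolding K_def B_def by (intro sum_nonneg mult_nonneg_nonneg) auto
    have D0: "(\<Prod>j=2..M. D j) \<ge> 0" using D(1) by (intro prod_nonneg) auto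
    have "norm (line_integrand n x y s) \<le> (K * \<bar>Im s\<bar> ^ n) * (C1 / \<bar>Im s\<bar> ^ N * (\<Prod>j=2..M. D j)) * Y"
      unfolding line_integrand_def norm_mult using T W Yb K0 C1(1) D0 by (intro mult_mono mult_nonneg_nonneg) auto
    also have "\<dots> = (K * C1 * (\<Prod>j=2..M. D j) * Y) / (Im s)\<^sup>2"
    proof -
      have "\<bar>Im s\<bar> ^ N = \<bar>Im s\<bar> ^ n * (Im s)\<^sup>2" by (simp add: N_def power_add power2_eq_square)
      moreover have "\<bar>Im s\<bar> ^ n > 0" using s by simp
      ultimately show ?thesis by (simp add: field_simps)
    qed
    finally show ?thesis .
  qed
  then show ?thesis by (rule that)
qed

section \<open>The pentagonal contour\<close>

text \<open>The sides in positive direction, starting from the right-hand corner \<open>r\<close>.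
  They are kept as separate integrals because the two inclined sides contribute to the limit and the
  other three only to the error.\<close>

definition pentagon :: "real \<Rightarrow> real \<Rightarrow> real \<Rightarrow> (complex \<Rightarrow> complex) \<Rightarrow> complex" where
  "pentagon c r V f =
     contour_integral (linepath (of_real r) (Complex c V)) f +
     contour_integral (linepath (Complex c V) (Complex (-1/2) V)) f +
     contour_integral (linepath (Complex (-1/2) V) (Complex (-1/2) (- V))) f +
     contour_integral (linepath (Complex (-1/2) (- V)) (Complex c (- V))) f +
     contour_integral (linepath (Complex c (- V)) (of_real r)) f"

text \<open>For a rectangle the winding numbers are known. Its right side is then replaced by the
  two sides meeting at \<open>r\<close>, using Cauchy's theorem on a triangle between the last zero
  \<open>n - 1\<close> of \<open>F\<close> and the point \<open>s\<close>.\<close>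

lemma residue_sum_eq_pentagon:
  assumes nu0: "\<nu> 0 = 0" and n: "n > 0" and x: "x > 0" and V: "V > 0" and s: "Re s > r" "r > real n"
  shows "2 * of_real pi * \<i> * residue_sum n x s = pentagon (real n) r V (\<lambda>t. of_real x powr t / F n t / (s - t))"
proof -
  define f where "f = (\<lambda>t. of_real x powr t / F n t / (s - t))"
  define h where "h = (\<lambda>t. of_real x powr t * rgamma_prod t / (\<Prod>k<n. t - of_nat k) / (s - t))"
  define S where "S = {t. Re t > -1 \<and> Re t < Re s}"
  define a1 a2 a3 a4 where "a1 = Complex (-1/2) (- V)" and "a2 = Complex (real n) (- V)"
    and "a3 = Complex (real n) V" and "a4 = Complex (-1/2) V"
  note adefs = a1_def a2_def a3_def a4_def
  have hS: "S = {t. Re t > -1} \<inter> {t. Re t < Re s}" by (auto simp: S_def)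
  have S: "convex S" "open S"
    unfolding hS using convex_halfspace_Re_gt[of "-1"] convex_halfspace_Re_lt[of "Re s"]
      open_halfspace_Re_gt[of "-1"] open_halfspace_Re_lt[of "Re s"] by (auto intro: convex_Int)
  have pim: "path_image (rectpath a1 a3) \<subseteq> S"
  proof -
    have "path_image (rectpath a1 a3) \<subseteq> cbox a1 a3"
      using V by (intro path_image_rectpath_subset_cbox) (auto simp: adefs)
    also have "\<dots> \<subseteq> S" using s by (auto simp: in_cbox_complex_iff adefs S_def)
    finally show ?thesis .
  qed
  have "(f has_contour_integral 2 * of_real pi * \<i> * residue_sum n x s) (rectpath a1 a3)"
    unfolding f_def
  proof (rule contour_integral_F[OF nu0 n x S])
    show "t \<in> S \<Longrightarrow> - 1 < Re t" for t by (simp add: S_def)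
    show "s \<notin> S" by (simp add: S_def)
    show "of_nat k \<in> S" if "k < n" for k using that s by (auto simp: S_def)
    show "of_nat k \<notin> path_image (rectpath a1 a3)" if "k < n" for k
      using that V by (subst path_image_rectpath) (auto simp: adefs)
    show "winding_number (rectpath a1 a3) (of_nat k) = 1" if "k < n" for k
      using that V by (intro winding_number_rectpath) (auto simp: adefs in_box_complex_iff)
  qed (use pim in auto)
  then have rect: "(f has_contour_integral 2 * of_real pi * \<i> * residue_sum n x s) (linepath a1 a2 +++ linepath a2 a3 +++ linepath a3 a4 +++ linepath a4 a1)"
    by (simp add: rectpath_def Let_def adefs)
  then have int: "f contour_integrable_on linepath a1 a2" "f contour_integrable_on linepath a2 a3"
     "f contour_integrable_on linepath a3 a4" "f contour_integrable_on linepath a4 a1"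
  proof -
    have v: "valid_path (linepath a3 a4 +++ linepath a4 a1)" "valid_path (linepath a2 a3 +++ linepath a3 a4 +++ linepath a4 a1)"
      by (auto intro!: valid_path_join)
    note i1 = has_contour_integral_integrable[OF rect]
    note i2 = contour_integrable_joinD2[OF i1 v(2)]
    note i3 = contour_integrable_joinD2[OF i2 v(1)]
    show "f contour_integrable_on linepath a1 a2" by (rule contour_integrable_joinD1[OF i1]) simp
    show "f contour_integrable_on linepath a2 a3" by (rule contour_integrable_joinD1[OF i2]) simp
    show "f contour_integrable_on linepath a3 a4" by (rule contour_integrable_joinD1[OF i3]) simp
    show "f contour_integrable_on linepath a4 a1" by (rule contour_integrable_joinD2[OF i3]) simp
  qed
  have sum1: "2 * of_real pi * \<i> * residue_sum n x s = contour_integral (linepath a1 a2) f + (contour_integral (linepath a2 a3) f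
     + (contour_integral (linepath a3 a4) f + contour_integral (linepath a4 a1) f))"
  proof -
    have "(f has_contour_integral (contour_integral (linepath a1 a2) f + (contour_integral (linepath a2 a3) f
      + (contour_integral (linepath a3 a4) f + contour_integral (linepath a4 a1) f)))) (linepath a1 a2 +++ linepath a2 a3 +++ linepath a3 a4 +++ linepath a4 a1)"
      using int by (intro has_contour_integral_join has_contour_integral_integral valid_path_join) auto
    then show ?thesis using rect has_contour_integral_unique by blast
  qed
  have tri: "contour_integral (linepath a2 (of_real r)) f + contour_integral (linepath (of_real r) a3) f = contour_integral (linepath a2 a3) f"
  proof -
    \<comment> \<open>A convex strip that contains the triangle, lies to the right of all zeros of
      \<open>F\<close> and to the left of \<open>s\<close>.\<close>
    define U where "U = {t. Re t > real n - 1 \<and> Re t < Re s}"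
    have hU: "U = {t. Re t > real n - 1} \<inter> {t. Re t < Re s}" by (auto simp: U_def)
    have U: "convex U" "open U"
      unfolding hU using convex_halfspace_Re_gt[of "real n - 1"] convex_halfspace_Re_lt[of "Re s"]
        open_halfspace_Re_gt[of "real n - 1"] open_halfspace_Re_lt[of "Re s"] by (auto intro: convex_Int)
    have nk: "t \<noteq> of_nat k" if "t \<in> U" "k < n" for t k using that by (auto simp: U_def)
    have "h holomorphic_on U"
      unfolding h_def using x nk by (intro holomorphic_intros holomorphic_rgamma_prod) (auto simp: U_def)
    moreover have "h t = f t" if t: "t \<in> U" for t
    proof -
      have "t - of_nat n + 1 \<notin> \<int>\<^sub>\<le>\<^sub>0"
        by (rule not_pole) (use nk[OF t] t n in \<open>auto simp: U_def\<close>)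
      then show ?thesis by (simp add: h_def f_def rgamma_prod_eq F_eq[OF nu0])
    qed
    ultimately have fU: "f holomorphic_on U" using holomorphic_transform by blast
    have pts: "a2 \<in> U" "of_real r \<in> U" "a3 \<in> U" using s by (auto simp: U_def adefs)
    then have hull: "convex hull {a2, of_real r, a3} \<subseteq> U" using U by (intro hull_minimal) auto
    have "closed_segment u w \<subseteq> U" if "u \<in> U" "w \<in> U" for u w
      using U(1) that by (simp add: closed_segment_subset)
    then have ints: "f contour_integrable_on linepath u w" if "u \<in> U" "w \<in> U" for u w
      using that fU U(2) by (intro contour_integrable_holomorphic_simple) auto
    have "(f has_contour_integral 0) (linepath a2 (of_real r) +++ linepath (of_real r) a3 +++ linepath a3 a2)"
      using holomorphic_on_subset[OF fU hull] by (rule Cauchy_theorem_triangle)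
    moreover have "(f has_contour_integral (contour_integral (linepath a2 (of_real r)) f + (contour_integral (linepath (of_real r) a3) f + contour_integral (linepath a3 a2) f))) (linepath a2 (of_real r) +++ linepath (of_real r) a3 +++ linepath a3 a2)"
      using ints pts by (intro has_contour_integral_join has_contour_integral_integral valid_path_join) auto
    ultimately have "contour_integral (linepath a2 (of_real r)) f + (contour_integral (linepath (of_real r) a3) f + contour_integral (linepath a3 a2) f) = 0"
      using has_contour_integral_unique by blast
    moreover have "contour_integral (linepath a3 a2) f = - contour_integral (linepath a2 a3) f"
      using contour_integral_reversepath[of "linepath a2 a3" f] by simp
    ultimately show ?thesis by (simp add: algebra_simps)
  qed
  show ?thesis
    unfolding sum1 tri[symmetric] unfolding pentagon_def f_def[symmetric] adefs by (simp add: add_ac)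
qed

lemma continuous_on_residue_sum: "continuous_on {s. Re s > real n} (residue_sum n x)"
  unfolding residue_sum_def by (intro continuous_intros) auto

text \<open>Neither of the lines at -1/2 and \<open>b\<close> meets the points 0, ..., n - 1, so on
  both of them \<open>line_integrand\<close> agrees with the product of \<open>F\<close> and the
  residue sum; between them only the holomorphic form is used. The inner integral consumes one
  factor 2 pi i of the prefactor.\<close>

lemma product_kernel_eq_line:
  assumes nu0: "\<nu> 0 = 0" and n: "n > 0" and \<gamma>: "kernel_contour n \<gamma>" and xy: "x > 0" "y > 0" and b: "b > real n"
  shows "product_kernel M \<nu> n \<gamma> x y =
    1 / (2 * of_real pi * \<i>) * vertical_line_integral b (\<lambda>s. F n s * of_real y powr (- s - 1) * residue_sum n x s)"
proof -
  have "contour_integral \<gamma> (\<lambda>t. kernel_integrand M \<nu> n x y s t) = 2 * of_real pi * \<i> * line_integrand n x y s"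
    if s: "Re s = -1/2" for s
  proof -
    have op: "convex {t. Re t > -1/2}" "open {t. Re t > -1/2}"
      using convex_halfspace_Re_gt[of "-1/2"] open_halfspace_Re_gt[of "-1/2"] by auto
    have "((\<lambda>t. of_real x powr t / F n t / (s - t)) has_contour_integral 2 * of_real pi * \<i> * residue_sum n x s) \<gamma>"
      using \<gamma> s unfolding kernel_contour_def
      by (intro contour_integral_F[OF nu0 n xy(1) op]) auto
    from has_contour_integral_lmul[OF this, of "F n s * of_real y powr (- s - 1)"]
    have "contour_integral \<gamma> (\<lambda>t. kernel_integrand M \<nu> n x y s t) = F n s * of_real y powr (- s - 1) * (2 * of_real pi * \<i> * residue_sum n x s)"
      unfolding kernel_integrand_eq by (rule contour_integral_unique)
    moreover have nk: "s \<noteq> of_nat k" for k using s by auto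
    moreover have "F n s = (\<Prod>k<n. s - of_nat k) * gamma_prod s"
      by (rule F_eq[OF nu0 not_pole]) (use nk s in auto)
    ultimately show ?thesis by (simp add: line_integrand_def residue_poly_eq)
  qed
  then have "vertical_line_integral (-1/2) (\<lambda>s. contour_integral \<gamma> (\<lambda>t. kernel_integrand M \<nu> n x y s t)) =
     2 * of_real pi * \<i> * vertical_line_integral (-1/2) (line_integrand n x y)"
    by (simp add: vertical_line_integral_def)
  also have "vertical_line_integral (-1/2) (line_integrand n x y) = vertical_line_integral b (line_integrand n x y)"
  proof -
    have b2: "b > -1/2" using b by linarith
    obtain C where C: "\<And>s. -1/2 \<le> Re s \<Longrightarrow> Re s \<le> b \<Longrightarrow> \<bar>Im s\<bar> \<ge> 1 \<Longrightarrow> norm (line_integrand n x y s) \<le> C / (Im s)\<^sup>2"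
      by (rule line_integrand_bound[OF xy(2) b2, of n x]) blast
    show ?thesis
      using convex_halfspace_Re_gt[of "-1"] open_halfspace_Re_gt[of "-1"]
      by (intro vertical_line_integral_shift[OF b2 holomorphic_line_integrand[OF xy(2)] _ _ _ C]) auto
  qed
  also have "vertical_line_integral b (line_integrand n x y) = vertical_line_integral b (\<lambda>s. F n s * of_real y powr (- s - 1) * residue_sum n x s)"
  proof -
    have "line_integrand n x y s = F n s * of_real y powr (- s - 1) * residue_sum n x s" if s: "Re s = b" for s
    proof -
      have nk: "s \<noteq> of_nat k" if "k < n" for k using s b that by auto
      have "F n s = (\<Prod>k<n. s - of_nat k) * gamma_prod s"
        by (rule F_eq[OF nu0 not_pole]) (use nk s b in auto)
      then show ?thesis by (simp add: line_integrand_def residue_poly_eq[OF nk] mult_ac)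
    qed
    then show ?thesis by (simp add: vertical_line_integral_def)
  qed
  finally show ?thesis
    by (simp add: product_kernel_def power2_eq_square)
qed

end

section \<open>Asymptotics of the integrands\<close>

lemma exp_cubic_le:
  fixes c A r :: real
  assumes "c > 0" "r \<ge> 0"
  shows "exp (A * r - c * r ^ 3) \<le> exp (c + (A + 2)\<^sup>2 / (4 * c)) * exp (- r)"
proof -
  have "r\<^sup>2 - 1 \<le> r ^ 3"
  proof (cases "r \<ge> 1")
    case True
    then have "r\<^sup>2 * 1 \<le> r\<^sup>2 * r" by (intro mult_left_mono) auto
    then show ?thesis by (simp add: power3_eq_cube power2_eq_square)
  next
    case False
    then have "r\<^sup>2 \<le> 1" "r ^ 3 \<ge> 0" using assms by (auto simp: power_le_one)
    then show ?thesis by linarith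
  qed
  then have "c * (r\<^sup>2 - 1) \<le> c * r ^ 3" using assms by (intro mult_left_mono) auto
  then have "exp (A * r - c * r ^ 3) \<le> exp (c + (A * r - c * r\<^sup>2))" by (simp add: algebra_simps)
  also have "\<dots> = exp c * (r ^ 0 * exp (A * r - c * r\<^sup>2))" by (simp add: exp_add)
  also have "\<dots> \<le> exp c * (fact 0 * exp ((A + 2)\<^sup>2 / (4 * c)) * exp (- r))"
    using assms by (intro mult_left_mono exp_gauss_le) auto
  finally show ?thesis by (simp add: exp_add)
qed

context ginibre_product
begin

section \<open>The contours inside the regular set\<close>

text \<open>On the horizontal side the moduli of \<open>w\<close> and \<open>w - 1\<close> are at
  most 3, so the imaginary part \<open>e\<close> is at least \<open>e / 3\<close> times each, and
  \<open>in_sector_Im\<close> divides by another 3. The radius \<open>e / 2\<close> in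
  \<open>reg_radius\<close> is a lower bound for the distance from an inclined side to the point
  1.\<close>

definition reg_angle :: real where "reg_angle = e / 9"
definition reg_radius :: real where "reg_radius = e / 2"

lemma reg_pos: "reg_angle > 0" "reg_radius > 0"
  using e_bounds by (auto simp: reg_angle_def reg_radius_def)

lemma regular_right:
  assumes "Re w \<ge> 1" "norm (w - 1) \<ge> e / 2"
  shows "w \<in> regular reg_angle reg_radius"
proof -
  have "reg_angle \<le> 1/2" using e_bounds by (simp add: reg_angle_def)
  then have "in_sector reg_angle w" "in_sector reg_angle (w - 1)"
    using assms by (auto intro!: in_sector_mono[OF in_sector_Re])
  moreover have "norm w \<ge> reg_radius" using complex_Re_le_cmod[of w] assms e_bounds by (simp add: reg_radius_def)
  ultimately show ?thesis using assms by (simp add: regular_def reg_radius_def)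
qed

lemma regular_vertical: "Re w \<ge> w0 \<Longrightarrow> w \<in> regular reg_angle reg_radius"
  using complex_Re_le_cmod[of "w - 1"] e_bounds by (intro regular_right) (auto simp: w0_def)

lemma regular_ray:
  assumes "0 \<le> a" "a \<le> e"
  shows "Complex (w0 - a) a \<in> regular reg_angle reg_radius"
proof (rule regular_right)
  show "1 \<le> Re (Complex (w0 - a) a)" using assms by (simp add: w0_def)
  have "\<bar>Re (Complex (w0 - a) a - 1)\<bar> \<le> norm (Complex (w0 - a) a - 1)" "\<bar>Im (Complex (w0 - a) a - 1)\<bar> \<le> norm (Complex (w0 - a) a - 1)"
    by (rule abs_Re_le_cmod, rule abs_Im_le_cmod)
  then have "e - a \<le> norm (Complex (w0 - a) a - 1)" "a \<le> norm (Complex (w0 - a) a - 1)"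
    using assms by (auto simp: w0_def)
  then show "e / 2 \<le> norm (Complex (w0 - a) a - 1)" by linarith
qed

lemma regular_horizontal:
  assumes "-1 \<le> u" "u \<le> 1"
  shows "Complex u e \<in> regular reg_angle reg_radius"
proof -
  have "norm (Complex u e) \<le> 3" "norm (Complex u e - 1) \<le> 3"
    using cmod_le[of "Complex u e"] cmod_le[of "Complex u e - 1"] assms e_bounds by auto
  then have "e / 3 * norm (Complex u e) \<le> e / 3 * 3" "e / 3 * norm (Complex u e - 1) \<le> e / 3 * 3"
    using e_bounds by (auto intro!: mult_left_mono)
  then have "in_sector (e / 3 / 3) (Complex u e)" "in_sector (e / 3 / 3) (Complex u e - 1)"
    using e_bounds in_sector_Im[of "e / 3" "Complex u e"] in_sector_Im[of "e / 3" "Complex u e - 1"] by auto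
  moreover have "e \<le> norm (Complex u e)" "e \<le> norm (Complex u e - 1)"
    using abs_Im_le_cmod[of "Complex u e"] abs_Im_le_cmod[of "Complex u e - 1"] by auto
  ultimately show ?thesis using e_bounds by (simp add: regular_def reg_angle_def reg_radius_def)
qed

definition h :: "nat \<Rightarrow> complex \<Rightarrow> complex" where
  "h n w = H n (of_nat n * w) - H n (of_nat n * of_real w0)"

lemma h_approx:
  obtains C n0 where "C \<ge> 0" "n0 > 0"
    "\<And>n w. n \<ge> n0 \<Longrightarrow> Re w \<ge> w0 \<Longrightarrow> norm (h n w - of_nat n * (g w - g (of_real w0))) \<le> C * norm (w - of_real w0)"
    "\<And>n a. n \<ge> n0 \<Longrightarrow> 0 \<le> a \<Longrightarrow> a \<le> e \<Longrightarrow>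
      norm (h n (Complex (w0 - a) a) - of_nat n * (g (Complex (w0 - a) a) - g (of_real w0))) \<le> C * a"
    "\<And>n u. n \<ge> n0 \<Longrightarrow> -1 \<le> u \<Longrightarrow> u \<le> 1 \<Longrightarrow>
      norm (h n (Complex u e) - of_nat n * (g (Complex u e) - g (of_real w0))) \<le> C"
proof -
  obtain C n0 where C: "C \<ge> 0" "n0 > 0" "\<And>n a b. n \<ge> n0 \<Longrightarrow> closed_segment a b \<subseteq> regular reg_angle reg_radius \<Longrightarrow>
    norm (H n (of_nat n * b) - H n (of_nat n * a) - of_nat n * (g b - g a)) \<le> C * norm (b - a)"
    by (rule H_approx[OF reg_pos]) blast
  have vert: "norm (h n w - of_nat n * (g w - g (of_real w0))) \<le> C * norm (w - of_real w0)"
    if n: "n \<ge> n0" and w: "Re w \<ge> w0" for n w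
    unfolding h_def
  proof (rule C(3)[OF n])
    have "convex {z. Re z \<ge> w0}" using convex_halfspace_Re_ge[of w0] by simp
    then have "closed_segment (of_real w0) w \<subseteq> {z. Re z \<ge> w0}"
      using w by (intro closed_segment_subset) auto
    then show "closed_segment (of_real w0) w \<subseteq> regular reg_angle reg_radius" using regular_vertical by blast
  qed
  have ray: "norm (h n (Complex (w0 - a) a) - of_nat n * (g (Complex (w0 - a) a) - g (of_real w0))) \<le> C * norm (Complex (w0 - a) a - of_real w0)"
    if n: "n \<ge> n0" and a: "0 \<le> a" "a \<le> e" for n a
    unfolding h_def
  proof (rule C(3)[OF n], rule subsetI)
    fix z assume "z \<in> closed_segment (of_real w0) (Complex (w0 - a) a)"
    then obtain u where u: "0 \<le> u" "u \<le> 1" "z = (1 - u) *\<^sub>R of_real w0 + u *\<^sub>R Complex (w0 - a) a"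
      by (auto simp: in_segment)
    then have "z = Complex (w0 - u * a) (u * a)" by (simp add: complex_eq_iff algebra_simps)
    moreover have "0 \<le> u * a" "u * a \<le> e" using u a mult_mono[of u 1 a e] by auto
    ultimately show "z \<in> regular reg_angle reg_radius" using regular_ray by simp
  qed
  have na: "norm (Complex (w0 - a) a - of_real w0) \<le> 2 * a" if "a \<ge> 0" for a
    using cmod_le[of "Complex (w0 - a) a - of_real w0"] that by simp
  have ray2: "norm (h n (Complex (w0 - a) a) - of_nat n * (g (Complex (w0 - a) a) - g (of_real w0))) \<le> 2 * C * a"
    if n: "n \<ge> n0" and a: "0 \<le> a" "a \<le> e" for n a
    using ray[OF that] mult_left_mono[OF na[OF a(1)] C(1)] by simp
  have hor: "norm (h n (Complex u e) - of_nat n * (g (Complex u e) - g (of_real w0))) \<le> 4 * C"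
    if n: "n \<ge> n0" and u: "-1 \<le> u" "u \<le> 1" for n u
  proof -
    \<comment> \<open>The inclined segment ends where the horizontal one begins, so the error on the
      horizontal side is the sum of the errors along both segments.\<close>
    have c: "Complex (w0 - e) e = Complex 1 e" by (simp add: w0_def)
    have "norm (H n (of_nat n * Complex u e) - H n (of_nat n * Complex 1 e) - of_nat n * (g (Complex u e) - g (Complex 1 e))) \<le> C * norm (Complex u e - Complex 1 e)"
    proof (rule C(3)[OF n], rule subsetI)
      fix z assume "z \<in> closed_segment (Complex 1 e) (Complex u e)"
      then have "Im z = e" "u \<le> Re z" "Re z \<le> 1"
        using closed_segment_same_Im[of "Complex 1 e" "Complex u e"] u by (auto simp: closed_segment_eq_real_ivl split: if_splits)
      then show "z \<in> regular reg_angle reg_radius" using regular_horizontal[of "Re z"] u by (cases z) auto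
    qed
    also have "norm (Complex u e - Complex 1 e) \<le> 2"
      using cmod_le[of "Complex u e - Complex 1 e"] u by simp
    finally have 1: "norm (H n (of_nat n * Complex u e) - H n (of_nat n * Complex 1 e) - of_nat n * (g (Complex u e) - g (Complex 1 e))) \<le> C * 2"
      using C(1) by (simp add: mult_left_mono)
    have "2 * C * e \<le> 2 * C * 1" using C(1) e_bounds by (intro mult_left_mono) auto
    then have 2: "norm (h n (Complex 1 e) - of_nat n * (g (Complex 1 e) - g (of_real w0))) \<le> 2 * C"
      using ray2[OF n, of e] e_bounds unfolding c by simp
    have "h n (Complex u e) - of_nat n * (g (Complex u e) - g (of_real w0)) =
      (H n (of_nat n * Complex u e) - H n (of_nat n * Complex 1 e) - of_nat n * (g (Complex u e) - g (Complex 1 e)))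
      + (h n (Complex 1 e) - of_nat n * (g (Complex 1 e) - g (of_real w0)))"
      by (simp add: h_def algebra_simps)
    then show ?thesis using norm_triangle_ineq 1 2 by (smt (verit))
  qed
  show ?thesis
  proof (rule that[of "4 * C" n0])
    show "norm (h n w - of_nat n * (g w - g (of_real w0))) \<le> 4 * C * norm (w - of_real w0)" if "n \<ge> n0" "Re w \<ge> w0" for n w
    proof -
      have "C * norm (w - of_real w0) \<le> 4 * C * norm (w - of_real w0)"
        using C(1) by (intro mult_right_mono) auto
      then show ?thesis using vert[OF that] by linarith
    qed
    show "norm (h n (Complex (w0 - a) a) - of_nat n * (g (Complex (w0 - a) a) - g (of_real w0))) \<le> 4 * C * a" if "n \<ge> n0" "0 \<le> a" "a \<le> e" for n a
    proof -
      have "2 * C * a \<le> 4 * C * a" using C(1) that by (intro mult_right_mono) auto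
      then show ?thesis using ray2[OF that] by linarith
    qed
  qed (use C hor in auto)
qed

section \<open>The Airy scale and the normalised integrands\<close>

text \<open>Chosen so that the cubic term of the phase becomes \<open>z ^ 3 / 3\<close>. One Airy
  unit has length \<open>dl n\<close> in the variable \<open>w\<close> and
  \<open>kk n = n * dl n\<close> in the variable \<open>s\<close>.\<close>

definition kap :: real where "kap = (2 * (real M + 1)) powr (1/3) / real M"
definition dl :: "nat \<Rightarrow> real" where "dl n = kap / real n powr (1/3)"
definition kk :: "nat \<Rightarrow> real" where "kk n = kap * real n powr (2/3)"
definition s0 :: "nat \<Rightarrow> complex" where "s0 n = of_nat n * of_real w0"
definition lX :: "nat \<Rightarrow> real" where "lX n = real M * ln (real n) + ln (x_star M)"

lemma kap_pos: "kap > 0"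
  using M1 by (simp add: kap_def)

lemma kap_cube: "kap ^ 3 * (real M ^ 3 / (6 * (real M + 1))) = 1 / 3"
proof -
  have "((2 * (real M + 1)) powr (1/3)) ^ 3 = 2 * (real M + 1)"
    by (simp add: powr_powr flip: powr_realpow)
  then have "kap ^ 3 * (real M ^ 3 / (6 * (real M + 1))) = (2 * (real M + 1)) / real M ^ 3 * (real M ^ 3 / (6 * (real M + 1)))"
    by (simp add: kap_def power_divide)
  also have "\<dots> = 2 * ((real M + 1) * real M ^ 3) / (6 * ((real M + 1) * real M ^ 3))"
    by (simp add: mult_ac)
  also have "\<dots> = 1 / 3"
  proof -
    have "2 * q / (6 * q) = 1 / 3" if "q \<noteq> 0" for q :: real using that by simp
    moreover have "(real M + 1) * real M ^ 3 \<noteq> 0" using M1 by auto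
    ultimately show ?thesis by blast
  qed
  finally show ?thesis .
qed

lemma powr_thirds:
  assumes "n > 0"
  shows "(real n powr (1/3)) ^ 3 = real n" "real n powr (2/3) = (real n powr (1/3)) ^ 2"
  using assms by (simp_all add: powr_powr flip: powr_realpow)

lemma dl_kk:
  assumes "n > 0"
  shows "real n * dl n = kk n" "real n * dl n ^ 3 = kap ^ 3" "dl n > 0" "kk n > 0"
    "real n * dl n ^ 2 = kap ^ 2 * real n powr (1/3)"
proof -
  define p where "p = real n powr (1/3)"
  have p: "p > 0" "real n = p ^ 3" "real n powr (2/3) = p ^ 2"
    using powr_thirds[OF assms] assms by (auto simp: p_def)
  show "real n * dl n = kk n" "real n * dl n ^ 3 = kap ^ 3" "dl n > 0" "kk n > 0"
    "real n * dl n ^ 2 = kap ^ 2 * real n powr (1/3)"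
    unfolding dl_def kk_def p(3) p_def[symmetric] using p(1) kap_pos
    by (simp_all add: p(2) field_simps power2_eq_square power3_eq_cube)
qed

lemma dl_tendsto: "dl \<longlonglongrightarrow> 0"
  unfolding dl_def by (intro tendsto_divide_0[OF tendsto_const] filterlim_at_top_imp_at_infinity) real_asymp

text \<open>The integrands in \<open>s\<close> and \<open>t\<close>, normalised at the critical point; \<open>lX n + lam\<close> is the logarithm
  of the argument of the kernel.\<close>

definition Af :: "nat \<Rightarrow> real \<Rightarrow> complex \<Rightarrow> complex" where
  "Af n lam s = F n s / F n (s0 n) * exp (- (s - s0 n) * of_real (lX n + lam))"
definition Bf :: "nat \<Rightarrow> real \<Rightarrow> complex \<Rightarrow> complex" where
  "Bf n lam t = F n (s0 n) / F n t * exp ((t - s0 n) * of_real (lX n + lam))"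

lemma F_ratio:
  assumes "w \<in> regular reg_angle reg_radius" "n > 0"
  shows "F n (of_nat n * w) / F n (s0 n) = exp (h n w + (of_nat n * w - s0 n) * of_real (lX n))"
    "F n (s0 n) \<noteq> 0" "F n (of_nat n * w) \<noteq> 0"
proof -
  have w0: "of_real w0 \<in> regular reg_angle reg_radius" by (intro regular_vertical) simp
  note e1 = regular_exp_logF[OF assms(1) reg_pos assms(2)]
  note e2 = regular_exp_logF[OF w0 reg_pos assms(2)]
  show "F n (s0 n) \<noteq> 0" "F n (of_nat n * w) \<noteq> 0" unfolding s0_def e1[symmetric] e2[symmetric] by auto
  have "logF n (of_nat n * w) - logF n (of_nat n * of_real w0) = h n w + (of_nat n * w - s0 n) * of_real (lX n)"
    by (simp add: h_def H_def s0_def lX_def algebra_simps)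
  then show "F n (of_nat n * w) / F n (s0 n) = exp (h n w + (of_nat n * w - s0 n) * of_real (lX n))"
    unfolding s0_def e1[symmetric] e2[symmetric] exp_diff[symmetric] by (simp add: s0_def)
qed

lemma Af_eq:
  assumes "w \<in> regular reg_angle reg_radius" "n > 0"
  shows "Af n lam (of_nat n * w) = exp (h n w - (of_nat n * w - s0 n) * of_real lam)"
  unfolding Af_def F_ratio(1)[OF assms] by (simp add: algebra_simps flip: exp_add)

lemma Bf_eq:
  assumes "w \<in> regular reg_angle reg_radius" "n > 0"
  shows "Bf n lam (of_nat n * w) = exp (- h n w + (of_nat n * w - s0 n) * of_real lam)"
proof -
  have "F n (s0 n) / F n (of_nat n * w) = inverse (F n (of_nat n * w) / F n (s0 n))" by simp
  then show ?thesis
    unfolding Bf_def F_ratio(1)[OF assms] by (simp add: algebra_simps flip: exp_add exp_minus)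
qed

lemma F_cnj: "F n (cnj t) = cnj (F n t)"
  by (simp add: F_def cnj_Gamma)

lemma s0_real: "cnj (s0 n) = s0 n" "Re (s0 n) = real n * w0" "Im (s0 n) = 0"
  by (simp_all add: s0_def)

lemma Bf_cnj: "Bf n lam (cnj t) = cnj (Bf n lam t)"
proof -
  have "F n (s0 n) = cnj (F n (s0 n))" using F_cnj[of n "s0 n"] s0_real by simp
  then show ?thesis
    using s0_real(1)[of n] by (simp add: Bf_def F_cnj exp_cnj)
qed

lemma Af_cnj: "Af n lam (cnj t) = cnj (Af n lam t)"
proof -
  have "F n (s0 n) = cnj (F n (s0 n))" using F_cnj[of n "s0 n"] s0_real by simp
  then show ?thesis
    using s0_real(1)[of n] by (simp add: Af_def F_cnj exp_cnj)
qed

lemma s0_plus: "n > 0 \<Longrightarrow> s0 n + of_real (kk n) * z = of_nat n * (of_real w0 + of_real (dl n) * z)"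
proof -
  assume "n > 0"
  then have "of_real (kk n) = (of_nat n * of_real (dl n) :: complex)"
    using dl_kk(1)[of n] by (metis of_real_mult of_real_of_nat_eq)
  then show ?thesis by (simp add: s0_def algebra_simps)
qed

text \<open>In Airy units \<open>n * dl n ^ 3\<close> is constant, so the quartic Taylor error is of
  order \<open>dl n\<close> and vanishes.\<close>

lemma g_scaled_tendsto:
  assumes N: "filterlim N at_top sequentially"
  shows "(\<lambda>k. of_nat (N k) * (g (of_real w0 + of_real (dl (N k)) * z) - g (of_real w0))) \<longlonglongrightarrow> z ^ 3 / 3"
proof -
  define K where "K = (2 * (real M + 1) + 2) / (e / 2) ^ 3"
  have N0: "\<forall>\<^sub>F k in sequentially. N k > 0"
    by (rule eventually_compose_filterlim[OF eventually_gt_at_top N])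
  have dN: "(\<lambda>k. dl (N k)) \<longlonglongrightarrow> 0" by (rule filterlim_compose[OF dl_tendsto N])
  then have "(\<lambda>k. norm (of_real (dl (N k)) * z)) \<longlonglongrightarrow> norm (of_real 0 * z)"
    by (intro tendsto_intros)
  then have "(\<lambda>k. norm (of_real (dl (N k)) * z)) \<longlonglongrightarrow> 0" by simp
  then have small: "\<forall>\<^sub>F k in sequentially. norm (of_real (dl (N k)) * z) < e / 2"
    using e_bounds by (intro order_tendstoD) auto
  have "(\<lambda>k. of_nat (N k) * (g (of_real w0 + of_real (dl (N k)) * z) - g (of_real w0)) - z ^ 3 / 3) \<longlonglongrightarrow> 0"
  proof (rule Lim_null_comparison)
    have "(\<lambda>k. K * (kap ^ 3 * (dl (N k) * norm z ^ 4))) \<longlonglongrightarrow> K * (kap ^ 3 * (0 * norm z ^ 4))"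
      by (intro tendsto_intros dN)
    then show "(\<lambda>k. K * (kap ^ 3 * (dl (N k) * norm z ^ 4))) \<longlonglongrightarrow> 0" by simp
    show "\<forall>\<^sub>F k in sequentially. norm (of_nat (N k) * (g (of_real w0 + of_real (dl (N k)) * z) - g (of_real w0)) - z ^ 3 / 3) \<le> K * (kap ^ 3 * (dl (N k) * norm z ^ 4))"
      using N0 small
    proof eventually_elim
      case (elim k)
      define n where "n = N k"
      have n: "n > 0" using elim by (simp add: n_def)
      let ?w = "of_real w0 + of_real (dl n) * z"
      have "norm (g ?w - g (of_real w0) - of_real (real M ^ 3 / (6 * (real M + 1))) * (?w - of_real w0) ^ 3) \<le> K * norm (?w - of_real w0) ^ 4"
        unfolding K_def using elim by (intro g_taylor) (simp add: n_def)
      then have "real n * norm (g ?w - g (of_real w0) - of_real (real M ^ 3 / (6 * (real M + 1))) * (of_real (dl n) * z) ^ 3) \<le> real n * (K * norm (of_real (dl n) * z) ^ 4)"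
        by (intro mult_left_mono) auto
      also have "real n * (K * norm (of_real (dl n) * z) ^ 4) = K * ((real n * dl n ^ 3) * (dl n * norm z ^ 4))"
        using dl_kk(3)[OF n] by (simp add: norm_mult power_mult_distrib eval_nat_numeral)
      also have "real n * norm (g ?w - g (of_real w0) - of_real (real M ^ 3 / (6 * (real M + 1))) * (of_real (dl n) * z) ^ 3)
         = norm (of_nat n * (g ?w - g (of_real w0) - of_real (real M ^ 3 / (6 * (real M + 1))) * (of_real (dl n) * z) ^ 3))"
        by (simp add: norm_mult)
      also have "of_nat n * (g ?w - g (of_real w0) - of_real (real M ^ 3 / (6 * (real M + 1))) * (of_real (dl n) * z) ^ 3)
         = of_nat n * (g ?w - g (of_real w0)) - of_real ((real n * dl n ^ 3) * (real M ^ 3 / (6 * (real M + 1)))) * z ^ 3"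
        by (simp add: power_mult_distrib algebra_simps)
      finally show ?case unfolding dl_kk(2)[OF n] kap_cube by (simp add: n_def)
    qed
  qed
  then show ?thesis by (simp add: LIM_zero_iff)
qed

section \<open>The s-integrand on the vertical line\<close>

text \<open>While \<open>d * v \<le> 1\<close>, the quadratic descent is
  \<open>c * v\<^sup>2\<close> with \<open>c\<close> independent of \<open>n\<close>. Beyond, the
  descent is linear with a rate of order \<open>n * d\<^sup>2\<close>, hence of order n^(1/3), which
  outgrows the approximation error of at most \<open>C * (1 + v)\<close>. The lower half follows by
  conjugation.\<close>

lemma Af_bound:
  obtains C n1 where "n1 > 0" "\<And>n lam v. n \<ge> n1 \<Longrightarrow> \<bar>kk n * lam\<bar> \<le> \<Lambda> \<Longrightarrow>
    norm (Af n lam (s0 n + of_real (kk n) * Complex 1 v)) \<le> C * exp (- \<bar>v\<bar>)"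
proof -
  obtain C n0 where C: "C \<ge> 0" "n0 > 0" and hC:
    "\<And>n w. n \<ge> n0 \<Longrightarrow> Re w \<ge> w0 \<Longrightarrow> norm (h n w - of_nat n * (g w - g (of_real w0))) \<le> C * norm (w - of_real w0)"
    using h_approx by metis
  define K where "K = (2 * (real M + 1) + 2) / (e / 2) ^ 3"
  \<comment> \<open>Bounds \<open>n\<close> times the increase of the phase from the critical point
    to the foot of the line: the cubic term contributes exactly 1/3, the Taylor error the
    rest.\<close>
  define G0 where "G0 = 1 / 3 + K * kap ^ 3"
  have "\<forall>\<^sub>F n in sequentially. dl n < min 1 (e / 2)"
    using e_bounds by (intro order_tendstoD(2)[OF dl_tendsto]) auto
  moreover have "filterlim (\<lambda>n. kap ^ 2 / 100 * real n powr (1/3)) at_top sequentially"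
    using kap_pos by (intro filterlim_tendsto_pos_mult_at_top[OF tendsto_const]) (auto, real_asymp)
  then have "\<forall>\<^sub>F n in sequentially. kap ^ 2 / 100 * real n powr (1/3) \<ge> 1 + C"
    by (rule filterlim_at_top[THEN iffD1, rule_format])
  ultimately have "\<forall>\<^sub>F n in sequentially. dl n < min 1 (e / 2) \<and> kap ^ 2 / 100 * real n powr (1/3) \<ge> 1 + C"
    by eventually_elim simp
  then obtain n2 where n2: "\<And>n. n \<ge> n2 \<Longrightarrow> dl n < min 1 (e / 2)" "\<And>n. n \<ge> n2 \<Longrightarrow> kap ^ 2 / 100 * real n powr (1/3) \<ge> 1 + C"
    unfolding eventually_sequentially by blast
  define c where "c = kap ^ 3 / 100"
  have c: "c > 0" using kap_pos by (simp add: c_def)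
  define D where "D = exp (G0 + 2 * C + \<Lambda> + 1 / (4 * c))"
  have main: "norm (Af n lam (s0 n + of_real (kk n) * Complex 1 v)) \<le> D * exp (- \<bar>v\<bar>)"
    if n: "n \<ge> max n0 n2" and lam: "\<bar>kk n * lam\<bar> \<le> \<Lambda>" and v: "v \<ge> 0" for n lam v
  proof -
    have n0: "n > 0" "n \<ge> n0" "n \<ge> n2" using n C(2) by auto
    define d where "d = dl n"
    have d: "0 < d" "d < 1" "d < e / 2" using dl_kk(3)[OF n0(1)] n2(1)[OF n0(3)] by (auto simp: d_def)
    define w where "w = of_real w0 + of_real d * Complex 1 v"
    have w: "w = Complex (w0 + d) (d * v)" by (simp add: w_def complex_eq_iff)
    have sw: "s0 n + of_real (kk n) * Complex 1 v = of_nat n * w"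
      using s0_plus[OF n0(1)] by (simp add: w_def d_def)
    have wreg: "w \<in> regular reg_angle reg_radius" using d by (intro regular_vertical) (simp add: w)
    have nw: "norm (w - of_real w0) \<le> d + d * v"
      using cmod_le[of "w - of_real w0"] d v by (simp add: w)
    have 1: "real n * (Re (g (of_real (w0 + d))) - Re (g (of_real w0))) \<le> G0"
    proof -
      have "norm (g (of_real (w0 + d)) - g (of_real w0) - of_real (real M ^ 3 / (6 * (real M + 1))) * (of_real (w0 + d) - of_real w0) ^ 3) \<le> K * norm (of_real (w0 + d) - of_real w0 :: complex) ^ 4"
        unfolding K_def by (rule g_taylor) (use d in auto)
      then have "norm (g (of_real (w0 + d)) - g (of_real w0) - of_real (real M ^ 3 / (6 * (real M + 1)) * d ^ 3)) \<le> K * d ^ 4"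
        using d by simp
      then have "Re (g (of_real (w0 + d)) - g (of_real w0) - of_real (real M ^ 3 / (6 * (real M + 1)) * d ^ 3)) \<le> K * d ^ 4"
        using complex_Re_le_cmod order_trans by blast
      then have "Re (g (of_real (w0 + d))) - Re (g (of_real w0)) \<le> real M ^ 3 / (6 * (real M + 1)) * d ^ 3 + K * d ^ 4"
        by simp
      then have "real n * (Re (g (of_real (w0 + d))) - Re (g (of_real w0))) \<le> real n * (real M ^ 3 / (6 * (real M + 1)) * d ^ 3 + K * d ^ 4)"
        by (intro mult_left_mono) auto
      also have "\<dots> = (real n * d ^ 3) * (real M ^ 3 / (6 * (real M + 1))) + K * ((real n * d ^ 3) * d)"
        by (simp add: algebra_simps eval_nat_numeral)
      also have "\<dots> = 1 / 3 + K * (kap ^ 3 * d)"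
        unfolding d_def dl_kk(2)[OF n0(1)] kap_cube ..
      also have "\<dots> \<le> 1 / 3 + K * (kap ^ 3 * 1)"
        using d kap_pos e_bounds by (intro add_left_mono mult_left_mono) (auto simp: K_def)
      finally show ?thesis by (simp add: G0_def)
    qed
    have 2: "real n * (Re (g w) - Re (g (of_real (w0 + d)))) \<le> real n * (- (d / 100) * (if d * v \<le> 1 then (d * v)\<^sup>2 else d * v))"
      unfolding w using d v by (intro mult_left_mono Re_g_vertical) auto
    have 3: "Re (h n w) \<le> real n * (Re (g w) - Re (g (of_real w0))) + C * (d + d * v)"
    proof -
      have "Re (h n w - of_nat n * (g w - g (of_real w0))) \<le> C * norm (w - of_real w0)"
        by (rule order_trans[OF complex_Re_le_cmod hC[OF n0(2)]]) (use d in \<open>simp add: w\<close>)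
      also have "\<dots> \<le> C * (d + d * v)" using C(1) nw by (intro mult_left_mono) auto
      finally show ?thesis by simp
    qed
    have 3: "Re (h n w) \<le> real n * (Re (g w) - Re (g (of_real (w0 + d)))) + real n * (Re (g (of_real (w0 + d))) - Re (g (of_real w0))) + C * (d + d * v)"
      using 3 by (simp add: right_diff_distrib)
    have 4: "Re (h n w) \<le> G0 + 2 * C + 1 / (4 * c) - v"
    proof (cases "d * v \<le> 1")
      case True
      have "real n * (- (d / 100) * (d * v)\<^sup>2) = - ((real n * d ^ 3) / 100 * v\<^sup>2)"
        by (simp add: power2_eq_square power3_eq_cube)
      also have "\<dots> = - (c * v\<^sup>2)" unfolding d_def dl_kk(2)[OF n0(1)] c_def ..
      also have "\<dots> \<le> 1 / (4 * c) - v"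
      proof -
        have "1 / (4 * c) - v + c * v\<^sup>2 = (2 * c * v - 1)\<^sup>2 / (4 * c)"
          using c by (simp add: field_simps power2_eq_square)
        also have "\<dots> \<ge> 0" using c by simp
        finally show ?thesis by linarith
      qed
      finally have "real n * (- (d / 100) * (d * v)\<^sup>2) \<le> 1 / (4 * c) - v" .
      moreover have "C * (d + d * v) \<le> C * 2" using C(1) d True by (intro mult_left_mono) auto
      moreover have "real n * (Re (g w) - Re (g (of_real (w0 + d)))) \<le> real n * (- (d / 100) * (d * v)\<^sup>2)"
        using 2 by (simp only: True if_True)
      ultimately show ?thesis using 1 3 by linarith
    next
      case False
      have "real n * (- (d / 100) * (d * v)) = - ((real n * d ^ 2) / 100 * v)"
        by (simp add: power2_eq_square)
      also have "\<dots> = - (kap ^ 2 / 100 * real n powr (1/3) * v)" unfolding d_def dl_kk(5)[OF n0(1)] by simp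
      also have "\<dots> \<le> - ((1 + C) * v)"
        using mult_right_mono[OF n2(2)[OF n0(3)] v] by simp
      finally have "real n * (- (d / 100) * (d * v)) \<le> - ((1 + C) * v)" .
      moreover have "C * (d + d * v) \<le> C * (1 + v)"
        using C(1) d v mult_right_mono[of d 1 v] by (intro mult_left_mono) auto
      moreover have "1 / (4 * c) \<ge> 0" using c by simp
      moreover have "real n * (Re (g w) - Re (g (of_real (w0 + d)))) \<le> real n * (- (d / 100) * (d * v))"
        using 2 by (simp only: False if_False)
      moreover have "C * (1 + v) = C + C * v" "(1 + C) * v = v + C * v" by (simp_all add: algebra_simps)
      ultimately show ?thesis using 1 3 C(1) by linarith
    qed
    have 5: "- Re ((of_nat n * w - s0 n) * of_real lam) \<le> \<Lambda>"
    proof -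
      have "of_nat n * w - s0 n = of_real (kk n) * Complex 1 v" by (simp add: sw[symmetric])
      then show ?thesis using lam by simp
    qed
    have "norm (Af n lam (s0 n + of_real (kk n) * Complex 1 v)) = exp (Re (h n w) - Re ((of_nat n * w - s0 n) * of_real lam))"
      unfolding sw Af_eq[OF wreg n0(1)] by simp
    also have "\<dots> \<le> exp ((G0 + 2 * C + 1 / (4 * c) - v) + \<Lambda>)"
      unfolding exp_le_cancel_iff using 4 5 by linarith
    also have "\<dots> = D * exp (- \<bar>v\<bar>)" using v by (simp add: D_def algebra_simps flip: exp_add)
    finally show ?thesis .
  qed
  show ?thesis
  proof (rule that[of "max n0 n2" D])
    fix n lam v assume n: "n \<ge> max n0 n2" and lam: "\<bar>kk n * lam\<bar> \<le> \<Lambda>"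
    show "norm (Af n lam (s0 n + of_real (kk n) * Complex 1 v)) \<le> D * exp (- \<bar>v\<bar>)"
    proof (cases "v \<ge> 0")
      case False
      have "cnj (s0 n + of_real (kk n) * Complex 1 (- v)) = s0 n + of_real (kk n) * Complex 1 v"
        using s0_real(1)[of n] by (simp add: complex_eq_iff)
      then have "Af n lam (s0 n + of_real (kk n) * Complex 1 v) = cnj (Af n lam (s0 n + of_real (kk n) * Complex 1 (- v)))"
        by (metis Af_cnj)
      then show ?thesis using main[OF n lam, of "- v"] False by simp
    qed (use main[OF n lam] in auto)
  qed (use C in auto)
qed

lemma Af_tendsto:
  assumes N: "filterlim N at_top sequentially" and lam: "(\<lambda>k. kk (N k) * lam k) \<longlonglongrightarrow> \<eta>" and z: "Re z \<ge> 0"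
  shows "(\<lambda>k. Af (N k) (lam k) (s0 (N k) + of_real (kk (N k)) * z)) \<longlonglongrightarrow> exp (z ^ 3 / 3 - of_real \<eta> * z)"
proof -
  obtain C n0 where C: "C \<ge> 0" "n0 > 0" and hC:
    "\<And>n w. n \<ge> n0 \<Longrightarrow> Re w \<ge> w0 \<Longrightarrow> norm (h n w - of_nat n * (g w - g (of_real w0))) \<le> C * norm (w - of_real w0)"
    using h_approx by metis
  define w where "w k = of_real w0 + of_real (dl (N k)) * z" for k
  have Nn: "\<forall>\<^sub>F k in sequentially. N k \<ge> n0"
    by (rule eventually_compose_filterlim[OF eventually_ge_at_top N])
  have dN: "(\<lambda>k. dl (N k)) \<longlonglongrightarrow> 0" by (rule filterlim_compose[OF dl_tendsto N])
  have err: "(\<lambda>k. h (N k) (w k) - of_nat (N k) * (g (w k) - g (of_real w0))) \<longlonglongrightarrow> 0"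
  proof (rule Lim_null_comparison)
    have "(\<lambda>k. C * norm (of_real (dl (N k)) * z)) \<longlonglongrightarrow> C * norm (of_real 0 * z)"
      by (intro tendsto_intros dN)
    then show "(\<lambda>k. C * norm (of_real (dl (N k)) * z)) \<longlonglongrightarrow> 0" by simp
    show "\<forall>\<^sub>F k in sequentially. norm (h (N k) (w k) - of_nat (N k) * (g (w k) - g (of_real w0))) \<le> C * norm (of_real (dl (N k)) * z)"
      using Nn
    proof eventually_elim
      case (elim k)
      have "dl (N k) > 0" using elim C by (intro dl_kk) auto
      then show ?case using hC[OF elim, of "w k"] z by (simp add: w_def)
    qed
  qed
  have "(\<lambda>k. (h (N k) (w k) - of_nat (N k) * (g (w k) - g (of_real w0))) + of_nat (N k) * (g (w k) - g (of_real w0)) - of_real (kk (N k) * lam k) * z)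
     \<longlonglongrightarrow> 0 + z ^ 3 / 3 - of_real \<eta> * z"
    unfolding w_def by (intro tendsto_intros err[unfolded w_def] g_scaled_tendsto N lam)
  then have "(\<lambda>k. exp (h (N k) (w k) - of_real (kk (N k) * lam k) * z)) \<longlonglongrightarrow> exp (z ^ 3 / 3 - of_real \<eta> * z)"
    by (intro tendsto_exp) simp
  then show ?thesis
  proof (rule Lim_transform_eventually)
    show "\<forall>\<^sub>F k in sequentially. exp (h (N k) (w k) - of_real (kk (N k) * lam k) * z) = Af (N k) (lam k) (s0 (N k) + of_real (kk (N k)) * z)"
      using Nn
    proof eventually_elim
      case (elim k)
      have n: "N k > 0" using elim C by simp
      have "dl (N k) > 0" using n by (rule dl_kk)
      then have "w k \<in> regular reg_angle reg_radius" using z by (intro regular_vertical) (simp add: w_def)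
      moreover have "s0 (N k) + of_real (kk (N k)) * z = of_nat (N k) * w k"
        using s0_plus[OF n] by (simp add: w_def)
      moreover from this have "of_nat (N k) * w k - s0 (N k) = of_real (kk (N k)) * z" by (simp add: algebra_simps)
      ultimately show ?case using Af_eq[of "w k" "N k" "lam k"] n by (simp add: mult_ac)
    qed
  qed
qed

section \<open>The t-integrand on the inclined sides\<close>

text \<open>The length, in Airy units, at which an inclined side reaches height \<open>n * e\<close>
  and meets the horizontal one.\<close>

definition rmax :: "nat \<Rightarrow> real" where "rmax n = sqrt 2 * e / dl n"

lemma cis_45: "cis (pi/4) = Complex (sqrt 2 / 2) (sqrt 2 / 2)" "cis (- (pi/4)) = Complex (sqrt 2 / 2) (- sqrt 2 / 2)"
  by (simp_all add: complex_eq_iff cos_45 sin_45)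

text \<open>The minus sign is the reflection \<open>w = - tau\<close>: the angle
  \<open>- (pi/4)\<close> parametrises the upper inclined side of the t-contour and
  \<open>pi/4\<close> the lower one.\<close>

abbreviation ray_pt :: "nat \<Rightarrow> real \<Rightarrow> real \<Rightarrow> complex" where
  "ray_pt n r \<theta> \<equiv> s0 n - of_real (kk n) * (of_real r * cis \<theta>)"

lemma ray_point:
  assumes "n > 0"
  shows "ray_pt n r (- (pi/4)) = of_nat n * Complex (w0 - dl n * r * (sqrt 2 / 2)) (dl n * r * (sqrt 2 / 2))"
proof -
  have "ray_pt n r (- (pi/4)) = s0 n + of_real (kk n) * (- (of_real r * cis (- (pi/4))))"
    by simp
  also have "\<dots> = of_nat n * (of_real w0 + of_real (dl n) * (- (of_real r * cis (- (pi/4)))))"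
    by (rule s0_plus[OF assms])
  also have "of_real w0 + of_real (dl n) * (- (of_real r * cis (- (pi/4)))) = Complex (w0 - dl n * r * (sqrt 2 / 2)) (dl n * r * (sqrt 2 / 2))"
    by (simp add: complex_eq_iff cis_45)
  finally show ?thesis .
qed

lemma ray_range:
  assumes "n > 0" "0 \<le> r" "r \<le> rmax n"
  shows "0 \<le> dl n * r * (sqrt 2 / 2)" "dl n * r * (sqrt 2 / 2) \<le> e"
proof -
  have d: "dl n > 0" using dl_kk(3)[OF assms(1)] .
  then show "0 \<le> dl n * r * (sqrt 2 / 2)" using assms by simp
  have "dl n * r * (sqrt 2 / 2) \<le> dl n * rmax n * (sqrt 2 / 2)"
    using d assms by (intro mult_right_mono mult_left_mono) auto
  also have "\<dots> = e" using d by (simp add: rmax_def)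
  finally show "dl n * r * (sqrt 2 / 2) \<le> e" .
qed

lemma ray_cnj: "ray_pt n r (pi/4) = cnj (ray_pt n r (- (pi/4)))"
  using s0_real(1)[of n] by (simp add: cis_cnj)

text \<open>In Airy units the cubic growth of the phase becomes \<open>c * r ^ 3\<close> with
  \<open>c\<close> independent of \<open>n\<close>. It dominates both the bounded approximation
  error and the linear term \<open>\<Lambda> * r\<close> that comes from displacing the argument of
  the kernel.\<close>

lemma Bf_ray_bound:
  obtains C n1 where "n1 > 0" "\<And>n lam r \<theta>. n \<ge> n1 \<Longrightarrow> \<bar>kk n * lam\<bar> \<le> \<Lambda> \<Longrightarrow> 0 \<le> r \<Longrightarrow> r \<le> rmax n \<Longrightarrow> \<theta> = pi/4 \<or> \<theta> = - (pi/4) \<Longrightarrow>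
    norm (Bf n lam (ray_pt n r \<theta>)) \<le> C * exp (- r)"
proof -
  obtain C n0 where C: "C \<ge> 0" "n0 > 0" and hC: "\<And>n a. n \<ge> n0 \<Longrightarrow> 0 \<le> a \<Longrightarrow> a \<le> e \<Longrightarrow>
      norm (h n (Complex (w0 - a) a) - of_nat n * (g (Complex (w0 - a) a) - g (of_real w0))) \<le> C * a"
    using h_approx by metis
  define c where "c = kap ^ 3 * (sqrt 2 / 2) ^ 3 / 3456"
  have c: "c > 0" using kap_pos by (simp add: c_def)
  define D where "D = exp C * exp (c + (\<Lambda> + 2)\<^sup>2 / (4 * c))"
  have main: "norm (Bf n lam (ray_pt n r (- (pi/4)))) \<le> D * exp (- r)"
    if n: "n \<ge> n0" and lam: "\<bar>kk n * lam\<bar> \<le> \<Lambda>" and r: "0 \<le> r" "r \<le> rmax n" for n lam r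
  proof -
    have n0: "n > 0" using n C(2) by simp
    define a where "a = dl n * r * (sqrt 2 / 2)"
    have a: "0 \<le> a" "a \<le> e" using ray_range[OF n0 r] by (auto simp: a_def)
    define w where "w = Complex (w0 - a) a"
    have wreg: "w \<in> regular reg_angle reg_radius" unfolding w_def by (rule regular_ray[OF a])
    have tw: "ray_pt n r (- (pi/4)) = of_nat n * w"
      using ray_point[OF n0] by (simp add: w_def a_def)
    have "Re (of_nat n * (g w - g (of_real w0)) - h n w) \<le> C * a"
      using order_trans[OF complex_Re_le_cmod[of "of_nat n * (g w - g (of_real w0)) - h n w"]] hC[OF n a]
      by (simp add: w_def norm_minus_commute)
    moreover have "C * a \<le> C * 1" using C(1) a e_bounds by (intro mult_left_mono) auto
    moreover have "real n * (a ^ 3 / 3456) \<le> real n * (Re (g w) - Re (g (of_real w0)))"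
      unfolding w_def by (intro mult_left_mono Re_g_ray a) auto
    moreover have "real n * (a ^ 3 / 3456) = c * r ^ 3"
    proof -
      have "real n * (a ^ 3 / 3456) = (real n * dl n ^ 3) * (sqrt 2 / 2) ^ 3 / 3456 * r ^ 3"
        unfolding a_def by (simp only: power_mult_distrib) (simp add: mult_ac)
      then show ?thesis unfolding dl_kk(2)[OF n0] c_def .
    qed
    ultimately have 1: "- Re (h n w) \<le> C - c * r ^ 3" by simp
    have 2: "Re ((of_nat n * w - s0 n) * of_real lam) \<le> \<Lambda> * r"
    proof -
      have ee: "of_nat n * w - s0 n = - (of_real (kk n) * (of_real r * cis (- (pi/4))))"
        by (simp add: tw[symmetric])
      have "Re ((of_nat n * w - s0 n) * of_real lam) = - (kk n * lam) * (r * (sqrt 2 / 2))"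
        unfolding ee by (simp add: cis_45)
      also have "\<dots> \<le> \<bar>kk n * lam\<bar> * (r * (sqrt 2 / 2))" using r by (intro mult_right_mono) auto
      also have "\<dots> \<le> \<Lambda> * (r * 1)"
        using r lam sqrt2_less_2 by (intro mult_mono) auto
      finally show ?thesis by simp
    qed
    have "norm (Bf n lam (of_nat n * w)) = exp (- Re (h n w) + Re ((of_nat n * w - s0 n) * of_real lam))"
      unfolding Bf_eq[OF wreg n0] by simp
    also have "\<dots> \<le> exp (C + (\<Lambda> * r - c * r ^ 3))" using 1 2 by simp
    also have "\<dots> = exp C * exp (\<Lambda> * r - c * r ^ 3)" by (rule exp_add)
    also have "\<dots> \<le> exp C * (exp (c + (\<Lambda> + 2)\<^sup>2 / (4 * c)) * exp (- r))"
      using c r by (intro mult_left_mono exp_cubic_le) auto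
    finally show ?thesis by (simp add: tw D_def)
  qed
  show ?thesis
  proof (rule that[of n0 D])
    fix n lam r \<theta> assume *: "n \<ge> n0" "\<bar>kk n * lam\<bar> \<le> \<Lambda>" "0 \<le> r" "r \<le> rmax n" and \<theta>: "\<theta> = pi/4 \<or> \<theta> = - (pi/4)"
    show "norm (Bf n lam (ray_pt n r \<theta>)) \<le> D * exp (- r)"
      using \<theta>
    proof
      assume "\<theta> = pi/4"
      then have "Bf n lam (ray_pt n r \<theta>) = cnj (Bf n lam (ray_pt n r (- (pi/4))))"
        by (simp only: ray_cnj Bf_cnj)
      then show ?thesis using main[OF *] by (simp only: complex_mod_cnj)
    next
      assume "\<theta> = - (pi/4)"
      then show ?thesis using main[OF *] by (simp only:)
    qed
  qed (use C in auto)
qed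

lemma Bf_tendsto:
  assumes N: "filterlim N at_top sequentially" and lam: "(\<lambda>k. kk (N k) * lam k) \<longlonglongrightarrow> \<xi>" and r: "r \<ge> 0"
    and \<theta>: "\<theta> = pi/4 \<or> \<theta> = - (pi/4)"
  shows "(\<lambda>k. Bf (N k) (lam k) (ray_pt (N k) r \<theta>)) \<longlonglongrightarrow>
    airy_exp (of_real \<xi>) (of_real r * cis \<theta>)"
proof -
  obtain C n0 where C: "C \<ge> 0" "n0 > 0" and hC: "\<And>n a. n \<ge> n0 \<Longrightarrow> 0 \<le> a \<Longrightarrow> a \<le> e \<Longrightarrow>
      norm (h n (Complex (w0 - a) a) - of_nat n * (g (Complex (w0 - a) a) - g (of_real w0))) \<le> C * a"
    using h_approx by metis
  define z where "z = - (of_real r * cis (- (pi/4)))"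
  define a where "a k = dl (N k) * r * (sqrt 2 / 2)" for k
  define w where "w k = Complex (w0 - a k) (a k)" for k
  have w: "w k = of_real w0 + of_real (dl (N k)) * z" for k
    by (simp add: w_def a_def z_def complex_eq_iff cis_45)
  have dN: "(\<lambda>k. dl (N k)) \<longlonglongrightarrow> 0" by (rule filterlim_compose[OF dl_tendsto N])
  have a0: "a \<longlonglongrightarrow> 0"
    unfolding a_def using tendsto_mult_left_zero[OF tendsto_mult_left_zero[OF dN, of r], of "sqrt 2 / 2"] by simp
  have Nn: "\<forall>\<^sub>F k in sequentially. N k \<ge> n0"
    by (rule eventually_compose_filterlim[OF eventually_ge_at_top N])
  have "\<forall>\<^sub>F k in sequentially. a k < e" using e_bounds by (intro order_tendstoD(2)[OF a0]) auto
  with Nn have ev: "\<forall>\<^sub>F k in sequentially. N k \<ge> n0 \<and> 0 \<le> a k \<and> a k \<le> e \<and> N k > 0"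
  proof eventually_elim
    case (elim k)
    then have "dl (N k) > 0" using C by (intro dl_kk) auto
    then show ?case using elim r C by (auto simp: a_def)
  qed
  have err: "(\<lambda>k. h (N k) (w k) - of_nat (N k) * (g (w k) - g (of_real w0))) \<longlonglongrightarrow> 0"
  proof (rule Lim_null_comparison)
    show "(\<lambda>k. C * a k) \<longlonglongrightarrow> 0" using tendsto_mult_right_zero[OF a0] .
    show "\<forall>\<^sub>F k in sequentially. norm (h (N k) (w k) - of_nat (N k) * (g (w k) - g (of_real w0))) \<le> C * a k"
      using ev by eventually_elim (auto simp: w_def intro!: hC)
  qed
  have "(\<lambda>k. - ((h (N k) (w k) - of_nat (N k) * (g (w k) - g (of_real w0))) + of_nat (N k) * (g (w k) - g (of_real w0))) + of_real (kk (N k) * lam k) * z)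
     \<longlonglongrightarrow> - (0 + z ^ 3 / 3) + of_real \<xi> * z"
    unfolding w by (intro tendsto_intros err[unfolded w] g_scaled_tendsto N lam)
  then have "(\<lambda>k. exp (- h (N k) (w k) + of_real (kk (N k) * lam k) * z)) \<longlonglongrightarrow> exp (- (z ^ 3 / 3) + of_real \<xi> * z)"
    by (intro tendsto_exp) simp
  then have main: "(\<lambda>k. Bf (N k) (lam k) (ray_pt (N k) r (- (pi/4)))) \<longlonglongrightarrow> exp (- (z ^ 3 / 3) + of_real \<xi> * z)"
  proof (rule Lim_transform_eventually)
    show "\<forall>\<^sub>F k in sequentially. exp (- h (N k) (w k) + of_real (kk (N k) * lam k) * z) = Bf (N k) (lam k) (ray_pt (N k) r (- (pi/4)))"
      using ev
    proof eventually_elim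
      case (elim k)
      then have n: "N k > 0" by simp
      have "w k \<in> regular reg_angle reg_radius" unfolding w_def using elim by (intro regular_ray) auto
      moreover have tw: "ray_pt (N k) r (- (pi/4)) = of_nat (N k) * w k"
        using ray_point[OF n, of r] by (simp add: w_def a_def)
      moreover from this have "of_nat (N k) * w k - s0 (N k) = of_real (kk (N k)) * z" by (simp add: algebra_simps z_def)
      ultimately show ?case using Bf_eq[of "w k" "N k" "lam k"] n unfolding tw by (simp add: mult_ac)
    qed
  qed
  have zeq: "- (z ^ 3 / 3) + of_real \<xi> * z = (of_real r * cis (- (pi/4))) ^ 3 / 3 - of_real \<xi> * (of_real r * cis (- (pi/4)))"
    by (simp add: z_def power3_eq_cube)
  show ?thesis
    using \<theta>
  proof
    assume \<theta>: "\<theta> = - (pi/4)"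
    show ?thesis using main unfolding zeq \<theta> .
  next
    assume \<theta>: "\<theta> = pi/4"
    have "cnj (airy_exp (of_real \<xi>) (of_real r * cis (- (pi/4)))) = airy_exp (of_real \<xi>) (of_real r * cis (pi/4))"
      by (simp add: exp_cnj cis_cnj)
    then show ?thesis
      using tendsto_cnj[OF main[unfolded zeq]] unfolding \<theta> ray_cnj Bf_cnj by simp
  qed
qed

section \<open>The t-integrand on the remaining sides\<close>

text \<open>The phase on the horizontal side exceeds its critical value by at least
  \<open>e ^ 3 / 3456\<close>, which makes the reciprocal of \<open>F\<close> exponentially small in
  \<open>n\<close>. The displacement \<open>lam\<close> is of order n^(-2/3) and is multiplied by a
  distance of at most \<open>3 * n\<close>, so it costs only an exponential of order
  n^(1/3).\<close>

lemma Bf_top_bound: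
  obtains C n0 where "n0 > 0" "\<And>n lam u. n \<ge> n0 \<Longrightarrow> \<bar>kk n * lam\<bar> \<le> \<Lambda> \<Longrightarrow> -1/2 \<le> u \<Longrightarrow> u \<le> real n \<Longrightarrow>
    norm (Bf n lam (Complex u (real n * e))) \<le> exp (C + 3 * \<Lambda> / kap * real n powr (1/3) - e ^ 3 / 3456 * real n)"
proof -
  obtain C n0 where C: "C \<ge> 0" "n0 > 0" and hC: "\<And>n u. n \<ge> n0 \<Longrightarrow> -1 \<le> u \<Longrightarrow> u \<le> 1 \<Longrightarrow>
      norm (h n (Complex u e) - of_nat n * (g (Complex u e) - g (of_real w0))) \<le> C"
    using h_approx by metis
  show ?thesis
  proof (rule that[of n0 C])
    fix n lam u assume n: "n \<ge> n0" and lam: "\<bar>kk n * lam\<bar> \<le> \<Lambda>" and u: "-1/2 \<le> u" "u \<le> real n"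
    have n0: "n > 0" "real n \<ge> 1" using n C(2) by auto
    have u': "-1 \<le> u / real n" "u / real n \<le> 1" using u n0 by (auto simp: field_simps)
    define w where "w = Complex (u / real n) e"
    have wreg: "w \<in> regular reg_angle reg_radius" unfolding w_def by (rule regular_horizontal[OF u'])
    have tw: "Complex u (real n * e) = of_nat n * w" using n0 by (simp add: w_def complex_eq_iff)
    have "Re (of_nat n * (g w - g (of_real w0)) - h n w) \<le> C"
      using order_trans[OF complex_Re_le_cmod[of "of_nat n * (g w - g (of_real w0)) - h n w"]] hC[OF n u']
      by (simp add: w_def norm_minus_commute)
    moreover have "e ^ 3 / 3456 \<le> Re (g w) - Re (g (of_real w0))"
    proof -
      have "Complex (w0 - e) e = Complex 1 e" by (simp add: w0_def)
      then show ?thesis using Re_g_horizontal[OF u'] Re_g_ray[of e] e_bounds by (simp add: w_def)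
    qed
    then have "real n * (e ^ 3 / 3456) \<le> real n * (Re (g w) - Re (g (of_real w0)))"
      by (intro mult_left_mono) auto
    ultimately have 1: "- Re (h n w) \<le> C - e ^ 3 / 3456 * real n" by (simp add: mult.commute)
    have 2: "Re ((of_nat n * w - s0 n) * of_real lam) \<le> 3 * \<Lambda> / kap * real n powr (1/3)"
    proof -
      have "Re ((of_nat n * w - s0 n) * of_real lam) = (u - real n * w0) * lam"
        by (simp add: tw[symmetric] s0_real)
      also have "\<dots> \<le> \<bar>u - real n * w0\<bar> * \<bar>lam\<bar>" by (simp flip: abs_mult)
      also have "\<dots> \<le> (3 * real n) * \<bar>lam\<bar>"
      proof (intro mult_right_mono)
        have "real n * 1 \<le> real n * w0" "real n * w0 \<le> real n * 2"
          by (rule mult_left_mono; use e_bounds in simp)+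
        then show "\<bar>u - real n * w0\<bar> \<le> 3 * real n" using u n0 by (intro abs_leI) linarith+
      qed auto
      also have "\<dots> = 3 * (real n / kk n) * \<bar>kk n * lam\<bar>" using dl_kk(4)[OF n0(1)] by (simp add: abs_mult)
      also have "\<dots> \<le> 3 * (real n / kk n) * \<Lambda>" using dl_kk(4)[OF n0(1)] lam by (intro mult_left_mono) auto
      also have "real n / kk n = real n powr (1/3) / kap"
      proof -
        have "real n = real n powr (1/3) * real n powr (2/3)" using n0 by (simp flip: powr_add)
        then have "real n / kk n = (real n powr (1/3) * real n powr (2/3)) / (kap * real n powr (2/3))" by (simp add: kk_def)
        then show ?thesis using n0 by simp
      qed
      finally show ?thesis by (simp add: mult_ac)
    qed
    have "norm (Bf n lam (Complex u (real n * e))) = exp (- Re (h n w) + Re ((of_nat n * w - s0 n) * of_real lam))"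
      unfolding tw Bf_eq[OF wreg n0(1)] by simp
    also have "\<dots> \<le> exp (C + 3 * \<Lambda> / kap * real n powr (1/3) - e ^ 3 / 3456 * real n)" using 1 2 by simp
    finally show "norm (Bf n lam (Complex u (real n * e))) \<le> exp (C + 3 * \<Lambda> / kap * real n powr (1/3) - e ^ 3 / 3456 * real n)" .
  qed (use C in auto)
qed

text \<open>At real part -1/2, reflection in the imaginary axis turns the moduli of the polynomial
  factors into those of a \<open>pochhammer\<close> symbol at 1/2 + i v. Its Gamma denominator
  cancels against the Gamma factor with index 1, up to a \<open>pochhammer\<close> symbol of fixed
  length \<open>\<nu> 1\<close>. All Gamma factors left have positive real part, so their moduli are
  monotone in the imaginary direction.\<close>

lemma norm_F_left:
  assumes nu0: "\<nu> 0 = 0"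
  shows "norm (F n (Complex (-1/2) v)) =
    norm (Gamma (Complex (real n + 1/2) v)) * norm (pochhammer (Complex (1/2) v) (\<nu> 1)) * (\<Prod>j=2..M. norm (Gamma (Complex (1/2 + real (\<nu> j)) v)))"
proof -
  let ?t = "Complex (-1/2) v"
  have np: "Complex (1/2) v \<notin> \<int>\<^sub>\<le>\<^sub>0" by (auto simp: complex_eq_iff elim!: nonpos_Ints_cases)
  have G0: "Gamma (Complex (1/2) v) \<noteq> 0" using np by (simp add: Gamma_eq_zero_iff)
  have sh: "?t + of_nat m + 1 = Complex (1/2 + real m) v" "Complex (1/2) v + of_nat m = Complex (1/2 + real m) v" for m
    by (simp_all add: complex_eq_iff)
  have "?t \<noteq> of_nat k" for k by (simp add: complex_eq_iff)
  then have "F n ?t = (\<Prod>k<n. ?t - of_nat k) * gamma_prod ?t"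
    by (intro F_eq[OF nu0 not_pole]) auto
  moreover have "norm (\<Prod>k<n. ?t - of_nat k) = norm (Gamma (Complex (real n + 1/2) v)) / norm (Gamma (Complex (1/2) v))"
  proof -
    have "norm (\<Prod>k<n. ?t - of_nat k) = (\<Prod>k<n. norm (Complex (1/2) v + of_nat k))"
      unfolding prod_norm[symmetric]
    proof (rule prod.cong)
      fix k
      have "(- 1/2 - real k)\<^sup>2 = (1/2 + real k)\<^sup>2" by (simp add: power2_eq_square algebra_simps)
      then show "norm (?t - of_nat k) = norm (Complex (1/2) v + of_nat k)" by (simp add: cmod_def)
    qed simp
    also have "\<dots> = norm (pochhammer (Complex (1/2) v) n)" by (simp add: pochhammer_prod prod_norm atLeast0LessThan)
    also have "\<dots> = norm (Gamma (Complex (real n + 1/2) v)) / norm (Gamma (Complex (1/2) v))"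
      using pochhammer_Gamma[OF np, of n] unfolding sh by (simp add: norm_divide add.commute[of "1/2"])
    finally show ?thesis .
  qed
  moreover have "norm (gamma_prod ?t) = norm (Gamma (Complex (1/2) v)) * norm (pochhammer (Complex (1/2) v) (\<nu> 1)) * (\<Prod>j=2..M. norm (Gamma (Complex (1/2 + real (\<nu> j)) v)))"
  proof -
    have "gamma_prod ?t = Gamma (Complex (1/2 + real (\<nu> 1)) v) * (\<Prod>j=2..M. Gamma (Complex (1/2 + real (\<nu> j)) v))"
      unfolding gamma_prod_def sh using M1 by (subst prod.atLeast_Suc_atMost) (auto simp: numeral_2_eq_2)
    moreover have "Gamma (Complex (1/2 + real (\<nu> 1)) v) = pochhammer (Complex (1/2) v) (\<nu> 1) * Gamma (Complex (1/2) v)"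
      using pochhammer_Gamma[OF np, of "\<nu> 1"] G0 by (simp add: sh)
    ultimately show ?thesis by (simp add: norm_mult prod_norm mult_ac)
  qed
  ultimately show ?thesis using G0 by (simp add: norm_mult)
qed

text \<open>The Gamma factors decrease as the imaginary part grows to \<open>V\<close>. Only the
  \<open>pochhammer\<close> factor may increase; at \<open>v\<close> it is at least
  \<open>(1/2) ^ \<nu> 1\<close>, and the comparison costs a polynomial in \<open>V\<close>.\<close>

lemma norm_F_left_le:
  assumes nu0: "\<nu> 0 = 0" and v: "\<bar>v\<bar> \<le> V"
  shows "norm (F n (Complex (-1/2) V)) \<le> (1 + 2 * real (\<nu> 1) + 2 * V) ^ \<nu> 1 * norm (F n (Complex (-1/2) v))"
proof -
  define m where "m = \<nu> 1"
  have G: "norm (Gamma (Complex a V)) \<le> norm (Gamma (Complex a v))" if "a > 0" for a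
    using that v by (intro norm_Gamma_antimono_Im) auto
  have p1: "norm (pochhammer (Complex (1/2) V) m) \<le> (1/2 + real m + V) ^ m"
  proof -
    have "norm (Complex (1/2) V + of_nat k) \<le> 1/2 + real m + V" if "k < m" for k
      using cmod_le[of "Complex (1/2) V + of_nat k"] that v by simp
    then have "(\<Prod>k<m. norm (Complex (1/2) V + of_nat k)) \<le> (\<Prod>k<m. 1/2 + real m + V)"
      by (intro prod_mono) auto
    then show ?thesis by (simp add: pochhammer_prod prod_norm atLeast0LessThan)
  qed
  have p2: "(1/2) ^ m \<le> norm (pochhammer (Complex (1/2) v) m)"
  proof -
    have "1/2 \<le> norm (Complex (1/2) v + of_nat k)" for k
      using complex_Re_le_cmod[of "Complex (1/2) v + of_nat k"] by simp
    then have "(\<Prod>k<m. 1/2) \<le> (\<Prod>k<m. norm (Complex (1/2) v + of_nat k))"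
      by (intro prod_mono) auto
    then show ?thesis by (simp add: pochhammer_prod prod_norm atLeast0LessThan)
  qed
  have "(1/2 + real m + V) ^ m = (1 + 2 * real m + 2 * V) ^ m * (1/2) ^ m"
    by (simp add: field_simps flip: power_mult_distrib)
  also have "\<dots> \<le> (1 + 2 * real m + 2 * V) ^ m * norm (pochhammer (Complex (1/2) v) m)"
    using p2 v by (intro mult_left_mono) auto
  finally have p: "norm (pochhammer (Complex (1/2) V) m) \<le> (1 + 2 * real m + 2 * V) ^ m * norm (pochhammer (Complex (1/2) v) m)"
    using p1 by linarith
  have "norm (F n (Complex (-1/2) V)) \<le> norm (Gamma (Complex (real n + 1/2) v)) * ((1 + 2 * real m + 2 * V) ^ m * norm (pochhammer (Complex (1/2) v) m)) * (\<Prod>j=2..M. norm (Gamma (Complex (1/2 + real (\<nu> j)) v)))"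
    unfolding norm_F_left[OF nu0] m_def[symmetric]
    using v by (intro mult_mono prod_mono G p mult_nonneg_nonneg prod_nonneg) (auto simp: G)
  then show ?thesis unfolding norm_F_left[OF nu0] m_def[symmetric] by (simp add: mult_ac)
qed

text \<open>The horizontal sides are covered by the exponential bound. The left side runs outside
  the regular set and is compared with its upper corner, where the exponential smallness absorbs the
  polynomial loss. The bound \<open>1 / n\<close> is far from sharp, but suffices because the sides
  are no longer than \<open>2 * n\<close> and stay at distance \<open>n * e\<close> from
  \<open>s\<close>.\<close>

lemma Bf_rest_bound:
  assumes nu0: "\<nu> 0 = 0" and "\<Lambda> \<ge> 0"
  obtains n1 where "n1 > 0"
    "\<And>n lam u. n \<ge> n1 \<Longrightarrow> \<bar>kk n * lam\<bar> \<le> \<Lambda> \<Longrightarrow> -1/2 \<le> u \<Longrightarrow> u \<le> real n \<Longrightarrow> norm (Bf n lam (Complex u (real n * e))) \<le> 1 / real n"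
    "\<And>n lam u. n \<ge> n1 \<Longrightarrow> \<bar>kk n * lam\<bar> \<le> \<Lambda> \<Longrightarrow> -1/2 \<le> u \<Longrightarrow> u \<le> real n \<Longrightarrow> norm (Bf n lam (Complex u (- (real n * e)))) \<le> 1 / real n"
    "\<And>n lam v. n \<ge> n1 \<Longrightarrow> \<bar>kk n * lam\<bar> \<le> \<Lambda> \<Longrightarrow> \<bar>v\<bar> \<le> real n * e \<Longrightarrow> norm (Bf n lam (Complex (-1/2) v)) \<le> 1 / real n"
proof -
  obtain C n0 where n0: "n0 > 0" and top: "\<And>n lam u. n \<ge> n0 \<Longrightarrow> \<bar>kk n * lam\<bar> \<le> \<Lambda> \<Longrightarrow> -1/2 \<le> u \<Longrightarrow> u \<le> real n \<Longrightarrow>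
    norm (Bf n lam (Complex u (real n * e))) \<le> exp (C + 3 * \<Lambda> / kap * real n powr (1/3) - e ^ 3 / 3456 * real n)"
    by (rule Bf_top_bound[of \<Lambda>]) blast
  define D c m where "D = 3 * \<Lambda> / kap" and "c = e ^ 3 / 3456" and "m = \<nu> 1"
  have c: "c > 0" using e_bounds by (simp add: c_def)
  define E where "E n = exp (C + D * real n powr (1/3) - c * real n)" for n
  define P where "P n = (1 + 2 * real m + 2 * (real n * e)) ^ m" for n
  have "(\<lambda>n. real n * ((1 + 2 * real m + 2 * (real n * e)) powr real m * exp (C + D * real n powr (1/3) - c * real n))) \<longlonglongrightarrow> 0"
    using c e_bounds(1) by real_asymp
  moreover have P: "P n \<ge> 1" "P n = (1 + 2 * real m + 2 * (real n * e)) powr real m" for n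
  proof -
    have "0 \<le> real n * e" using e_bounds by simp
    then have "1 + 2 * real m + 2 * (real n * e) > 0" "1 \<le> 1 + 2 * real m + 2 * (real n * e)"
      using of_nat_0_le_iff[of m] by linarith+
    then show "P n \<ge> 1" "P n = (1 + 2 * real m + 2 * (real n * e)) powr real m"
      by (auto simp: P_def powr_realpow one_le_power)
  qed
  ultimately have "(\<lambda>n. real n * (P n * E n)) \<longlonglongrightarrow> 0" by (simp add: E_def)
  then have "\<forall>\<^sub>F n in sequentially. real n * (P n * E n) < 1" by (rule order_tendstoD) simp
  then obtain n2 where n2: "\<And>n. n \<ge> n2 \<Longrightarrow> real n * (P n * E n) < 1" unfolding eventually_sequentially by blast
  define n1 where "n1 = max n0 n2"
  have PE: "P n * E n \<le> 1 / real n" "E n \<le> 1 / real n" if "n \<ge> n1" for n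
  proof -
    have n: "real n > 0" "n \<ge> n2" using that n0 by (auto simp: n1_def)
    then show 1: "P n * E n \<le> 1 / real n" using n2[OF n(2)] by (simp add: field_simps)
    have "1 * E n \<le> P n * E n" by (intro mult_right_mono P) (simp add: E_def)
    then show "E n \<le> 1 / real n" using 1 by simp
  qed
  have t: "norm (Bf n lam (Complex u (real n * e))) \<le> E n" if "n \<ge> n1" "\<bar>kk n * lam\<bar> \<le> \<Lambda>" "-1/2 \<le> u" "u \<le> real n" for n lam u
    using top[of n lam u] that by (simp add: E_def D_def c_def n1_def)
  have cc: "Complex u (- y) = cnj (Complex u y)" for u y by (simp add: complex_eq_iff)
  show ?thesis
  proof (rule that[of n1])
    show "n1 > 0" using n0 by (simp add: n1_def)
    show *: "norm (Bf n lam (Complex u (real n * e))) \<le> 1 / real n" if "n \<ge> n1" "\<bar>kk n * lam\<bar> \<le> \<Lambda>" "-1/2 \<le> u" "u \<le> real n" for n lam u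
      using t[OF that] PE(2)[OF that(1)] by linarith
    show "norm (Bf n lam (Complex u (- (real n * e)))) \<le> 1 / real n" if "n \<ge> n1" "\<bar>kk n * lam\<bar> \<le> \<Lambda>" "-1/2 \<le> u" "u \<le> real n" for n lam u
      unfolding cc Bf_cnj using *[OF that] by simp
    show "norm (Bf n lam (Complex (-1/2) v)) \<le> 1 / real n" if n: "n \<ge> n1" and lam: "\<bar>kk n * lam\<bar> \<le> \<Lambda>" and v: "\<bar>v\<bar> \<le> real n * e" for n lam v
    proof -
      have nn: "n > 0" using n n0 by (simp add: n1_def)
      have reg: "Complex (- 1 / 2 / real n) e \<in> regular reg_angle reg_radius"
        using nn by (intro regular_horizontal) (auto simp: field_simps)
      have "of_nat n * Complex (- 1 / 2 / real n) e = Complex (-1/2) (real n * e)"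
        using nn by (simp add: complex_eq_iff)
      then have FV: "F n (Complex (-1/2) (real n * e)) \<noteq> 0" using F_ratio(3)[OF reg nn] by simp
      have le: "norm (F n (Complex (-1/2) (real n * e))) \<le> P n * norm (F n (Complex (-1/2) v))"
        using norm_F_left_le[OF nu0 v] by (simp add: P_def m_def)
      then have Fv: "F n (Complex (-1/2) v) \<noteq> 0" using FV by auto
      \<comment> \<open>On the left side the modulus of the exponential factor is constant, so
        values of \<open>Bf\<close> compare exactly as those of the reciprocal of
        \<open>F\<close>.\<close>
      let ?X = "norm (F n (s0 n)) * exp ((- 1/2 - real n * w0) * (lX n + lam))"
      have B: "norm (Bf n lam (Complex (-1/2) v)) = ?X / norm (F n (Complex (-1/2) v))" for v
        by (simp add: Bf_def norm_mult norm_divide s0_real)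
      have "norm (Bf n lam (Complex (-1/2) v)) \<le> P n * norm (Bf n lam (Complex (-1/2) (real n * e)))"
      proof -
        have "?X * norm (F n (Complex (-1/2) (real n * e))) \<le> ?X * (P n * norm (F n (Complex (-1/2) v)))"
          using le by (intro mult_left_mono) auto
        then show ?thesis unfolding B using FV Fv by (simp add: field_simps)
      qed
      also have "\<dots> \<le> P n * E n"
        using t[OF n lam, of "-1/2"] order_trans[OF zero_le_one P(1)[of n]] by (intro mult_left_mono) auto
      finally show ?thesis using PE(1)[OF n] by linarith
    qed
  qed
qed

end

section \<open>Convergence of the kernel\<close>

lemma contour_integral_linepath_ray:
  assumes "R \<ge> 0" "continuous_on {0..R} (\<lambda>r. f (a + of_real r * d))"
  shows "contour_integral (linepath a (a + of_real R * d)) f = (LINT r:{0..R}|lborel. d * f (a + of_real r * d))"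
proof (cases "R = 0")
  case True
  have "(LINT r:{0..0}|lborel. d * f (a + of_real r * d)) = 0"
    unfolding set_lebesgue_integral_def
    by (rule integral_eq_zero_AE, rule AE_mp[OF AE_lborel_singleton[of 0]]) (auto intro!: AE_I2 simp: indicator_def)
  then show ?thesis using True by simp
next
  case False
  then have R: "R > 0" using assms by simp
  have cont: "continuous_on {0..R} (\<lambda>r. d * f (a + of_real r * d))"
    using assms(2) by (intro continuous_intros)
  have int: "set_integrable lborel {0..R} (\<lambda>r. d * f (a + of_real r * d))"
    using borel_integrable_atLeastAtMost'[OF cont] .
  let ?I = "LINT r:{0..R}|lborel. d * f (a + of_real r * d)"
  have "((\<lambda>r. d * f (a + of_real r * d)) has_integral ?I) (cbox 0 R)"
    using set_borel_integral_eq_integral[OF int] by (metis box_real(2) integrable_integral)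
  from has_integral_affinity'[OF this R, of 0]
  have "((\<lambda>x. d * f (a + of_real (R * x) * d)) has_integral ?I /\<^sub>R R) {0..1}"
    using R by simp
  from has_integral_mult_right[OF this, of "of_real R"]
  have "((\<lambda>x. of_real R * (d * f (a + of_real (R * x) * d))) has_integral of_real R * (?I /\<^sub>R R)) {0..1}" .
  moreover have "of_real R * (?I /\<^sub>R R) = ?I" using R by (simp add: scaleR_conv_of_real)
  ultimately have "((\<lambda>x. of_real R * (d * f (a + of_real (R * x) * d))) has_integral ?I) {0..1}"
    by (simp only:)
  moreover have "of_real R * (d * f (a + of_real (R * x) * d)) = f (a + of_real (R * x) * d) * (of_real R * d)" for x
    by (simp add: mult_ac)
  ultimately have "((\<lambda>x. f (a + of_real (R * x) * d) * (of_real R * d)) has_integral ?I) {0..1}"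
    by (simp only:)
  moreover have "linepath a (a + of_real R * d) x = a + of_real (R * x) * d" for x
    by (simp add: linepath_def scaleR_conv_of_real algebra_simps)
  ultimately have "(f has_contour_integral ?I) (linepath a (a + of_real R * d))"
    unfolding has_contour_integral_linepath by simp
  then show ?thesis by (rule contour_integral_unique)
qed

text \<open>If \<open>f\<close> is not integrable along the segment, its contour integral has the
  default value 0 and the bound still holds.\<close>

lemma norm_contour_integral_linepath_le:
  assumes "0 \<le> B" "\<And>x. x \<in> closed_segment a b \<Longrightarrow> norm (f x) \<le> B" "norm (b - a) \<le> L"
  shows "norm (contour_integral (linepath a b) f) \<le> B * L"
proof (cases "f contour_integrable_on (linepath a b)")
  case True
  then have "norm (contour_integral (linepath a b) f) \<le> B * norm (b - a)"
    using assms by (intro contour_integral_bound_linepath) auto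
  also have "\<dots> \<le> B * L" using assms by (intro mult_left_mono) auto
  finally show ?thesis .
next
  case False
  have "0 \<le> L" using order_trans[OF norm_ge_zero assms(3)] .
  then show ?thesis using False assms(1) by (simp add: not_integrable_contour_integral)
qed

lemma divide_2pi_le: "x / (2 * pi) \<le> x" if "x \<ge> 0" for x :: real
proof -
  have "x / (2 * pi) \<le> x / 1"
    by (rule divide_left_mono) (use pi_gt3 that in auto)
  then show ?thesis by simp
qed

lemma contour_integral_cmult: "contour_integral p (\<lambda>t. c * f t) = c * contour_integral p f"
  unfolding contour_integral_integral by (simp add: mult.assoc)

context ginibre_product
begin

lemma pentagon_cmult: "pentagon c r V (\<lambda>t. k * f t) = k * pentagon c r V f"
  by (simp only: pentagon_def contour_integral_cmult distrib_left)

lemma regular_cnj: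
  assumes "w \<in> regular \<delta> c"
  shows "cnj w \<in> regular \<delta> c"
proof -
  have "norm (cnj z + of_real x) = norm (z + of_real x)" for z x
    by (metis complex_cnj_add complex_cnj_complex_of_real complex_mod_cnj)
  then have s: "in_sector \<delta> (cnj z) \<longleftrightarrow> in_sector \<delta> z" for z
    by (simp add: in_sector_def)
  have "cnj w - 1 = cnj (w - 1)" by simp
  then show ?thesis using assms unfolding regular_def by (simp only: mem_Collect_eq s complex_mod_cnj)
qed

lemma isCont_F:
  assumes "w \<in> regular reg_angle reg_radius" "n > 0"
  shows "isCont (F n) (of_nat n * w)"
proof -
  note nn = regular_not_nonpos_Reals[OF assms(1) reg_pos assms(2)]
  have 1: "of_nat n * w + of_nat (\<nu> j) + 1 \<notin> \<int>\<^sub>\<le>\<^sub>0" for j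
    using nn(1)[of "Suc (\<nu> j)"] nonpos_Ints_subset_nonpos_Reals by (auto simp: add_ac)
  have 2: "of_nat n * w - of_nat n + 1 \<notin> \<int>\<^sub>\<le>\<^sub>0"
    using nn(2)[of 1] nonpos_Ints_subset_nonpos_Reals by auto
  show ?thesis
    unfolding F_def using 1 2 by (intro continuous_intros) (auto simp: Gamma_eq_zero_iff)
qed

lemma continuous_on_Bf:
  assumes "n > 0" "\<And>t. t \<in> A \<Longrightarrow> \<exists>w \<in> regular reg_angle reg_radius. t = of_nat n * w"
  shows "continuous_on A (Bf n lam)" "continuous_on A (Af n lam)" "continuous_on A (F n)"
proof -
  show F: "continuous_on A (F n)"
    using assms isCont_F by (intro continuous_at_imp_continuous_on) blast
  have "F n t \<noteq> 0" if "t \<in> A" for t using assms(2)[OF that] F_ratio(3)[OF _ assms(1)] by blast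
  then show "continuous_on A (Bf n lam)"
    unfolding Bf_def by (intro continuous_intros F) auto
  obtain w where "w \<in> regular reg_angle reg_radius" using regular_vertical[of "of_real w0"] by auto
  from F_ratio(2)[OF this assms(1)] show "continuous_on A (Af n lam)"
    unfolding Af_def by (intro continuous_intros F) auto
qed

section \<open>The inner integral and its limit\<close>

definition line_pt :: "nat \<Rightarrow> real \<Rightarrow> complex" where
  "line_pt n v = s0 n + of_real (kk n) * Complex 1 v"

text \<open>The inner integral seen from the displaced line, with the t-integrand normalised at the
  critical point; its limit is \<open>airy_cauchy\<close>.\<close>

definition Bin :: "nat \<Rightarrow> real \<Rightarrow> real \<Rightarrow> complex" where
  "Bin n lam v = pentagon (real n) (real n * w0) (real n * e) (\<lambda>t. Bf n lam t / (line_pt n v - t)) / (2 * of_real pi * \<i>)"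

abbreviation bray_fun :: "nat \<Rightarrow> real \<Rightarrow> real \<Rightarrow> real \<Rightarrow> real \<Rightarrow> complex" where
  "bray_fun n lam v \<theta> r \<equiv> cis \<theta> * (Bf n lam (ray_pt n r \<theta>) / (Complex 1 v + of_real r * cis \<theta>))"

definition Bray :: "nat \<Rightarrow> real \<Rightarrow> real \<Rightarrow> real \<Rightarrow> complex" where
  "Bray n lam v \<theta> = (LINT r:{0..rmax n}|lborel. bray_fun n lam v \<theta> r)"

lemma ray_pt_regular:
  assumes "n > 0" "0 \<le> r" "r \<le> rmax n" "\<theta> = pi/4 \<or> \<theta> = - (pi/4)"
  shows "\<exists>w \<in> regular reg_angle reg_radius. ray_pt n r \<theta> = of_nat n * w"
proof -
  have minus: "Complex (w0 - dl n * r * (sqrt 2 / 2)) (dl n * r * (sqrt 2 / 2)) \<in> regular reg_angle reg_radius"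
    using ray_range[OF assms(1-3)] by (intro regular_ray)
  have plus: "Complex (w0 - dl n * r * (sqrt 2 / 2)) (- (dl n * r * (sqrt 2 / 2))) \<in> regular reg_angle reg_radius"
  proof -
    have "Complex x (- y) = cnj (Complex x y)" for x y by (simp add: complex_eq_iff)
    then show ?thesis using regular_cnj[OF minus] by (simp only:)
  qed
  have "cnj (of_nat n * Complex x y) = of_nat n * Complex x (- y)" for x y
    by (simp add: complex_eq_iff)
  then show ?thesis
    using assms(4) plus minus ray_point[OF assms(1), of r] ray_cnj[of n r] by metis
qed

lemma Bray_cont:
  assumes "n > 0" "\<theta> = pi/4 \<or> \<theta> = - (pi/4)"
  shows "continuous_on {0..rmax n} (\<lambda>r. Bf n lam (ray_pt n r \<theta>) / (Complex 1 v + of_real r * cis \<theta>))"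
proof -
  have "continuous_on ((\<lambda>r. ray_pt n r \<theta>) ` {0..rmax n}) (Bf n lam)"
    using ray_pt_regular[OF assms(1) _ _ assms(2)] by (intro continuous_on_Bf(1) assms(1)) auto
  then have "continuous_on {0..rmax n} (\<lambda>r. Bf n lam (ray_pt n r \<theta>))"
    by (rule continuous_on_compose2) (auto intro!: continuous_intros)
  moreover have "Complex 1 v + of_real r * cis \<theta> \<noteq> 0" if "r \<ge> 0" for r
  proof -
    have "cos \<theta> \<ge> 0" using assms(2) airy_angle_cos(2)[of \<theta>] unfolding airy_angle_def by blast
    then have "Re (Complex 1 v + of_real r * cis \<theta>) \<ge> 1" using that by simp
    then show ?thesis by (metis not_one_le_zero zero_complex.simps(1))
  qed
  ultimately show ?thesis by (intro continuous_intros) auto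
qed

text \<open>On the three outer sides the integrand is at most \<open>1 / n\<close> divided by
  \<open>n * e\<close>, and each side is no longer than \<open>2 * n\<close>. Together they
  contribute at most \<open>6 / (n * e)\<close>, and the inclined sides carry the rest.\<close>

lemma Bin_split:
  assumes nu0: "\<nu> 0 = 0" and "\<Lambda> \<ge> 0"
  obtains n1 where "n1 > 0" "\<And>n lam v. n \<ge> n1 \<Longrightarrow> \<bar>kk n * lam\<bar> \<le> \<Lambda> \<Longrightarrow>
    norm (Bin n lam v - (Bray n lam v (pi/4) - Bray n lam v (- (pi/4))) / (2 * of_real pi * \<i>)) \<le> 6 / (real n * e)"
proof -
  obtain n1 where n1: "n1 > 0"
    "\<And>n lam u. n \<ge> n1 \<Longrightarrow> \<bar>kk n * lam\<bar> \<le> \<Lambda> \<Longrightarrow> -1/2 \<le> u \<Longrightarrow> u \<le> real n \<Longrightarrow> norm (Bf n lam (Complex u (real n * e))) \<le> 1 / real n"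
    "\<And>n lam u. n \<ge> n1 \<Longrightarrow> \<bar>kk n * lam\<bar> \<le> \<Lambda> \<Longrightarrow> -1/2 \<le> u \<Longrightarrow> u \<le> real n \<Longrightarrow> norm (Bf n lam (Complex u (- (real n * e)))) \<le> 1 / real n"
    "\<And>n lam v. n \<ge> n1 \<Longrightarrow> \<bar>kk n * lam\<bar> \<le> \<Lambda> \<Longrightarrow> \<bar>v\<bar> \<le> real n * e \<Longrightarrow> norm (Bf n lam (Complex (-1/2) v)) \<le> 1 / real n"
    by (rule Bf_rest_bound[OF assms]) blast
  show ?thesis
  proof (rule that[of n1])
    fix n lam v assume n: "n \<ge> n1" and lam: "\<bar>kk n * lam\<bar> \<le> \<Lambda>"
    have npos: "n > 0" "real n \<ge> 1" using n n1(1) by auto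
    have d: "dl n > 0" "kk n > 0" using dl_kk[OF npos(1)] by auto
    define V where "V = real n * e"
    have V: "V > 0" "V \<le> real n" using npos e_bounds by (auto simp: V_def mult_left_le)
    define s where "s = line_pt n v"
    define f where "f t = Bf n lam t / (s - t)" for t
    define B where "B = (1 / real n) / V"
    have B0: "B \<ge> 0" using V by (simp add: B_def)
    have Re_s: "Re s = real n * w0 + kk n" by (simp add: s_def line_pt_def s0_real)
    have st: "V \<le> norm (s - t)" if "Re t \<le> real n" for t
    proof -
      have "V = real n * w0 - real n" by (simp add: V_def w0_def algebra_simps)
      then have "V \<le> Re (s - t)" using that Re_s d by simp
      then show ?thesis using complex_Re_le_cmod[of "s - t"] by linarith
    qed
    have fB: "norm (f t) \<le> B" if "Re t \<le> real n" "norm (Bf n lam t) \<le> 1 / real n" for t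
      unfolding f_def norm_divide B_def using st[OF that(1)] that(2) V by (intro frac_le) auto
    have top: "norm (contour_integral (linepath (Complex (real n) V) (Complex (-1/2) V)) f) \<le> B * (2 * real n)"
    proof (rule norm_contour_integral_linepath_le[OF B0])
      show "norm (Complex (-1/2) V - Complex (real n) V) \<le> 2 * real n"
        using cmod_le[of "Complex (-1/2) V - Complex (real n) V"] npos by simp
      fix t assume "t \<in> closed_segment (Complex (real n) V) (Complex (-1/2) V)"
      then have "Im t = V" "-1/2 \<le> Re t" "Re t \<le> real n"
        using closed_segment_same_Im[of "Complex (real n) V" "Complex (-1/2) V"] npos by (auto simp: closed_segment_eq_real_ivl split: if_splits)
      then show "norm (f t) \<le> B" using n1(2)[OF n lam, of "Re t"] by (intro fB) (auto simp: V_def complex_surj, metis complex_surj)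
    qed
    have bot: "norm (contour_integral (linepath (Complex (-1/2) (- V)) (Complex (real n) (- V))) f) \<le> B * (2 * real n)"
    proof (rule norm_contour_integral_linepath_le[OF B0])
      show "norm (Complex (real n) (- V) - Complex (-1/2) (- V)) \<le> 2 * real n"
        using cmod_le[of "Complex (real n) (- V) - Complex (-1/2) (- V)"] npos by simp
      fix t assume "t \<in> closed_segment (Complex (-1/2) (- V)) (Complex (real n) (- V))"
      then have "Im t = - V" "-1/2 \<le> Re t" "Re t \<le> real n"
        using closed_segment_same_Im[of "Complex (-1/2) (- V)" "Complex (real n) (- V)"] npos by (auto simp: closed_segment_eq_real_ivl split: if_splits)
      then show "norm (f t) \<le> B" using n1(3)[OF n lam, of "Re t"] by (intro fB) (auto simp: V_def complex_surj, metis complex_surj)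
    qed
    have left: "norm (contour_integral (linepath (Complex (-1/2) V) (Complex (-1/2) (- V))) f) \<le> B * (2 * real n)"
    proof (rule norm_contour_integral_linepath_le[OF B0])
      show "norm (Complex (-1/2) (- V) - Complex (-1/2) V) \<le> 2 * real n"
        using cmod_le[of "Complex (-1/2) (- V) - Complex (-1/2) V"] V by simp
      fix t assume "t \<in> closed_segment (Complex (-1/2) V) (Complex (-1/2) (- V))"
      then have "Re t = -1/2" "\<bar>Im t\<bar> \<le> V"
        using closed_segment_same_Re[of "Complex (-1/2) V" "Complex (-1/2) (- V)"] V by (auto simp: closed_segment_eq_real_ivl split: if_splits)
      then show "norm (f t) \<le> B" using n1(4)[OF n lam, of "Im t"] npos by (intro fB) (auto simp: V_def complex_surj, metis complex_surj)
    qed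
    have ray: "contour_integral (linepath (of_real (real n * w0)) (s0 n - of_real (kk n) * (of_real (rmax n) * cis \<theta>))) f = - Bray n lam v \<theta>"
      if \<theta>: "\<theta> = pi/4 \<or> \<theta> = - (pi/4)" for \<theta>
    proof -
      have r0: "rmax n \<ge> 0" using d e_bounds by (simp add: rmax_def)
      define dd where "dd = - (of_real (kk n) * cis \<theta>)"
      have pt: "s0 n + of_real r * dd = ray_pt n r \<theta>" for r by (simp add: dd_def)
      \<comment> \<open>The scale \<open>kk n\<close> cancels between \<open>dt\<close> and
        \<open>s - t\<close>, so the inner integral converges without a power of
        \<open>n\<close>.\<close>
      have ft: "dd * f (s0 n + of_real r * dd) = - (bray_fun n lam v \<theta> r)" for r
      proof -
        have eq: "s - (ray_pt n r \<theta>) = of_real (kk n) * (Complex 1 v + of_real r * cis \<theta>)"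
          by (simp add: s_def line_pt_def algebra_simps)
        show ?thesis unfolding pt unfolding f_def eq unfolding dd_def using d(2) by simp
      qed
      have dd0: "dd \<noteq> 0" using d(2) by (simp add: dd_def)
      have c: "continuous_on {0..rmax n} (\<lambda>r. dd * f (s0 n + of_real r * dd))"
        unfolding ft by (intro continuous_intros Bray_cont npos \<theta>)
      have "continuous_on {0..rmax n} (\<lambda>r. f (s0 n + of_real r * dd))"
        using continuous_on_divide[OF c continuous_on_const[of "{0..rmax n}" dd]] dd0 by simp
      from contour_integral_linepath_ray[OF r0 this]
      have "contour_integral (linepath (s0 n) (s0 n + of_real (rmax n) * dd)) f = - Bray n lam v \<theta>"
        unfolding ft Bray_def by (simp add: set_lebesgue_integral_def)
      then show ?thesis unfolding pt by (simp add: s0_def)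
    qed
    have rm: "kk n * (rmax n * (sqrt 2 / 2)) = V"
      using d by (simp add: rmax_def V_def flip: dl_kk(1)[OF npos(1)])
    have c1: "s0 n - of_real (kk n) * (of_real (rmax n) * cis (- (pi/4))) = Complex (real n) V"
      "s0 n - of_real (kk n) * (of_real (rmax n) * cis (pi/4)) = Complex (real n) (- V)"
      using rm by (auto simp: complex_eq_iff s0_real cis_45 V_def w0_def algebra_simps)
    have r1: "contour_integral (linepath (of_real (real n * w0)) (Complex (real n) V)) f = - Bray n lam v (- (pi/4))"
      using ray[of "- (pi/4)"] unfolding c1 by simp
    have "contour_integral (linepath (of_real (real n * w0)) (Complex (real n) (- V))) f = - Bray n lam v (pi/4)"
      using ray[of "pi/4"] unfolding c1 by simp
    then have r2: "contour_integral (linepath (Complex (real n) (- V)) (of_real (real n * w0))) f = Bray n lam v (pi/4)"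
      using contour_integral_reversepath[of "linepath (of_real (real n * w0)) (Complex (real n) (- V))" f] by simp
    define S where "S = contour_integral (linepath (Complex (real n) V) (Complex (-1/2) V)) f
       + contour_integral (linepath (Complex (-1/2) V) (Complex (-1/2) (- V))) f
       + contour_integral (linepath (Complex (-1/2) (- V)) (Complex (real n) (- V))) f"
    have eq: "Bin n lam v - (Bray n lam v (pi/4) - Bray n lam v (- (pi/4))) / (2 * of_real pi * \<i>) = S / (2 * of_real pi * \<i>)"
      unfolding Bin_def s_def[symmetric] f_def[symmetric] pentagon_def V_def[symmetric] r1 r2 S_def
      by (simp add: diff_divide_distrib add_divide_distrib)
    have "norm (S / (2 * of_real pi * \<i>)) = norm S / (2 * pi)" by (simp add: norm_divide norm_mult)
    moreover have "norm S / (2 * pi) \<le> norm S" by (rule divide_2pi_le) (rule norm_ge_zero)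
    moreover have "norm S \<le> B * (2 * real n) + B * (2 * real n) + B * (2 * real n)"
      unfolding S_def by (rule norm_triangle_mono[OF norm_triangle_mono[OF top left] bot])
    moreover have "B * (2 * real n) + B * (2 * real n) + B * (2 * real n) = 6 / V" using npos by (simp add: B_def)
    ultimately show "norm (Bin n lam v - (Bray n lam v (pi/4) - Bray n lam v (- (pi/4))) / (2 * of_real pi * \<i>)) \<le> 6 / (real n * e)"
      unfolding eq V_def by linarith
  qed (rule n1)
qed

lemma Bray_eq_indicator:
  "Bray n lam v \<theta> = (LINT r|lborel. indicator {0..rmax n} r *\<^sub>R (bray_fun n lam v \<theta> r))"
  by (simp add: Bray_def set_lebesgue_integral_def)

lemma Bray_measurable:
  assumes "n > 0" "\<theta> = pi/4 \<or> \<theta> = - (pi/4)"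
  shows "(\<lambda>r. indicator {0..rmax n} r *\<^sub>R (bray_fun n lam v \<theta> r)) \<in> borel_measurable borel"
  by (intro borel_measurable_continuous_on_indicator continuous_intros Bray_cont assms) auto

lemma Bray_pointwise:
  assumes C: "\<And>r. 0 \<le> r \<Longrightarrow> r \<le> rmax n \<Longrightarrow> norm (Bf n lam (ray_pt n r \<theta>)) \<le> C * exp (- r)"
    and \<theta>: "\<theta> = pi/4 \<or> \<theta> = - (pi/4)" and "C \<ge> 0"
  shows "norm (indicator {0..rmax n} r *\<^sub>R (bray_fun n lam v \<theta> r)) \<le> C * exp (- \<bar>r\<bar>)"
proof (cases "r \<in> {0..rmax n}")
  case True
  have "cos \<theta> \<ge> 0" using \<theta> airy_angle_cos(2)[of \<theta>] unfolding airy_angle_def by blast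
  then have "1 \<le> norm (Complex 1 v + of_real r * cis \<theta>)"
    using True by (intro norm_add_ge_Re) auto
  then have "norm (Bf n lam (ray_pt n r \<theta>)) / norm (Complex 1 v + of_real r * cis \<theta>) \<le> C * exp (- r) / 1"
    using C[of r] True assms(3) by (intro frac_le) auto
  then show ?thesis using True by (simp add: norm_mult norm_divide)
qed (use assms(3) in simp)

text \<open>Uniform in \<open>v\<close> because the denominator has real part at least 1 on the
  rays. This is what dominates the outer integral in its passage to the limit.\<close>

lemma Bin_bound:
  assumes nu0: "\<nu> 0 = 0" and "\<Lambda> \<ge> 0"
  obtains K n1 where "n1 > 0" "K \<ge> 0" "\<And>n lam v. n \<ge> n1 \<Longrightarrow> \<bar>kk n * lam\<bar> \<le> \<Lambda> \<Longrightarrow> norm (Bin n lam v) \<le> K"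
proof -
  obtain n1 where n1: "n1 > 0" "\<And>n lam v. n \<ge> n1 \<Longrightarrow> \<bar>kk n * lam\<bar> \<le> \<Lambda> \<Longrightarrow>
    norm (Bin n lam v - (Bray n lam v (pi/4) - Bray n lam v (- (pi/4))) / (2 * of_real pi * \<i>)) \<le> 6 / (real n * e)"
    by (rule Bin_split[OF assms]) blast
  obtain C n2 where C: "n2 > 0" "\<And>n lam r \<theta>. n \<ge> n2 \<Longrightarrow> \<bar>kk n * lam\<bar> \<le> \<Lambda> \<Longrightarrow> 0 \<le> r \<Longrightarrow> r \<le> rmax n \<Longrightarrow> \<theta> = pi/4 \<or> \<theta> = - (pi/4) \<Longrightarrow>
    norm (Bf n lam (ray_pt n r \<theta>)) \<le> C * exp (- r)"
    by (rule Bf_ray_bound[of \<Lambda>]) blast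
  define I where "I = (LINT r|lborel. max C 0 * exp (- \<bar>r\<bar>) :: real)"
  have I0: "I \<ge> 0" unfolding I_def by (intro integral_nonneg_AE) auto
  have ray: "norm (Bray n lam v \<theta>) \<le> I" if n: "n \<ge> n2" and lam: "\<bar>kk n * lam\<bar> \<le> \<Lambda>" and \<theta>: "\<theta> = pi/4 \<or> \<theta> = - (pi/4)" for n lam v \<theta>
  proof -
    have npos: "n > 0" using n C(1) by simp
    have b: "norm (indicator {0..rmax n} r *\<^sub>R (bray_fun n lam v \<theta> r)) \<le> max C 0 * exp (- \<bar>r\<bar>)" for r
    proof (rule Bray_pointwise[OF _ \<theta>])
      show "norm (Bf n lam (ray_pt n r \<theta>)) \<le> max C 0 * exp (- r)" if "0 \<le> r" "r \<le> rmax n" for r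
        by (rule order_trans[OF C(2)[OF n lam that \<theta>]], rule mult_right_mono) auto
    qed simp
    show ?thesis
      unfolding Bray_eq_indicator I_def
    proof (rule order_trans[OF integral_norm_bound integral_mono])
      show "integrable lborel (\<lambda>r. norm (indicator {0..rmax n} r *\<^sub>R (bray_fun n lam v \<theta> r)))"
        by (intro integrable_norm integrable_lborel_exp_bound[OF Bray_measurable[OF npos \<theta>] b])
    qed (use integrable_exp_minus_abs b in auto)
  qed
  show ?thesis
  proof (rule that[of "max n1 n2" "6 / e + 2 * I"])
    show "0 < max n1 n2" "6 / e + 2 * I \<ge> 0" using n1 I0 e_bounds by auto
    fix n lam v assume n: "n \<ge> max n1 n2" and lam: "\<bar>kk n * lam\<bar> \<le> \<Lambda>"
    let ?D = "Bray n lam v (pi/4) - Bray n lam v (- (pi/4))"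
    have "norm ?D \<le> I + I"
      by (intro order_trans[OF norm_triangle_ineq4] add_mono ray) (use n lam in auto)
    moreover have "norm (?D / (2 * of_real pi * \<i>)) \<le> norm ?D / 1"
      using divide_2pi_le[of "norm ?D"] by (simp add: norm_divide norm_mult)
    moreover have "6 / (real n * e) \<le> 6 / e"
      using n n1(1) e_bounds by (intro divide_left_mono) (auto simp: mult_le_cancel_right1)
    moreover have "norm (Bin n lam v) \<le> norm (Bin n lam v - ?D / (2 * of_real pi * \<i>)) + norm (?D / (2 * of_real pi * \<i>))"
      using norm_triangle_ineq[of "Bin n lam v - ?D / (2 * of_real pi * \<i>)" "?D / (2 * of_real pi * \<i>)"] by (simp only: diff_add_cancel)
    ultimately show "norm (Bin n lam v) \<le> 6 / e + 2 * I"
      using n1(2)[of n lam v] n lam by simp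
  qed
qed

lemma Bin_tendsto:
  assumes nu0: "\<nu> 0 = 0" and N: "filterlim N at_top sequentially" and lam: "(\<lambda>k. kk (N k) * lam k) \<longlonglongrightarrow> \<xi>"
  shows "(\<lambda>k. Bin (N k) (lam k) v) \<longlonglongrightarrow> airy_cauchy (of_real \<xi>) (Complex 1 v)"
proof -
  define \<Lambda> where "\<Lambda> = \<bar>\<xi>\<bar> + 1"
  have L0: "\<Lambda> \<ge> 0" by (simp add: \<Lambda>_def)
  have "(\<lambda>k. \<bar>kk (N k) * lam k\<bar>) \<longlonglongrightarrow> \<bar>\<xi>\<bar>" using lam by (rule tendsto_rabs)
  then have "\<forall>\<^sub>F k in sequentially. \<bar>kk (N k) * lam k\<bar> < \<Lambda>" by (rule order_tendstoD) (simp add: \<Lambda>_def)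
  then have lb: "\<forall>\<^sub>F k in sequentially. \<bar>kk (N k) * lam k\<bar> \<le> \<Lambda>" by (rule eventually_mono) simp
  obtain n1 where n1: "n1 > 0" "\<And>n lam v. n \<ge> n1 \<Longrightarrow> \<bar>kk n * lam\<bar> \<le> \<Lambda> \<Longrightarrow>
    norm (Bin n lam v - (Bray n lam v (pi/4) - Bray n lam v (- (pi/4))) / (2 * of_real pi * \<i>)) \<le> 6 / (real n * e)"
    by (rule Bin_split[OF nu0 L0]) blast
  obtain C n2 where C: "n2 > 0" "\<And>n lam r \<theta>. n \<ge> n2 \<Longrightarrow> \<bar>kk n * lam\<bar> \<le> \<Lambda> \<Longrightarrow> 0 \<le> r \<Longrightarrow> r \<le> rmax n \<Longrightarrow> \<theta> = pi/4 \<or> \<theta> = - (pi/4) \<Longrightarrow>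
    norm (Bf n lam (ray_pt n r \<theta>)) \<le> C * exp (- r)"
    by (rule Bf_ray_bound[of \<Lambda>]) blast
  have "\<forall>\<^sub>F k in sequentially. N k \<ge> max n1 n2"
    by (rule eventually_compose_filterlim[OF eventually_ge_at_top N])
  with lb have ev: "\<forall>\<^sub>F k in sequentially. \<bar>kk (N k) * lam k\<bar> \<le> \<Lambda> \<and> N k \<ge> n1 \<and> N k \<ge> n2 \<and> N k > 0"
    by eventually_elim (use n1 in auto)
  then obtain k0 where k0: "\<And>k. k \<ge> k0 \<Longrightarrow> \<bar>kk (N k) * lam k\<bar> \<le> \<Lambda> \<and> N k \<ge> n1 \<and> N k \<ge> n2 \<and> N k > 0"
    unfolding eventually_sequentially by blast
  have dN: "(\<lambda>k. dl (N k)) \<longlonglongrightarrow> 0" by (rule filterlim_compose[OF dl_tendsto N])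
  have ray: "(\<lambda>k. Bray (N k) (lam k) v \<theta>) \<longlonglongrightarrow> ray_integral \<theta> (\<lambda>w. airy_exp (of_real \<xi>) w * (1 / (Complex 1 v + w)))"
    if \<theta>: "\<theta> = pi/4 \<or> \<theta> = - (pi/4)" for \<theta>
  proof -
    let ?f = "\<lambda>r. cis \<theta> * (airy_exp (of_real \<xi>) (of_real r * cis \<theta>) * (1 / (Complex 1 v + of_real r * cis \<theta>)))"
    have cosp: "cos \<theta> \<ge> 0" using \<theta> airy_angle_cos(2)[of \<theta>] unfolding airy_angle_def by blast
    have nz: "Complex 1 v + of_real r * cis \<theta> \<noteq> 0" if "r \<ge> 0" for r
      using norm_add_ge_Re[of 1 "Complex 1 v" "of_real r * cis \<theta>"] that cosp by auto
    \<comment> \<open>The majorant is valid from \<open>k0\<close> on only, whence the shifted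
      sequence.\<close>
    have "(\<lambda>k. Bray (N (k + k0)) (lam (k + k0)) v \<theta>) \<longlonglongrightarrow> (LINT r|lborel. indicator {0..} r *\<^sub>R ?f r)"
      unfolding Bray_eq_indicator
    proof (rule integral_dominated_convergence)
      have "continuous_on {0..} ?f" using nz by (intro continuous_intros) auto
      then have "(\<lambda>r. indicator {0..} r *\<^sub>R ?f r) \<in> borel_measurable borel"
        by (intro borel_measurable_continuous_on_indicator) auto
      then show "(\<lambda>r. indicator {0..} r *\<^sub>R ?f r) \<in> borel_measurable lborel" by simp
      show "integrable lborel (\<lambda>r::real. max C 0 * exp (- \<bar>r\<bar>))" using integrable_exp_minus_abs by simp
      show "AE r in lborel. (\<lambda>k. indicator {0..rmax (N (k + k0))} r *\<^sub>R (bray_fun (N (k + k0)) (lam (k + k0)) v \<theta> r)) \<longlonglongrightarrow> indicator {0..} r *\<^sub>R ?f r"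
      proof (rule AE_I2)
        fix r :: real
        show "(\<lambda>k. indicator {0..rmax (N (k + k0))} r *\<^sub>R (bray_fun (N (k + k0)) (lam (k + k0)) v \<theta> r)) \<longlonglongrightarrow> indicator {0..} r *\<^sub>R ?f r"
        proof (cases "r \<ge> 0")
          case True
          have b: "(\<lambda>k. Bf (N k) (lam k) (ray_pt (N k) r \<theta>)) \<longlonglongrightarrow> airy_exp (of_real \<xi>) (of_real r * cis \<theta>)"
            by (rule Bf_tendsto[OF N lam True \<theta>])
          have "(\<lambda>k. dl (N k) * r) \<longlonglongrightarrow> 0 * r" by (intro tendsto_intros dN)
          then have "\<forall>\<^sub>F k in sequentially. dl (N k) * r < sqrt 2 * e"
            using e_bounds by (intro order_tendstoD(2)[of _ "0 * r"]) auto
          with ev have rm: "\<forall>\<^sub>F k in sequentially. r \<le> rmax (N k)"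
          proof eventually_elim
            case (elim k)
            then have "dl (N k) > 0" by (intro dl_kk) auto
            then show ?case using elim by (simp add: rmax_def field_simps)
          qed
          have "(\<lambda>k. bray_fun (N k) (lam k) v \<theta> r) \<longlonglongrightarrow>
             cis \<theta> * (airy_exp (of_real \<xi>) (of_real r * cis \<theta>) / (Complex 1 v + of_real r * cis \<theta>))"
            by (intro tendsto_intros b nz True)
          then have "(\<lambda>k. indicator {0..rmax (N k)} r *\<^sub>R (bray_fun (N k) (lam k) v \<theta> r)) \<longlonglongrightarrow>
             cis \<theta> * (airy_exp (of_real \<xi>) (of_real r * cis \<theta>) / (Complex 1 v + of_real r * cis \<theta>))"
            by (rule Lim_transform_eventually) (rule eventually_mono[OF rm], use True in simp)
          from LIMSEQ_ignore_initial_segment[OF this, of k0] show ?thesis using True by simp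
        qed simp
      qed
      show "AE r in lborel. norm (indicator {0..rmax (N (k + k0))} r *\<^sub>R (bray_fun (N (k + k0)) (lam (k + k0)) v \<theta> r)) \<le> max C 0 * exp (- \<bar>r\<bar>)" for k
      proof (intro AE_I2 Bray_pointwise[OF _ \<theta>])
        fix r assume r: "0 \<le> r" "r \<le> rmax (N (k + k0))"
        have "C * exp (- r) \<le> max C 0 * exp (- r)" by (intro mult_right_mono) auto
        then show "norm (Bf (N (k + k0)) (lam (k + k0)) (ray_pt (N (k + k0)) r \<theta>)) \<le> max C 0 * exp (- r)"
          using C(2)[of "N (k + k0)" "lam (k + k0)" r \<theta>] k0[of "k + k0"] r \<theta> by (intro order_trans[OF C(2)]) auto
      qed simp
      show "(\<lambda>r. indicator {0..rmax (N (k + k0))} r *\<^sub>R (bray_fun (N (k + k0)) (lam (k + k0)) v \<theta> r)) \<in> borel_measurable lborel" for k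
        using Bray_measurable[OF _ \<theta>, of "N (k + k0)"] k0[of "k + k0"] by simp
    qed
    then have "(\<lambda>k. Bray (N k) (lam k) v \<theta>) \<longlonglongrightarrow> (LINT r|lborel. indicator {0..} r *\<^sub>R ?f r)"
      by (rule LIMSEQ_offset)
    then show ?thesis by (simp add: ray_integral_def set_lebesgue_integral_def)
  qed
  have err: "(\<lambda>k. Bin (N k) (lam k) v - (Bray (N k) (lam k) v (pi/4) - Bray (N k) (lam k) v (- (pi/4))) / (2 * of_real pi * \<i>)) \<longlonglongrightarrow> 0"
  proof (rule Lim_null_comparison)
    have "(\<lambda>n. 6 / (real n * e)) \<longlonglongrightarrow> 0" using e_bounds(1) by real_asymp
    from filterlim_compose[OF this N] show "(\<lambda>k. 6 / (real (N k) * e)) \<longlonglongrightarrow> 0" .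
    show "\<forall>\<^sub>F k in sequentially. norm (Bin (N k) (lam k) v - (Bray (N k) (lam k) v (pi/4) - Bray (N k) (lam k) v (- (pi/4))) / (2 * of_real pi * \<i>)) \<le> 6 / (real (N k) * e)"
      using ev by eventually_elim (use n1 in auto)
  qed
  have "(\<lambda>k. (Bin (N k) (lam k) v - (Bray (N k) (lam k) v (pi/4) - Bray (N k) (lam k) v (- (pi/4))) / (2 * of_real pi * \<i>)) +
     (Bray (N k) (lam k) v (pi/4) - Bray (N k) (lam k) v (- (pi/4))) / (2 * of_real pi * \<i>)) \<longlonglongrightarrow> 0 + airy_cauchy (of_real \<xi>) (Complex 1 v)"
    unfolding airy_cauchy_def airy_rays_def by (intro tendsto_add tendsto_divide tendsto_diff err tendsto_const ray) auto
  then show ?thesis by simp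
qed

end

section \<open>From convergence along sequences to uniform convergence\<close>

text \<open>For continuity, \<open>N k\<close> is taken so large that \<open>f (N k) (u k)\<close>
  approximates \<open>J (u k)\<close>, and \<open>core\<close> identifies the limit along this
  diagonal. If uniformity failed, compactness would yield a convergent sequence of points at which
  \<open>f\<close> and \<open>J\<close> stay apart, although both tend to the same value.\<close>

lemma continuous_convergence:
  fixes f :: "nat \<Rightarrow> 'a::metric_space \<Rightarrow> 'b::metric_space"
  assumes core: "\<And>N z w. filterlim N at_top sequentially \<Longrightarrow> z \<longlonglongrightarrow> w \<Longrightarrow> (\<lambda>k. f (N k) (z k)) \<longlonglongrightarrow> J w"
  shows "isCont J w" "compact K \<Longrightarrow> uniform_limit K f J sequentially"
proof -
  have cont: "isCont J w" for w
  proof (rule continuous_at_sequentiallyI)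
    fix u assume u: "u \<longlonglongrightarrow> w"
    have "\<exists>n\<ge>k. dist (f n (u k)) (J (u k)) < 1 / (real k + 1)" for k
    proof -
      have "(\<lambda>n. f n (u k)) \<longlonglongrightarrow> J (u k)"
        by (rule core[of "\<lambda>n. n" "\<lambda>_. u k"]) (auto intro: filterlim_ident)
      then have "\<forall>\<^sub>F n in sequentially. dist (f n (u k)) (J (u k)) < 1 / (real k + 1)"
        by (rule tendstoD) simp
      then obtain n0 where "\<And>n. n \<ge> n0 \<Longrightarrow> dist (f n (u k)) (J (u k)) < 1 / (real k + 1)"
        unfolding eventually_sequentially by blast
      then show ?thesis by (intro exI[of _ "max k n0"]) auto
    qed
    then obtain N where N: "\<And>k. N k \<ge> k" "\<And>k. dist (f (N k) (u k)) (J (u k)) < 1 / (real k + 1)" by metis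
    have "filterlim N at_top sequentially"
      by (rule filterlim_at_top_mono[OF filterlim_ident]) (use N in auto)
    then have lim: "(\<lambda>k. f (N k) (u k)) \<longlonglongrightarrow> J w" using u by (rule core)
    have "(\<lambda>k. dist (J (u k)) (J w)) \<longlonglongrightarrow> 0"
    proof (rule tendsto_sandwich[OF _ _ tendsto_const])
      have "(\<lambda>k. 1 / (real k + 1)) \<longlonglongrightarrow> 0" by real_asymp
      from tendsto_add[OF this lim[THEN tendsto_dist_iff[THEN iffD1]]]
      show "(\<lambda>k. 1 / (real k + 1) + dist (f (N k) (u k)) (J w)) \<longlonglongrightarrow> 0" by simp
      have "dist (J (u k)) (J w) \<le> 1 / (real k + 1) + dist (f (N k) (u k)) (J w)" for k
        using dist_triangle[of "J (u k)" "J w" "f (N k) (u k)"] N(2)[of k] by (simp add: dist_commute)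
      then show "\<forall>\<^sub>F k in sequentially. dist (J (u k)) (J w) \<le> 1 / (real k + 1) + dist (f (N k) (u k)) (J w)" by simp
    qed auto
    then show "(\<lambda>k. J (u k)) \<longlonglongrightarrow> J w" by (rule tendsto_dist_iff[THEN iffD2])
  qed
  then show "isCont J w" .
  show "uniform_limit K f J sequentially" if K: "compact K"
  proof (rule ccontr)
    assume "\<not> uniform_limit K f J sequentially"
    then obtain \<epsilon> where \<epsilon>: "\<epsilon> > 0" "\<not> (\<forall>\<^sub>F n in sequentially. \<forall>x\<in>K. dist (f n x) (J x) < \<epsilon>)"
      unfolding uniform_limit_iff by blast
    then have "\<exists>n\<ge>k. \<exists>x\<in>K. dist (f n x) (J x) \<ge> \<epsilon>" for k
      unfolding eventually_sequentially by (meson not_le)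
    then obtain N u where N: "\<And>k. N k \<ge> k" "\<And>k. u k \<in> K" "\<And>k. dist (f (N k) (u k)) (J (u k)) \<ge> \<epsilon>" by metis
    from K N(2) obtain l r where r: "strict_mono r" "(u \<circ> r) \<longlonglongrightarrow> l"
      using compact_imp_seq_compact seq_compactE by metis
    have "filterlim (\<lambda>k. N (r k)) at_top sequentially"
      by (rule filterlim_at_top_mono[OF filterlim_subseq[OF r(1)]]) (use N in auto)
    then have 1: "(\<lambda>k. f (N (r k)) ((u \<circ> r) k)) \<longlonglongrightarrow> J l" using r(2) by (rule core)
    have 2: "(\<lambda>k. J ((u \<circ> r) k)) \<longlonglongrightarrow> J l" using isCont_tendsto_compose[OF cont r(2)] .
    have "(\<lambda>k. dist (f (N (r k)) ((u \<circ> r) k)) (J ((u \<circ> r) k))) \<longlonglongrightarrow> dist (J l) (J l)"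
      by (intro tendsto_dist 1 2)
    then have "\<forall>\<^sub>F k in sequentially. dist (f (N (r k)) ((u \<circ> r) k)) (J ((u \<circ> r) k)) < \<epsilon>"
      using \<epsilon>(1) by (intro order_tendstoD) auto
    then obtain k where "dist (f (N (r k)) ((u \<circ> r) k)) (J ((u \<circ> r) k)) < \<epsilon>"
      using eventually_happens' sequentially_bot by blast
    then show False using N(3)[of "r k"] by simp
  qed
qed

section \<open>The kernel in Airy variables\<close>

context ginibre_product
begin

lemma line_pt_eq: "line_pt n v = Complex (real n * w0 + kk n) (kk n * v)"
  by (simp add: line_pt_def s0_def complex_eq_iff)

lemma line_pt_regular:
  assumes "n > 0"
  shows "\<exists>w \<in> regular reg_angle reg_radius. line_pt n v = of_nat n * w"
proof (intro bexI)
  show "line_pt n v = of_nat n * (of_real w0 + of_real (dl n) * Complex 1 v)"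
    unfolding line_pt_def by (rule s0_plus[OF assms])
  show "of_real w0 + of_real (dl n) * Complex 1 v \<in> regular reg_angle reg_radius"
    using dl_kk(3)[OF assms] by (intro regular_vertical) simp
qed

lemma continuous_line_pt: "continuous_on A (line_pt n)"
  unfolding line_pt_def Complex_eq by (intro continuous_intros)

text \<open>The finite residue sum makes continuity of \<open>Bin\<close> in \<open>v\<close>
  evident, which supplies the measurability for the outer integral.\<close>

lemma Bin_eq_residue_sum:
  assumes nu0: "\<nu> 0 = 0" and n: "n > 0"
  shows "F n (s0 n) * exp (- s0 n * of_real (lX n + lam)) * residue_sum n (exp (lX n + lam)) (line_pt n v) = Bin n lam v"
    "continuous_on UNIV (Bin n lam)"
proof -
  define x where "x = exp (lX n + lam)"
  define k where "k = exp (s0 n * of_real (lX n + lam)) / F n (s0 n)"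
  have F0: "F n (s0 n) \<noteq> 0" using F_ratio(2)[OF regular_vertical[of "of_real w0"] n] by simp
  have powr: "of_real x powr t / F n t = k * Bf n lam t" for t
  proof -
    have "of_real x powr t = exp (t * of_real (lX n + lam))"
      by (simp add: powr_def x_def Ln_of_real)
    also have "\<dots> = exp (s0 n * of_real (lX n + lam)) * exp ((t - s0 n) * of_real (lX n + lam))"
      by (simp add: algebra_simps flip: exp_add)
    finally show ?thesis using F0 by (simp add: k_def Bf_def)
  qed
  have d: "kk n > 0" using dl_kk(4)[OF n] .
  have V: "real n * e > 0" using n e_bounds by simp
  have w: "real n * w0 > real n" using n e_bounds by simp
  have "2 * of_real pi * \<i> * residue_sum n x (line_pt n v) = pentagon (real n) (real n * w0) (real n * e) (\<lambda>t. of_real x powr t / F n t / (line_pt n v - t))" for v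
    by (rule residue_sum_eq_pentagon[OF nu0 n]) (use V d w in \<open>auto simp: x_def line_pt_eq\<close>)
  also have "\<dots> v = k * pentagon (real n) (real n * w0) (real n * e) (\<lambda>t. Bf n lam t / (line_pt n v - t))" for v
    unfolding powr times_divide_eq_right[symmetric] by (rule pentagon_cmult)
  finally have eq: "2 * of_real pi * \<i> * residue_sum n x (line_pt n v) = k * (2 * of_real pi * \<i> * Bin n lam v)" for v
    by (simp add: Bin_def)
  then have eq: "residue_sum n x (line_pt n v) = k * Bin n lam v" for v by (simp add: mult_ac)
  have kk: "F n (s0 n) * exp (- s0 n * of_real (lX n + lam)) * k = 1"
    using F0 by (simp add: k_def flip: exp_add)
  show main: "F n (s0 n) * exp (- s0 n * of_real (lX n + lam)) * residue_sum n (exp (lX n + lam)) (line_pt n v) = Bin n lam v" for v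
    using kk unfolding x_def[symmetric] eq by (simp add: mult.assoc[symmetric])
  have "continuous_on UNIV (\<lambda>v. residue_sum n x (line_pt n v))"
    by (rule continuous_on_compose2[OF continuous_on_residue_sum continuous_line_pt]) (use w d in \<open>auto simp: line_pt_eq\<close>)
  then have "continuous_on UNIV (\<lambda>v. F n (s0 n) * exp (- s0 n * of_real (lX n + lam)) * residue_sum n x (line_pt n v))"
    by (intro continuous_intros)
  then show "continuous_on UNIV (Bin n lam)" unfolding x_def main .
qed

abbreviation line_fun :: "nat \<Rightarrow> real \<Rightarrow> real \<Rightarrow> real \<Rightarrow> complex" where
  "line_fun n mu lam v \<equiv> Af n mu (line_pt n v) * Bin n lam v"

lemma continuous_Af_line:
  assumes "n > 0"
  shows "continuous_on UNIV (\<lambda>v. Af n lam (line_pt n v))"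
  by (rule continuous_on_compose2[OF continuous_on_Bf(2)[OF assms, of "range (line_pt n)"] continuous_line_pt])
     (use line_pt_regular[OF assms] in auto)

text \<open>Normalising both integrands at the critical point leaves the factor
  \<open>exp (n * w0 * (lam - mu))\<close>. It diverges in general and is the reason for the
  exponential prefactor in the theorem; \<open>kk n\<close> is the Jacobian of the outer
  substitution.\<close>

lemma kernel_scaled:
  assumes nu0: "\<nu> 0 = 0" and n: "n > 0" and \<gamma>: "kernel_contour n \<gamma>"
  shows "product_kernel M \<nu> n \<gamma> (exp (lX n + lam)) (exp (lX n + mu)) =
    of_real (kk n / exp (lX n + mu) * exp (real n * w0 * (lam - mu))) *
    ((LINT v|lborel. line_fun n mu lam v) / (2 * of_real pi))"
proof -
  define x y where "x = exp (lX n + lam)" and "y = exp (lX n + mu)"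
  define b where "b = real n * w0 + kk n"
  have d: "kk n > 0" using dl_kk(4)[OF n] .
  have w: "real n * w0 > real n" using n e_bounds by simp
  have F0: "F n (s0 n) \<noteq> 0" using F_ratio(2)[OF regular_vertical[of "of_real w0"] n] by simp
  define q where "q s = F n s * of_real y powr (- s - 1) * residue_sum n x s" for s
  have K: "product_kernel M \<nu> n \<gamma> x y = 1 / (2 * of_real pi * \<i>) * vertical_line_integral b q"
    unfolding q_def by (rule product_kernel_eq_line[OF nu0 n \<gamma>]) (use w d in \<open>auto simp: x_def y_def b_def\<close>)
  define c where "c = exp (of_real (real n * w0 * (lam - mu))) / (of_real y :: complex)"
  have qv: "q (line_pt n v) = c * (line_fun n mu lam v)" for v
  proof -
    define s where "s = line_pt n v"
    have "of_real y powr (- s - 1) = exp ((- s - 1) * of_real (lX n + mu))"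
      by (simp add: powr_def y_def Ln_of_real)
    also have "(- s - 1) * of_real (lX n + mu) = - (s - s0 n) * of_real (lX n + mu) + - s0 n * of_real (lX n + mu) + - of_real (lX n + mu)"
      by (simp add: algebra_simps)
    also have "exp \<dots> = exp (- (s - s0 n) * of_real (lX n + mu)) * exp (- s0 n * of_real (lX n + mu)) * exp (- of_real (lX n + mu))"
      by (simp only: exp_add)
    also have "exp (- of_real (lX n + mu)) = 1 / (of_real y :: complex)"
      by (simp add: y_def exp_of_real exp_minus inverse_eq_divide flip: of_real_add)
    finally have yp: "of_real y powr (- s - 1) = exp (- (s - s0 n) * of_real (lX n + mu)) * exp (- s0 n * of_real (lX n + mu)) * (1 / of_real y)" .
    have Fs: "F n s * exp (- (s - s0 n) * of_real (lX n + mu)) = F n (s0 n) * Af n mu s"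
      using F0 by (simp add: Af_def)
    have R: "F n (s0 n) * residue_sum n x s = exp (s0 n * of_real (lX n + lam)) * Bin n lam v"
    proof -
      have "exp (s0 n * of_real (lX n + lam)) * Bin n lam v = exp (s0 n * of_real (lX n + lam)) * exp (- s0 n * of_real (lX n + lam)) * (F n (s0 n) * residue_sum n x s)"
        unfolding Bin_eq_residue_sum(1)[OF nu0 n, of lam v, symmetric] x_def s_def by (simp only: mult_ac)
      then show ?thesis by (simp flip: exp_add)
    qed
    have "q s = (F n s * exp (- (s - s0 n) * of_real (lX n + mu))) * exp (- s0 n * of_real (lX n + mu)) * (1 / of_real y) * residue_sum n x s"
      unfolding q_def yp by (simp only: mult_ac)
    also have "\<dots> = Af n mu s * exp (- s0 n * of_real (lX n + mu)) * (1 / of_real y) * (F n (s0 n) * residue_sum n x s)"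
      unfolding Fs by (simp only: mult_ac)
    also have "\<dots> = (exp (s0 n * of_real (lX n + lam)) * exp (- s0 n * of_real (lX n + mu))) * (1 / of_real y) * (Af n mu s * Bin n lam v)"
      unfolding R by (simp only: mult_ac)
    also have "exp (s0 n * of_real (lX n + lam)) * exp (- s0 n * of_real (lX n + mu)) = exp (of_real (real n * w0 * (lam - mu)))"
      by (simp add: s0_def algebra_simps flip: exp_add)
    finally show ?thesis by (simp add: c_def s_def)
  qed
  have "vertical_line_integral b q = \<i> * (\<bar>kk n\<bar> *\<^sub>R (LINT v|lborel. q (Complex b (0 + kk n * v))))"
    unfolding vertical_line_integral_def
    by (subst lborel_integral_real_affine[where c = "kk n" and t = 0]) (use d in auto)
  also have "(\<lambda>v. q (Complex b (0 + kk n * v))) = (\<lambda>v. c * (line_fun n mu lam v))"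
    unfolding qv[symmetric] by (simp add: line_pt_eq b_def)
  finally have "product_kernel M \<nu> n \<gamma> x y = of_real (kk n) * c * ((LINT v|lborel. line_fun n mu lam v) / (2 * of_real pi))"
    unfolding K using d by (simp add: scaleR_conv_of_real)
  also have "of_real (kk n) * c = of_real (kk n / y * exp (real n * w0 * (lam - mu)))"
    unfolding c_def exp_of_real by simp
  finally show ?thesis by (simp only: x_def y_def)
qed

lemma line_integral_tendsto:
  assumes nu0: "\<nu> 0 = 0" and N: "filterlim N at_top sequentially"
    and lam: "(\<lambda>k. kk (N k) * lam k) \<longlonglongrightarrow> \<xi>" and mu: "(\<lambda>k. kk (N k) * mu k) \<longlonglongrightarrow> \<eta>"
  shows "(\<lambda>k. (LINT v|lborel. line_fun (N k) (mu k) (lam k) v) / (2 * of_real pi)) \<longlonglongrightarrow> airy_double (of_real \<xi>) (of_real \<eta>)"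
proof -
  define \<Lambda> where "\<Lambda> = \<bar>\<xi>\<bar> + \<bar>\<eta>\<bar> + 1"
  have L0: "\<Lambda> \<ge> 0" by (simp add: \<Lambda>_def)
  have b1: "\<forall>\<^sub>F k in sequentially. \<bar>kk (N k) * lam k\<bar> < \<Lambda>" by (rule order_tendstoD(2)[OF tendsto_rabs[OF lam]]) (simp add: \<Lambda>_def)
  have b2: "\<forall>\<^sub>F k in sequentially. \<bar>kk (N k) * mu k\<bar> < \<Lambda>" by (rule order_tendstoD(2)[OF tendsto_rabs[OF mu]]) (simp add: \<Lambda>_def)
  obtain C n1 where A: "n1 > 0" "\<And>n lam v. n \<ge> n1 \<Longrightarrow> \<bar>kk n * lam\<bar> \<le> \<Lambda> \<Longrightarrow>
    norm (Af n lam (s0 n + of_real (kk n) * Complex 1 v)) \<le> C * exp (- \<bar>v\<bar>)"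
    by (rule Af_bound[of \<Lambda>]) blast
  obtain K n2 where B: "n2 > 0" "K \<ge> 0" "\<And>n lam v. n \<ge> n2 \<Longrightarrow> \<bar>kk n * lam\<bar> \<le> \<Lambda> \<Longrightarrow> norm (Bin n lam v) \<le> K"
    by (rule Bin_bound[OF nu0 L0]) blast
  have "\<forall>\<^sub>F k in sequentially. N k \<ge> max n1 n2"
    by (rule eventually_compose_filterlim[OF eventually_ge_at_top N])
  with b1 b2 have "\<forall>\<^sub>F k in sequentially. \<bar>kk (N k) * lam k\<bar> \<le> \<Lambda> \<and> \<bar>kk (N k) * mu k\<bar> \<le> \<Lambda> \<and> N k \<ge> n1 \<and> N k \<ge> n2 \<and> N k > 0"
    by eventually_elim (use A(1) in auto)
  then obtain k0 where k0: "\<And>k. k \<ge> k0 \<Longrightarrow> \<bar>kk (N k) * lam k\<bar> \<le> \<Lambda> \<and> \<bar>kk (N k) * mu k\<bar> \<le> \<Lambda> \<and> N k \<ge> n1 \<and> N k \<ge> n2 \<and> N k > 0"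
    unfolding eventually_sequentially by blast
  let ?f = "\<lambda>v. airy_exp (of_real \<eta>) (Complex 1 v) * airy_cauchy (of_real \<xi>) (Complex 1 v)"
  have "(\<lambda>k. LINT v|lborel. line_fun (N (k + k0)) (mu (k + k0)) (lam (k + k0)) v) \<longlonglongrightarrow> (LINT v|lborel. ?f v)"
  proof (rule integral_dominated_convergence)
    have "continuous_on {z. Re z = 1} (airy_cauchy (of_real \<xi>))"
      using has_field_derivative_airy_cauchy by (intro continuous_at_imp_continuous_on) (auto intro: DERIV_isCont)
    then have "continuous_on UNIV (\<lambda>v. airy_cauchy (of_real \<xi>) (Complex 1 v))"
      by (rule continuous_on_Complex_line)
    moreover have "continuous_on UNIV (\<lambda>v. Complex 1 v)" by (simp add: Complex_eq continuous_intros)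
    ultimately have "continuous_on UNIV ?f" by (intro continuous_intros) auto
    then show "?f \<in> borel_measurable lborel" using borel_measurable_continuous_onI by auto
    show "integrable lborel (\<lambda>v::real. C * exp (- \<bar>v\<bar>) * K)" using integrable_exp_minus_abs by simp
    show "(\<lambda>v. line_fun (N (k + k0)) (mu (k + k0)) (lam (k + k0)) v) \<in> borel_measurable lborel" for k
    proof -
      have "N (k + k0) > 0" using k0[of "k + k0"] by simp
      then have "continuous_on UNIV (\<lambda>v. line_fun (N (k + k0)) (mu (k + k0)) (lam (k + k0)) v)"
        by (intro continuous_intros continuous_Af_line Bin_eq_residue_sum(2) nu0)
      then show ?thesis using borel_measurable_continuous_onI by auto
    qed
    show "AE v in lborel. (\<lambda>k. line_fun (N (k + k0)) (mu (k + k0)) (lam (k + k0)) v) \<longlonglongrightarrow> ?f v"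
    proof (rule AE_I2)
      fix v :: real
      have "(\<lambda>k. line_fun (N k) (mu k) (lam k) v) \<longlonglongrightarrow> ?f v"
        unfolding line_pt_def by (intro tendsto_mult Af_tendsto Bin_tendsto N lam mu nu0) auto
      then show "(\<lambda>k. line_fun (N (k + k0)) (mu (k + k0)) (lam (k + k0)) v) \<longlonglongrightarrow> ?f v"
        by (rule LIMSEQ_ignore_initial_segment)
    qed
    show "AE v in lborel. norm (line_fun (N (k + k0)) (mu (k + k0)) (lam (k + k0)) v) \<le> C * exp (- \<bar>v\<bar>) * K" for k
    proof (rule AE_I2)
      fix v :: real
      have a: "norm (Af (N (k + k0)) (mu (k + k0)) (line_pt (N (k + k0)) v)) \<le> C * exp (- \<bar>v\<bar>)"
        unfolding line_pt_def using k0[of "k + k0"] by (intro A(2)) auto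
      have "norm (Bin (N (k + k0)) (lam (k + k0)) v) \<le> K" using k0[of "k + k0"] by (intro B(3)) auto
      then show "norm (line_fun (N (k + k0)) (mu (k + k0)) (lam (k + k0)) v) \<le> C * exp (- \<bar>v\<bar>) * K"
        unfolding norm_mult using order_trans[OF norm_ge_zero a] by (intro mult_mono a) auto
    qed
  qed
  then have "(\<lambda>k. LINT v|lborel. line_fun (N k) (mu k) (lam k) v) \<longlonglongrightarrow> (LINT v|lborel. ?f v)"
    by (rule LIMSEQ_offset)
  then have "(\<lambda>k. (LINT v|lborel. line_fun (N k) (mu k) (lam k) v) / (2 * of_real pi)) \<longlonglongrightarrow> (LINT v|lborel. ?f v) / (2 * of_real pi)"
    by (intro tendsto_divide tendsto_const) auto
  then show ?thesis by (simp add: airy_double_def vertical_line_integral_def)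
qed

section \<open>Matching the constants of the statement\<close>

lemma kap_eq: "kap = 2 powr (1/3) * (real M + 1) powr (1/3) / real M"
  unfolding kap_def by (subst powr_mult) auto

text \<open>Hence adding \<open>c2 M * \<xi> / n powr (2/3)\<close> to \<open>x_star M\<close> is a
  relative displacement by exactly \<open>\<xi> / kk n\<close>.\<close>

lemma c2_eq: "c2 M = x_star M / kap"
proof -
  define m where "m = real M + 1"
  have m: "m > 0" "real M > 0" using M1 by (auto simp: m_def)
  have "kap * c2 M = (2 powr (1/3) * m powr (1/3) / real M) * (m powr (real M + 2/3) / (2 powr (1/3) * real M ^ (M - 1)))"
    by (simp only: kap_eq c2_def m_def)
  also have "\<dots> = (m powr (1/3) * m powr (real M + 2/3)) / (real M * real M ^ (M - 1))"
    by (simp add: field_simps)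
  also have "m powr (1/3) * m powr (real M + 2/3) = m powr (real (M + 1))"
    by (simp flip: powr_add)
  also have "\<dots> = m ^ (M + 1)" using m by (subst powr_realpow) auto
  also have "real M * real M ^ (M - 1) = real M ^ M" using M1 by (cases M) auto
  finally have "kap * c2 M = x_star M" by (simp only: x_star_def m_def)
  then show ?thesis using kap_pos by (simp add: nonzero_eq_divide_eq mult.commute)
qed

text \<open>The coefficient in the prefactor is that of \<open>\<xi> * n powr (1/3)\<close> in
  \<open>n * w0 * (\<xi> / kk n)\<close>, the leading part of the exponent left over in
  \<open>kernel_scaled\<close>.\<close>

lemma exponent_eq: "2 powr (- 1/3) * (real M + 1) powr (2/3) = w0 / kap"
proof -
  define m where "m = real M + 1"
  have m: "m > 0" "real M > 0" using M1 by (auto simp: m_def)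
  have "w0 / kap = (m / real M) / (2 powr (1/3) * m powr (1/3) / real M)"
  proof -
    have "w0 = m / real M" using m by (simp add: w0_def e_def m_def field_simps)
    then show ?thesis by (simp only: kap_eq m_def)
  qed
  also have "\<dots> = m / m powr (1/3) / 2 powr (1/3)" using m by (simp add: field_simps)
  also have "m / m powr (1/3) = m powr (1 - 1/3)" using m by (subst powr_diff) auto
  finally show ?thesis by (simp add: m_def powr_minus_divide)
qed

definition rho :: "nat \<Rightarrow> real \<Rightarrow> real" where "rho n \<xi> = \<xi> / kk n"

lemma point_eq:
  assumes "n > 0" "1 + rho n \<xi> > 0"
  shows "real n ^ M * (x_star M + c2 M * \<xi> / real n powr (2/3)) = exp (lX n + ln (1 + rho n \<xi>))"
proof -
  have "exp (lX n) = real n ^ M * x_star M"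
    using assms(1) x_star_eq(2) by (simp add: lX_def exp_add exp_of_nat_mult)
  then have "exp (lX n + ln (1 + rho n \<xi>)) = real n ^ M * x_star M * (1 + rho n \<xi>)"
    using assms by (simp add: exp_add)
  also have "\<dots> = real n ^ M * (x_star M + c2 M * \<xi> / real n powr (2/3))"
    using kap_pos by (simp add: rho_def kk_def c2_eq algebra_simps)
  finally show ?thesis by simp
qed

text \<open>All three limits rest on the quadratic error of ln (1 + x) \<approx> x. In the third
  this error is multiplied by \<open>n\<close>, but \<open>n / (kk n)\<^sup>2\<close> is still of
  order n^(-1/3), so the exponential prefactor is compensated up to a factor tending to 1.\<close>

lemma rho_asymp:
  assumes N: "filterlim N at_top sequentially" and X: "X \<longlonglongrightarrow> \<xi>"
  shows "(\<lambda>k. rho (N k) (X k)) \<longlonglongrightarrow> 0"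
    "(\<lambda>k. kk (N k) * ln (1 + rho (N k) (X k))) \<longlonglongrightarrow> \<xi>"
    "(\<lambda>k. real (N k) * w0 * ln (1 + rho (N k) (X k)) - w0 / kap * X k * real (N k) powr (1/3)) \<longlonglongrightarrow> 0"
proof -
  have kinv: "(\<lambda>n. 1 / kk n) \<longlonglongrightarrow> 0" unfolding kk_def using kap_pos by real_asymp
  have "(\<lambda>k. X k * (1 / kk (N k))) \<longlonglongrightarrow> \<xi> * 0"
    by (intro tendsto_mult X filterlim_compose[OF kinv N])
  then show r0: "(\<lambda>k. rho (N k) (X k)) \<longlonglongrightarrow> 0" by (simp add: rho_def)
  have N0: "\<forall>\<^sub>F k in sequentially. N k > 0"
    by (rule eventually_compose_filterlim[OF eventually_gt_at_top N])
  have "(\<lambda>k. \<bar>rho (N k) (X k)\<bar>) \<longlonglongrightarrow> 0" using tendsto_rabs[OF r0] by simp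
  then have "\<forall>\<^sub>F k in sequentially. \<bar>rho (N k) (X k)\<bar> < 1/2" by (rule order_tendstoD) simp
  with N0 have ev: "\<forall>\<^sub>F k in sequentially. N k > 0 \<and> \<bar>ln (1 + rho (N k) (X k)) - rho (N k) (X k)\<bar> \<le> 2 * (rho (N k) (X k))\<^sup>2"
    by eventually_elim (use abs_ln_one_plus_x_minus_x_bound in auto)
  have "(\<lambda>k. kk (N k) * ln (1 + rho (N k) (X k)) - X k) \<longlonglongrightarrow> 0"
  proof (rule Lim_null_comparison)
    have "(\<lambda>k. 2 * \<bar>X k\<bar> * \<bar>rho (N k) (X k)\<bar>) \<longlonglongrightarrow> 2 * \<bar>\<xi>\<bar> * \<bar>0\<bar>"
      by (intro tendsto_intros X r0)
    then show "(\<lambda>k. 2 * \<bar>X k\<bar> * \<bar>rho (N k) (X k)\<bar>) \<longlonglongrightarrow> 0" by simp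
    show "\<forall>\<^sub>F k in sequentially. norm (kk (N k) * ln (1 + rho (N k) (X k)) - X k) \<le> 2 * \<bar>X k\<bar> * \<bar>rho (N k) (X k)\<bar>"
      using ev
    proof eventually_elim
      case (elim k)
      have d: "kk (N k) > 0" using elim by (intro dl_kk) auto
      have Xr: "X k = kk (N k) * rho (N k) (X k)" using d by (simp add: rho_def)
      have "norm (kk (N k) * ln (1 + rho (N k) (X k)) - X k) = kk (N k) * \<bar>ln (1 + rho (N k) (X k)) - rho (N k) (X k)\<bar>"
        using d by (subst (2) Xr) (simp add: abs_mult flip: right_diff_distrib)
      also have "\<dots> \<le> kk (N k) * (2 * (rho (N k) (X k))\<^sup>2)" using d elim by (intro mult_left_mono) auto
      also have "\<dots> = 2 * \<bar>kk (N k) * rho (N k) (X k)\<bar> * \<bar>rho (N k) (X k)\<bar>" using d by (simp add: abs_mult power2_eq_square)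
      finally show ?case unfolding Xr[symmetric] .
    qed
  qed
  then show "(\<lambda>k. kk (N k) * ln (1 + rho (N k) (X k))) \<longlonglongrightarrow> \<xi>"
    using tendsto_add[OF _ X] by fastforce
  show "(\<lambda>k. real (N k) * w0 * ln (1 + rho (N k) (X k)) - w0 / kap * X k * real (N k) powr (1/3)) \<longlonglongrightarrow> 0"
  proof (rule Lim_null_comparison)
    have "(\<lambda>n. real n / (kk n)\<^sup>2) \<longlonglongrightarrow> 0" unfolding kk_def using kap_pos by real_asymp
    from filterlim_compose[OF this N]
    have "(\<lambda>k. 2 * w0 * (X k)\<^sup>2 * (real (N k) / (kk (N k))\<^sup>2)) \<longlonglongrightarrow> 2 * w0 * \<xi>\<^sup>2 * 0"
      by (intro tendsto_intros X)
    then show "(\<lambda>k. 2 * w0 * (X k)\<^sup>2 * (real (N k) / (kk (N k))\<^sup>2)) \<longlonglongrightarrow> 0" by simp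
    show "\<forall>\<^sub>F k in sequentially. norm (real (N k) * w0 * ln (1 + rho (N k) (X k)) - w0 / kap * X k * real (N k) powr (1/3)) \<le> 2 * w0 * (X k)\<^sup>2 * (real (N k) / (kk (N k))\<^sup>2)"
      using ev
    proof eventually_elim
      case (elim k)
      define n where "n = N k"
      have n: "n > 0" using elim by (simp add: n_def)
      have d: "kk n > 0" using n by (rule dl_kk)
      have "real n = real n powr (1/3) * real n powr (2/3)" using n by (simp flip: powr_add)
      then have "real n / kk n = (real n powr (1/3) * real n powr (2/3)) / (kap * real n powr (2/3))" by (simp add: kk_def)
      then have nk: "real n / kk n = real n powr (1/3) / kap" using n by simp
      have "w0 / kap * X k * real n powr (1/3) = w0 * X k * (real n powr (1/3) / kap)" by simp
      also have "\<dots> = real n * w0 * rho n (X k)" unfolding nk[symmetric] by (simp add: rho_def)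
      finally have eq: "w0 / kap * X k * real n powr (1/3) = real n * w0 * rho n (X k)" .
      have "norm (real n * w0 * ln (1 + rho n (X k)) - w0 / kap * X k * real n powr (1/3)) = real n * w0 * \<bar>ln (1 + rho n (X k)) - rho n (X k)\<bar>"
        unfolding eq using e_bounds by (simp add: abs_mult flip: right_diff_distrib)
      also have "\<dots> \<le> real n * w0 * (2 * (rho n (X k))\<^sup>2)" using elim e_bounds by (intro mult_left_mono) (auto simp: n_def)
      also have "\<dots> = 2 * w0 * (X k)\<^sup>2 * (real n / (kk n)\<^sup>2)" by (simp add: rho_def power_divide)
      finally show ?case by (simp add: n_def)
    qed
  qed
qed

definition kernel_normalized :: "(nat \<Rightarrow> real \<Rightarrow> complex) \<Rightarrow> nat \<Rightarrow> real \<times> real \<Rightarrow> complex" where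
  "kernel_normalized \<gamma> = (\<lambda>n (\<xi>, \<eta>).
       complex_of_real
         (exp (- (2 powr (-1/3)) * (real M + 1) powr (2/3) * \<xi> * real n powr (1/3)) /
          exp (- (2 powr (-1/3)) * (real M + 1) powr (2/3) * \<eta> * real n powr (1/3)) *
          real n powr (real M - 2/3) * c2 M) *
       product_kernel M \<nu> n (\<gamma> n)
         (real n ^ M * (x_star M + c2 M * \<xi> / real n powr (2/3)))
         (real n ^ M * (x_star M + c2 M * \<eta> / real n powr (2/3))))"

lemma kernel_normalized_eq:
  assumes nu0: "\<nu> 0 = 0" and n: "n > 0" and \<gamma>: "kernel_contour n (\<gamma> n)"
    and pos: "1 + rho n \<xi> > 0" "1 + rho n \<eta> > 0"
  shows "kernel_normalized \<gamma> n (\<xi>, \<eta>) =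
    of_real (exp ((real n * w0 * ln (1 + rho n \<xi>) - w0 / kap * \<xi> * real n powr (1/3)) -
                  (real n * w0 * ln (1 + rho n \<eta>) - w0 / kap * \<eta> * real n powr (1/3))) / (1 + rho n \<eta>)) *
    ((LINT v|lborel. Af n (ln (1 + rho n \<eta>)) (line_pt n v) * Bin n (ln (1 + rho n \<xi>)) v) / (2 * of_real pi))"
proof -
  define lam mu where "lam = ln (1 + rho n \<xi>)" and "mu = ln (1 + rho n \<eta>)"
  define p where "p = real n powr (1/3)"
  have a: "- (2 powr (-1/3)) * (real M + 1) powr (2/3) * z * p = - (w0 / kap * z * p)" for z
    using exponent_eq by (simp add: algebra_simps)
  have ey: "exp (lX n + mu) = real n ^ M * x_star M * (1 + rho n \<eta>)"
  proof -
    have "exp (lX n) = real n ^ M * x_star M"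
      using n x_star_eq(2) by (simp add: lX_def exp_add exp_of_nat_mult)
    then show ?thesis using pos by (simp add: exp_add mu_def)
  qed
  \<comment> \<open>The power of \<open>n\<close> and \<open>c2\<close> cancel against the Jacobian
    \<open>kk n\<close> and the factor 1 / y of the kernel; only the relative displacement of y
    remains.\<close>
  have "real n powr (real M - 2/3) * c2 M * (kk n / exp (lX n + mu)) = 1 / (1 + rho n \<eta>)"
  proof -
    have "real n powr (real M - 2/3) * kk n = kap * real n ^ M"
      using n by (simp add: kk_def powr_realpow mult.left_commute flip: powr_add)
    then have "real n powr (real M - 2/3) * c2 M * (kk n / exp (lX n + mu)) = kap * real n ^ M * c2 M / exp (lX n + mu)"
      by (simp add: mult_ac)
    also have "\<dots> = 1 / (1 + rho n \<eta>)"
      unfolding ey c2_eq using n x_star_eq(2) kap_pos pos by simp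
    finally show ?thesis .
  qed
  then have pre: "exp (- (w0 / kap * \<xi> * p)) / exp (- (w0 / kap * \<eta> * p)) * real n powr (real M - 2/3) * c2 M * (kk n / exp (lX n + mu) * exp (real n * w0 * (lam - mu)))
     = exp ((real n * w0 * lam - w0 / kap * \<xi> * p) - (real n * w0 * mu - w0 / kap * \<eta> * p)) / (1 + rho n \<eta>)"
  proof -
    assume h: "real n powr (real M - 2/3) * c2 M * (kk n / exp (lX n + mu)) = 1 / (1 + rho n \<eta>)"
    have "exp (- (w0 / kap * \<xi> * p)) / exp (- (w0 / kap * \<eta> * p)) * real n powr (real M - 2/3) * c2 M * (kk n / exp (lX n + mu) * exp (real n * w0 * (lam - mu)))
      = (exp (- (w0 / kap * \<xi> * p)) / exp (- (w0 / kap * \<eta> * p)) * exp (real n * w0 * (lam - mu))) * (real n powr (real M - 2/3) * c2 M * (kk n / exp (lX n + mu)))"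
      by (simp only: mult_ac)
    also have "exp (- (w0 / kap * \<xi> * p)) / exp (- (w0 / kap * \<eta> * p)) * exp (real n * w0 * (lam - mu)) = exp ((real n * w0 * lam - w0 / kap * \<xi> * p) - (real n * w0 * mu - w0 / kap * \<eta> * p))"
      by (simp add: algebra_simps flip: exp_add exp_diff)
    finally show ?thesis unfolding h by simp
  qed
  show ?thesis
    unfolding kernel_normalized_def prod.case point_eq[OF n pos(1)] point_eq[OF n pos(2)] kernel_scaled[OF nu0 n \<gamma>]
      p_def[symmetric] a lam_def[symmetric] mu_def[symmetric] mult.assoc[symmetric] of_real_mult[symmetric]
    unfolding pre[unfolded mult.assoc[symmetric]] by (simp only: times_divide_eq_right)
qed

lemma kernel_normalized_tendsto:
  assumes nu0: "\<nu> 0 = 0" and \<gamma>: "\<And>n. n \<ge> 1 \<Longrightarrow> kernel_contour n (\<gamma> n)"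
    and N: "filterlim N at_top sequentially" and Z: "Z \<longlonglongrightarrow> (\<xi>, \<eta>)"
  shows "(\<lambda>k. kernel_normalized \<gamma> (N k) (Z k)) \<longlonglongrightarrow> airy_double (of_real \<xi>) (of_real \<eta>)"
proof -
  define X Y where "X k = fst (Z k)" and "Y k = snd (Z k)" for k
  have X: "X \<longlonglongrightarrow> \<xi>" and Y: "Y \<longlonglongrightarrow> \<eta>"
    using tendsto_fst[OF Z] tendsto_snd[OF Z] by (simp_all add: X_def[abs_def] Y_def[abs_def])
  note rX = rho_asymp[OF N X] and rY = rho_asymp[OF N Y]
  have ev: "\<forall>\<^sub>F k in sequentially. N k \<ge> 1 \<and> rho (N k) (X k) > -1 \<and> rho (N k) (Y k) > -1"
    by (intro eventually_conj eventually_compose_filterlim[OF eventually_ge_at_top N] order_tendstoD(1)[OF rX(1)] order_tendstoD(1)[OF rY(1)]) auto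
  let ?E = "\<lambda>X k. real (N k) * w0 * ln (1 + rho (N k) (X k)) - w0 / kap * X k * real (N k) powr (1/3)"
  have "(\<lambda>k. of_real (exp (?E X k - ?E Y k) / (1 + rho (N k) (Y k))) *
     ((LINT v|lborel. Af (N k) (ln (1 + rho (N k) (Y k))) (line_pt (N k) v) * Bin (N k) (ln (1 + rho (N k) (X k))) v) / (2 * of_real pi)))
     \<longlonglongrightarrow> of_real (exp (0 - 0) / (1 + 0)) * airy_double (of_real \<xi>) (of_real \<eta>)"
    by (intro tendsto_mult tendsto_of_real tendsto_divide tendsto_exp tendsto_diff tendsto_add tendsto_const rX(3) rY(3) rY(1) line_integral_tendsto[OF nu0 N rX(2) rY(2)]) auto
  then have "(\<lambda>k. of_real (exp (?E X k - ?E Y k) / (1 + rho (N k) (Y k))) *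
     ((LINT v|lborel. Af (N k) (ln (1 + rho (N k) (Y k))) (line_pt (N k) v) * Bin (N k) (ln (1 + rho (N k) (X k))) v) / (2 * of_real pi)))
     \<longlonglongrightarrow> airy_double (of_real \<xi>) (of_real \<eta>)"
    by simp
  then show ?thesis
  proof (rule Lim_transform_eventually)
    show "\<forall>\<^sub>F k in sequentially. of_real (exp (?E X k - ?E Y k) / (1 + rho (N k) (Y k))) *
     ((LINT v|lborel. Af (N k) (ln (1 + rho (N k) (Y k))) (line_pt (N k) v) * Bin (N k) (ln (1 + rho (N k) (X k))) v) / (2 * of_real pi)) = kernel_normalized \<gamma> (N k) (Z k)"
      using ev
    proof eventually_elim
      case (elim k)
      have "kernel_normalized \<gamma> (N k) (X k, Y k) = of_real (exp (?E X k - ?E Y k) / (1 + rho (N k) (Y k))) *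
        ((LINT v|lborel. Af (N k) (ln (1 + rho (N k) (Y k))) (line_pt (N k) v) * Bin (N k) (ln (1 + rho (N k) (X k))) v) / (2 * of_real pi))"
        by (rule kernel_normalized_eq[OF nu0 _ \<gamma>]) (use elim in auto)
      then show ?case by (simp add: X_def Y_def)
    qed
  qed
qed

end

section \<open>Identification with the Airy kernel\<close>

text \<open>Off the diagonal this is the integration by parts identity divided by
  \<open>x - y\<close>. On the diagonal the limit in the definition is evaluated by continuity of
  the double integral, which comes from convergence along arbitrary sequences.\<close>

lemma Airy_kernel_eq:
  assumes cont: "isCont (\<lambda>z. airy_double (of_real (fst z)) (of_real (snd z))) (x, y)"
  shows "Airy_kernel x y = airy_double (of_real x) (of_real y)"
proof -
  have quot: "Airy_quotient u v = airy_double (of_real u) (of_real v)" if "u \<noteq> v" for u v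
  proof -
    show ?thesis
      unfolding Airy_quotient_def airy_double_eq[symmetric] using that by simp
  qed
  show ?thesis
  proof (cases "x = y")
    case False
    then show ?thesis by (simp add: Airy_kernel_def quot)
  next
    case True
    let ?F = "at (x, x) within {(u, v). u \<noteq> v}"
    \<comment> \<open>This makes the filter proper, so that \<open>Lim\<close> is determined by
      convergence.\<close>
    have "(x, x) islimpt {(u, v). u \<noteq> v}"
      unfolding islimpt_approachable
    proof (intro allI impI)
      fix \<epsilon> :: real assume "\<epsilon> > 0"
      then show "\<exists>z\<in>{(u, v). u \<noteq> v}. z \<noteq> (x, x) \<and> dist z (x, x) < \<epsilon>"
        by (intro bexI[of _ "(x + \<epsilon> / 2, x)"]) (auto simp: dist_Pair_Pair dist_real_def)
    qed
    then have nt: "?F \<noteq> bot" by (simp add: trivial_limit_within)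
    have "((\<lambda>z. airy_double (of_real (fst z)) (of_real (snd z))) \<longlongrightarrow> airy_double (of_real x) (of_real x)) ?F"
      using cont True unfolding isCont_def by (auto intro: tendsto_within_subset)
    then have "((\<lambda>(u, v). Airy_quotient u v) \<longlongrightarrow> airy_double (of_real x) (of_real x)) ?F"
    proof (rule Lim_transform_eventually)
      show "\<forall>\<^sub>F z in ?F. airy_double (of_real (fst z)) (of_real (snd z)) = (case z of (u, v) \<Rightarrow> Airy_quotient u v)"
        unfolding eventually_at by (intro exI[of _ 1]) (auto simp: quot)
    qed
    then show ?thesis using True tendsto_Lim[OF nt] by (simp add: Airy_kernel_def)
  qed
qed

theorem theorem1p2:
  fixes M :: nat and \<nu> :: "nat \<Rightarrow> nat" and \<gamma> :: "nat \<Rightarrow> real \<Rightarrow> complex" and S :: "real set"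
  assumes "M \<ge> 1"
    and "\<nu> 0 = 0"
    and "\<And>n. n \<ge> 1 \<Longrightarrow> kernel_contour n (\<gamma> n)"
    and "compact S"
  shows "uniform_limit (S \<times> S)
    (\<lambda>n (\<xi>, \<eta>).
       complex_of_real
         (exp (- (2 powr (-1/3)) * (real M + 1) powr (2/3) * \<xi> * real n powr (1/3)) /
          exp (- (2 powr (-1/3)) * (real M + 1) powr (2/3) * \<eta> * real n powr (1/3)) *
          real n powr (real M - 2/3) * c2 M) *
       product_kernel M \<nu> n (\<gamma> n)
         (real n ^ M * (x_star M + c2 M * \<xi> / real n powr (2/3)))
         (real n ^ M * (x_star M + c2 M * \<eta> / real n powr (2/3))))
    (\<lambda>(\<xi>, \<eta>). Airy_kernel \<xi> \<eta>)
    sequentially"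
proof -
  interpret ginibre_product M \<nu> by unfold_locales fact
  define J where "J = (\<lambda>z. airy_double (of_real (fst z)) (of_real (snd z)))"
  have core: "(\<lambda>k. kernel_normalized \<gamma> (N k) (Z k)) \<longlonglongrightarrow> J w"
    if "filterlim N at_top sequentially" "Z \<longlonglongrightarrow> w" for N Z w
    using kernel_normalized_tendsto[of \<gamma> N Z "fst w" "snd w"] assms that by (simp add: J_def)
  have "uniform_limit (S \<times> S) (kernel_normalized \<gamma>) J sequentially"
    by (rule continuous_convergence(2)[OF core]) (use assms in \<open>auto intro: compact_Times\<close>)
  moreover have "J = (\<lambda>(\<xi>, \<eta>). Airy_kernel \<xi> \<eta>)"
  proof
    fix z
    have "isCont J z"
      by (rule continuous_convergence(1)[where f = "kernel_normalized \<gamma>"]) (rule core)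
    then show "J z = (case z of (\<xi>, \<eta>) \<Rightarrow> Airy_kernel \<xi> \<eta>)"
      using Airy_kernel_eq[of "fst z" "snd z"] by (simp add: J_def case_prod_beta)
  qed
  ultimately show ?thesis by (simp only: kernel_normalized_def)
qed

end
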